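(* Let $G$ be a run-length straight-line program (RLSLP) generating a string $w$ of length $n$. Then one can construct, in time $\mathcal{O}(|G|)$, an RLSLP $G'$ generating the same string $w$, such that $G'$ has size $\mathcal{O}(|G|)$, $G'$ is balanced (its depth is $\mathcal{O}(\log n)$), and every rule of $G'$ is of one of the forms $A\rightarrow a$, $A\rightarrow BC$, or $A\rightarrow B^t$, where $a$ is a terminal symbol, $B$ and $C$ are variables, and $t>2$ is an integer.
   Context: A straight-line program (SLP) is a context-free grammar in which each variable has exactly one rule, the variables can be ordered so that the right-hand side of each variable's rule mentions only terminals and strictly smaller variables, and the start variable is the largest; each variable $A$ thus derives a unique string $\exp{A}$, and the grammar generates the string derived by its start variable. A run-length straight-line program (RLSLP) is such a grammar whose rules have one of the forms: $A\rightarrow a$ ($a$ a terminal), $A\rightarrow A_1A_2\cdots A_k$ with $k>1$ variables $A_i$, or $A\rightarrow B^t$ for an integer $t>2$, the latter deriving $\exp{A}=\exp{B}^t$ (the concatenation of $t$ copies of $\exp{B}$). The size $|G|$ of an RLSLP is the sum of the lengths of the right-hand sides of its rules, where a run-length rule $A\rightarrow B^t$ counts as size 2. The depth of an RLSLP is the height of the parse tree of the SLP obtained by replacing every run-length rule $A\rightarrow B^t$ by the rule $A\rightarrow B B\cdots B$ with $t$ copies of $B$. Two grammars are equivalent if they generate the same string. *)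

theory Defs
  imports Complex_Main
begin

section \<open>Run-length straight-line programs\<close>

text \<open>
  The variables of a grammar with \<open>m\<close> rules are the numbers below \<open>m\<close>; variable \<open>A\<close> has the
  single rule whose right-hand side is entry \<open>A\<close> of the rule list. The numbering of the variables
  is arbitrary: it need not be compatible with the order required in \<open>is_rlslp\<close>.
\<close>

datatype 'a rhs =
    Term 'a
  | Vars "nat list"
  | Power nat nat \<comment> \<open>\<open>Power B t\<close> stands for \<open>B\<^sup>t\<close>\<close>

record 'a rlslp =
  rules :: "'a rhs list"
  start :: nat

fun rhs_vars :: "'a rhs \<Rightarrow> nat set" where
  "rhs_vars (Term a) = {}"
| "rhs_vars (Vars Bs) = set Bs"
| "rhs_vars (Power B t) = {B}"

fun rlslp_rhs :: "'a rhs \<Rightarrow> bool" where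
  "rlslp_rhs (Term a) \<longleftrightarrow> True"
| "rlslp_rhs (Vars Bs) \<longleftrightarrow> length Bs > 1"
| "rlslp_rhs (Power B t) \<longleftrightarrow> t > 2"

text \<open>The linear order on the variables is given by an injective ranking \<open>r\<close>.\<close>

definition acyclic_grammar :: "'a rlslp \<Rightarrow> bool" where
  "acyclic_grammar G \<longleftrightarrow>
     start G < length (rules G) \<and>
     (\<forall>A < length (rules G). \<forall>B \<in> rhs_vars (rules G ! A). B < length (rules G)) \<and>
     (\<exists>r :: nat \<Rightarrow> nat. inj_on r {..<length (rules G)} \<and>
        (\<forall>A < length (rules G). \<forall>B \<in> rhs_vars (rules G ! A). r B < r A) \<and>
        (\<forall>A < length (rules G). A \<noteq> start G \<longrightarrow> r A < r (start G)))"

definition is_rlslp :: "'a rlslp \<Rightarrow> bool" where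
  "is_rlslp G \<longleftrightarrow> acyclic_grammar G \<and> (\<forall>R \<in> set (rules G). rlslp_rhs R)"

inductive derives :: "'a rlslp \<Rightarrow> nat \<Rightarrow> 'a list \<Rightarrow> bool" for G where
  derives_Term:
    "A < length (rules G) \<Longrightarrow> rules G ! A = Term a \<Longrightarrow> derives G A [a]"
| derives_Vars:
    "A < length (rules G) \<Longrightarrow> rules G ! A = Vars Bs \<Longrightarrow> list_all2 (derives G) Bs us
     \<Longrightarrow> derives G A (concat us)"
| derives_Power:
    "A < length (rules G) \<Longrightarrow> rules G ! A = Power B t \<Longrightarrow> derives G B u
     \<Longrightarrow> derives G A (concat (replicate t u))"

definition generates :: "'a rlslp \<Rightarrow> 'a list \<Rightarrow> bool" where
  "generates G w \<longleftrightarrow> derives G (start G) w"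

fun rhs_size :: "'a rhs \<Rightarrow> nat" where
  "rhs_size (Term a) = 1"
| "rhs_size (Vars Bs) = length Bs"
| "rhs_size (Power B t) = 2"

definition grammar_size :: "'a rlslp \<Rightarrow> nat" where
  "grammar_size G = (\<Sum>R\<leftarrow>rules G. rhs_size R)"


section \<open>Depth\<close>

fun unroll_rhs :: "'a rhs \<Rightarrow> 'a rhs" where
  "unroll_rhs (Power B t) = Vars (replicate t B)"
| "unroll_rhs R = R"

definition unroll :: "'a rlslp \<Rightarrow> 'a rlslp" where
  "unroll G = \<lparr>rules = map unroll_rhs (rules G), start = start G\<rparr>"

datatype 'a tree = Leaf 'a | Node nat "'a tree list"

text \<open>There is no clause for \<open>Power\<close>: parse trees are only used for unrolled grammars.\<close>

inductive parse_tree :: "'a rlslp \<Rightarrow> nat \<Rightarrow> 'a tree \<Rightarrow> bool" for G where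
  "A < length (rules G) \<Longrightarrow> rules G ! A = Term a \<Longrightarrow> parse_tree G A (Node A [Leaf a])"
| "A < length (rules G) \<Longrightarrow> rules G ! A = Vars Bs \<Longrightarrow> list_all2 (parse_tree G) Bs Ts
     \<Longrightarrow> parse_tree G A (Node A Ts)"

primrec height :: "'a tree \<Rightarrow> nat" where
  "height (Leaf a) = 0"
| "height (Node A Ts) = Suc (Max (set (map height Ts)))"

definition depth :: "'a rlslp \<Rightarrow> nat" where
  "depth G = height (THE T. parse_tree (unroll G) (start G) T)"

fun normal_rhs :: "'a rhs \<Rightarrow> bool" where
  "normal_rhs (Term a) \<longleftrightarrow> True"
| "normal_rhs (Vars Bs) \<longleftrightarrow> length Bs = 2"
| "normal_rhs (Power B t) \<longleftrightarrow> t > 2"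


section \<open>Well-definedness of the derived string and of the parse tree\<close>

lemma list_all2_unique:
  assumes "\<And>B. B \<in> set Bs \<Longrightarrow> \<exists>!x. P B x"
  shows "\<exists>!xs. list_all2 P Bs xs"
  using assms
proof (induction Bs)
  case Nil
  then show ?case by auto
next
  case (Cons B Bs)
  have "\<exists>!xs. list_all2 P Bs xs"
    by (rule Cons.IH) (simp add: Cons.prems)
  then obtain xs where
    xs: "list_all2 P Bs xs" "\<And>ys. list_all2 P Bs ys \<Longrightarrow> ys = xs" by auto
  from Cons.prems[of B] obtain x where x: "P B x" "\<And>y. P B y \<Longrightarrow> y = x" by auto
  show ?case
  proof (rule ex1I[of _ "x # xs"])
    show "list_all2 P (B # Bs) (x # xs)" using x(1) xs(1) by simp
    fix zs
    assume "list_all2 P (B # Bs) zs"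
    then obtain z ys where "zs = z # ys" "P B z" "list_all2 P Bs ys"
      unfolding list_all2_Cons1 by blast
    with x(2) xs(2) show "zs = x # xs" by blast
  qed
qed

lemma acyclic_grammar_induct:
  assumes G: "acyclic_grammar G" and A: "A < length (rules G)"
    and step: "\<And>A. A < length (rules G) \<Longrightarrow> (\<And>B. B \<in> rhs_vars (rules G ! A) \<Longrightarrow> P B) \<Longrightarrow> P A"
  shows "P A"
proof -
  from G obtain r :: "nat \<Rightarrow> nat" where
    r: "\<And>A B. A < length (rules G) \<Longrightarrow> B \<in> rhs_vars (rules G ! A) \<Longrightarrow> B < length (rules G) \<and> r B < r A"
    unfolding acyclic_grammar_def by blast
  show ?thesis
    using A
  proof (induction "r A" arbitrary: A rule: less_induct)
    case less
    show ?case
    proof (rule step[OF less.prems])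
      fix B
      assume "B \<in> rhs_vars (rules G ! A)"
      with r[OF less.prems] show "P B" by (intro less.hyps) auto
    qed
  qed
qed

lemma derives_unique:
  assumes G: "acyclic_grammar G" and A: "A < length (rules G)"
  shows "\<exists>!w. derives G A w"
  using G A
proof (rule acyclic_grammar_induct)
  fix A
  assume A: "A < length (rules G)"
    and IH: "\<And>B. B \<in> rhs_vars (rules G ! A) \<Longrightarrow> \<exists>!w. derives G B w"
  show "\<exists>!w. derives G A w"
  proof (cases "rules G ! A")
    case (Term a)
    with A have "derives G A w \<longleftrightarrow> w = [a]" for w
      by (subst derives.simps) simp
    then show ?thesis by simp
  next
    case (Vars Bs)
    with A have *: "derives G A w \<longleftrightarrow> (\<exists>us. w = concat us \<and> list_all2 (derives G) Bs us)" for w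
      by (subst derives.simps) auto
    from Vars IH have "\<exists>!us. list_all2 (derives G) Bs us"
      by (intro list_all2_unique) auto
    with * show ?thesis by metis
  next
    case (Power B t)
    with A have *: "derives G A w \<longleftrightarrow> (\<exists>u. w = concat (replicate t u) \<and> derives G B u)" for w
      by (subst derives.simps) auto
    from Power IH have "\<exists>!u. derives G B u" by simp
    with * show ?thesis by metis
  qed
qed

lemma acyclic_grammar_unroll:
  assumes "acyclic_grammar G"
  shows "acyclic_grammar (unroll G)"
proof -
  have sub: "rhs_vars (unroll_rhs R) \<subseteq> rhs_vars R" for R :: "'a rhs"
    by (cases R) auto
  have *: "rhs_vars (rules (unroll G) ! A) \<subseteq> rhs_vars (rules G ! A)"
    if "A < length (rules G)" for A
    using that sub by (simp add: unroll_def)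
  have [simp]: "length (rules (unroll G)) = length (rules G)" "start (unroll G) = start G"
    by (simp_all add: unroll_def)
  from assms obtain r :: "nat \<Rightarrow> nat" where r: "start G < length (rules G)"
    "\<And>A B. A < length (rules G) \<Longrightarrow> B \<in> rhs_vars (rules G ! A) \<Longrightarrow> B < length (rules G)"
    "inj_on r {..<length (rules G)}"
    "\<And>A B. A < length (rules G) \<Longrightarrow> B \<in> rhs_vars (rules G ! A) \<Longrightarrow> r B < r A"
    "\<And>A. A < length (rules G) \<Longrightarrow> A \<noteq> start G \<Longrightarrow> r A < r (start G)"
    unfolding acyclic_grammar_def by blast
  show ?thesis
    unfolding acyclic_grammar_def
  proof (intro conjI exI[of _ r] allI impI ballI)
    fix A B
    assume "A < length (rules (unroll G))" "B \<in> rhs_vars (rules (unroll G) ! A)"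
    then have "A < length (rules G)" "B \<in> rhs_vars (rules G ! A)"
      using * by auto
    then show "B < length (rules (unroll G))" "r B < r A"
      using r(2,4) by auto
  qed (use r in simp_all)
qed

lemma parse_tree_unique:
  assumes G: "acyclic_grammar G" and A: "A < length (rules G)"
  shows "\<exists>!T. parse_tree (unroll G) A T"
proof -
  have "A < length (rules (unroll G))" using A by (simp add: unroll_def)
  with acyclic_grammar_unroll[OF G] show ?thesis
  proof (rule acyclic_grammar_induct)
    fix A
    assume A: "A < length (rules (unroll G))"
      and IH: "\<And>B. B \<in> rhs_vars (rules (unroll G) ! A) \<Longrightarrow> \<exists>!T. parse_tree (unroll G) B T"
    show "\<exists>!T. parse_tree (unroll G) A T"
    proof (cases "rules (unroll G) ! A")
      case (Term a)
      with A have "parse_tree (unroll G) A T \<longleftrightarrow> T = Node A [Leaf a]" for T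
        by (subst parse_tree.simps) simp
      then show ?thesis by simp
    next
      case (Vars Bs)
      with A have *: "parse_tree (unroll G) A T \<longleftrightarrow>
          (\<exists>Ts. T = Node A Ts \<and> list_all2 (parse_tree (unroll G)) Bs Ts)" for T
        by (subst parse_tree.simps) auto
      from Vars IH have "\<exists>!Ts. list_all2 (parse_tree (unroll G)) Bs Ts"
        by (intro list_all2_unique) auto
      with * show ?thesis by metis
    next
      case (Power B t)
      have "unroll_rhs R \<noteq> Power B t" for R :: "'a rhs" by (cases R) auto
      with A Power show ?thesis by (simp add: unroll_def)
    qed
  qed
qed


section \<open>Word RAM\<close>

text \<open>
  A unit-cost random access machine with words of \<open>wl\<close> bits, programmed in a structured language.
  A program uses finitely many registers and finitely many arrays; all numbers that
  it computes are reduced modulo \<open>2 ^ wl\<close>, and every operation, register access, array access and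
  test costs one unit of time.
\<close>

datatype binop = Add | Sub | Mul | Div | Mod | And | Or | Xor | Shl | Shr | Eq | Less

datatype expr =
    Const nat
  | Reg nat
  | Get nat expr \<comment> \<open>\<open>Get a e\<close>: the entry of array \<open>a\<close> at index \<open>e\<close>\<close>
  | Bin binop expr expr

datatype com =
    Skip
  | Set nat expr
  | Put nat expr expr \<comment> \<open>\<open>Put a e f\<close>: store \<open>f\<close> in array \<open>a\<close> at index \<open>e\<close>\<close>
  | Seq com com
  | If expr com com
  | While expr com

record state =
  reg :: "nat \<Rightarrow> nat"
  arr :: "nat \<Rightarrow> nat \<Rightarrow> nat"

text \<open>\<open>Sub\<close> is truncated at \<open>0\<close>; the comparisons return \<open>0\<close> or \<open>1\<close>.\<close>

fun apply_op :: "binop \<Rightarrow> nat \<Rightarrow> nat \<Rightarrow> nat" where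
  "apply_op Add x y = x + y"
| "apply_op Sub x y = x - y"
| "apply_op Mul x y = x * y"
| "apply_op Div x y = x div y"
| "apply_op Mod x y = x mod y"
| "apply_op And x y = Bit_Operations.and x y"
| "apply_op Or x y = Bit_Operations.or x y"
| "apply_op Xor x y = Bit_Operations.xor x y"
| "apply_op Shl x y = push_bit y x"
| "apply_op Shr x y = drop_bit y x"
| "apply_op Eq x y = of_bool (x = y)"
| "apply_op Less x y = of_bool (x < y)"

fun val :: "nat \<Rightarrow> state \<Rightarrow> expr \<Rightarrow> nat" where
  "val wl s (Const c) = c mod 2 ^ wl"
| "val wl s (Reg r) = reg s r"
| "val wl s (Get a e) = arr s a (val wl s e)"
| "val wl s (Bin f e1 e2) = apply_op f (val wl s e1) (val wl s e2) mod 2 ^ wl"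

fun cost :: "expr \<Rightarrow> nat" where
  "cost (Const c) = 1"
| "cost (Reg r) = 1"
| "cost (Get a e) = cost e + 1"
| "cost (Bin f e1 e2) = cost e1 + cost e2 + 1"

definition set_reg :: "nat \<Rightarrow> nat \<Rightarrow> state \<Rightarrow> state" where
  "set_reg r v s = s\<lparr>reg := (reg s)(r := v)\<rparr>"

definition set_arr :: "nat \<Rightarrow> nat \<Rightarrow> nat \<Rightarrow> state \<Rightarrow> state" where
  "set_arr a i v s = s\<lparr>arr := (arr s)(a := (arr s a)(i := v))\<rparr>"

text \<open>\<open>exec wl P s T s'\<close>: started in \<open>s\<close>, program \<open>P\<close> halts in \<open>s'\<close> after \<open>T\<close> units of time.\<close>

inductive exec :: "nat \<Rightarrow> com \<Rightarrow> state \<Rightarrow> nat \<Rightarrow> state \<Rightarrow> bool" for wl where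
  "exec wl Skip s 1 s"
| "exec wl (Set r e) s (cost e + 1) (set_reg r (val wl s e) s)"
| "exec wl (Put a e f) s (cost e + cost f + 1) (set_arr a (val wl s e) (val wl s f) s)"
| "exec wl P s T s' \<Longrightarrow> exec wl Q s' T' s'' \<Longrightarrow> exec wl (Seq P Q) s (T + T') s''"
| "val wl s e \<noteq> 0 \<Longrightarrow> exec wl P s T s' \<Longrightarrow> exec wl (If e P Q) s (cost e + 1 + T) s'"
| "val wl s e = 0 \<Longrightarrow> exec wl Q s T s' \<Longrightarrow> exec wl (If e P Q) s (cost e + 1 + T) s'"
| "val wl s e = 0 \<Longrightarrow> exec wl (While e P) s (cost e + 1) s"
| "val wl s e \<noteq> 0 \<Longrightarrow> exec wl P s T s' \<Longrightarrow> exec wl (While e P) s' T' s''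
     \<Longrightarrow> exec wl (While e P) s (cost e + 1 + T + T') s''"


section \<open>Grammars as input and output of the machine\<close>

text \<open>
  The machine handles grammars whose terminals are natural numbers. Register 0 holds the
  number of rules and register 1 the start variable. Array 0 holds the kinds of the rules, array 2
  the concatenation of the right-hand sides, and array 1 the positions in array 2 at which the
  right-hand sides begin, followed by the total length, which is the size of the grammar.
\<close>

fun rhs_kind :: "nat rhs \<Rightarrow> nat" where
  "rhs_kind (Term a) = 0"
| "rhs_kind (Vars Bs) = 1"
| "rhs_kind (Power B t) = 2"

fun rhs_cells :: "nat rhs \<Rightarrow> nat list" where
  "rhs_cells (Term a) = [a]"
| "rhs_cells (Vars Bs) = Bs"
| "rhs_cells (Power B t) = [B, t]"

definition kinds :: "nat rlslp \<Rightarrow> nat list" where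
  "kinds G = map rhs_kind (rules G)"

definition offsets :: "nat rlslp \<Rightarrow> nat list" where
  "offsets G = map (\<lambda>i. \<Sum>R\<leftarrow>take i (rules G). rhs_size R) [0..<Suc (length (rules G))]"

definition cells :: "nat rlslp \<Rightarrow> nat list" where
  "cells G = concat (map rhs_cells (rules G))"

definition array_holds :: "(nat \<Rightarrow> nat) \<Rightarrow> nat list \<Rightarrow> bool" where
  "array_holds f xs \<longleftrightarrow> (\<forall>i < length xs. f i = xs ! i)"

definition holds_grammar :: "state \<Rightarrow> nat rlslp \<Rightarrow> bool" where
  "holds_grammar s G \<longleftrightarrow>
     reg s 0 = length (rules G) \<and> reg s 1 = start G \<and>
     array_holds (arr s 0) (kinds G) \<and>
     array_holds (arr s 1) (offsets G) \<and>
     array_holds (arr s 2) (cells G)"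

definition zero_padded :: "nat list \<Rightarrow> nat \<Rightarrow> nat" where
  "zero_padded xs i = (if i < length xs then xs ! i else 0)"

definition initial :: "nat rlslp \<Rightarrow> state" where
  "initial G =
     \<lparr>reg = zero_padded [length (rules G), start G],
      arr = (\<lambda>_ _. 0)(0 := zero_padded (kinds G),
                       1 := zero_padded (offsets G),
                       2 := zero_padded (cells G))\<rparr>"

lemma holds_grammar_initial: "holds_grammar (initial G) G"
  by (simp add: holds_grammar_def initial_def array_holds_def zero_padded_def)

text \<open>
  A word length with which the problem can be stated at all: \<open>b\<close> bits suffice for the number \<open>n\<close>,
  for the size of the grammar (hence for its variables) and for its terminals and exponents.
\<close>

definition fits :: "nat \<Rightarrow> nat \<Rightarrow> nat rlslp \<Rightarrow> bool" where
  "fits b n G \<longleftrightarrow> n < 2 ^ b \<and> grammar_size G < 2 ^ b \<and> (\<forall>x \<in> set (cells G). x < 2 ^ b)"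

end

theory Submission
  imports Defs "HOL-Library.Discrete_Functions"
begin

text \<open>
  After binarization, let \<open>N v\<close> be the number of occurrences of a variable \<open>v\<close> in the parse tree and
  \<open>ln v\<close> the length of its string, so that \<open>N v * ln v \<le> n\<close>. A rule edge is heavy if both \<open>N\<close> and \<open>ln\<close>
  have the same binary logarithm (rounded down) at its two ends. By counting, a variable has at most one
  heavy edge above and at most one below, so the heavy edges form paths, and a root-to-leaf path of
  the parse tree leaves such paths at most \<open>2 log n\<close> times.

  Along a heavy path \<open>v\<^sub>0, \<dots>, v\<^sub>p\<close> the string of \<open>v\<^sub>i\<close> is that of \<open>v\<^sub>p\<close>, surrounded by the strings of the light
  children of \<open>v\<^sub>i, \<dots>, v\<^sub>p\<^sub>-\<^sub>1\<close>. Give the step from \<open>v\<^sub>i\<close> to \<open>v\<^sub>i\<^sub>+\<^sub>1\<close> a weight that accounts both for the length of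
  its light child and for the number of occurrences of \<open>v\<^sub>i\<close> that are not below \<open>v\<^sub>i\<^sub>-\<^sub>1\<close> (the entries), and place
  the steps on the number line accordingly, from the bottom of the path upwards. The binary trie of
  these points is a tree in which a step of weight \<open>\<omega>\<close> has depth \<open>log (\<Omega> / \<omega>) + O(1)\<close>, where \<open>\<Omega>\<close> is the total
  weight. Its complete subtrees are kept on a stack; every stack entry stores a variable for the whole string from there
  on. Climbing from \<open>v\<^sub>i\<close> up to a common ancestor and descending to a light child then costs the
  logarithms of two ratios, one of occurrences and one of lengths, and both telescope along a root-to-leaf path.
  Merging two stack entries is paid for by their pushes, so time and size are linear.
\<close>

section \<open>Reasoning about programs\<close>

text \<open>The trie is never built explicitly. Two neighbouring points separate at the level of the
  highest bit of their XOR, the key. Three increasing points give two keys with different highest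
  bits, so comparing keys as plain numbers compares levels, without computing a logarithm. Each step
  fills an interval of twice its weight and its point is the midpoint, so its distance to a
  neighbouring step, and with it the key, is at least the weight. The last vertex of a path is not a
  step: its point lies beyond all others and its own key is larger still, so it stays at the bottom
  of the stack and is never merged.

  The obstacle is sharing: a vertex is extended by its heavy parent and is also entered through
  light edges. Therefore nodes are immutable, and the stack of the parent shares a tail with the
  stack of the child. Amortization survives because a vertex has only one heavy parent, so its stack
  is extended only once.

  A change of either logarithm is worth 29 levels of depth, which is where the factor
  \<open>58 = 2 * 29\<close> in the final bound comes from.\<close>

fun loopfree :: "com \<Rightarrow> bool" where
  "loopfree (While e P) \<longleftrightarrow> False"
| "loopfree (Seq P Q) \<longleftrightarrow> loopfree P \<and> loopfree Q"
| "loopfree (If e P Q) \<longleftrightarrow> loopfree P \<and> loopfree Q"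
| "loopfree _ \<longleftrightarrow> True"

text \<open>On loop-free code the execution relation becomes a function that the simplifier can
  evaluate; the value at a loop is a default.\<close>

fun run :: "nat \<Rightarrow> com \<Rightarrow> state \<Rightarrow> state" where
  "run wl Skip s = s"
| "run wl (Set r e) s = set_reg r (val wl s e) s"
| "run wl (Put a e f) s = set_arr a (val wl s e) (val wl s f) s"
| "run wl (Seq P Q) s = run wl Q (run wl P s)"
| "run wl (If e P Q) s = (if val wl s e \<noteq> 0 then run wl P s else run wl Q s)"
| "run wl (While e P) s = s"

fun maxtime :: "com \<Rightarrow> nat" where
  "maxtime Skip = 1"
| "maxtime (Set r e) = cost e + 1"
| "maxtime (Put a e f) = cost e + cost f + 1"
| "maxtime (Seq P Q) = maxtime P + maxtime Q"
| "maxtime (If e P Q) = cost e + 1 + max (maxtime P) (maxtime Q)"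
| "maxtime (While e P) = 0"

lemma exec_loopfree: "loopfree P \<Longrightarrow> \<exists>T \<le> maxtime P. exec wl P s T (run wl P s)"
proof (induction P arbitrary: s)
  case (Seq P Q)
  then obtain T T' where "T \<le> maxtime P" "exec wl P s T (run wl P s)"
    "T' \<le> maxtime Q" "exec wl Q (run wl P s) T' (run wl Q (run wl P s))"
    by (meson loopfree.simps(2))
  then show ?case by (intro exI[of _ "T + T'"]) (auto intro: exec.intros)
next
  case (If e P Q)
  then obtain T T' where T: "T \<le> maxtime P" "exec wl P s T (run wl P s)"
    "T' \<le> maxtime Q" "exec wl Q s T' (run wl Q s)"
    by (meson loopfree.simps(3))
  show ?case
  proof (cases "val wl s e = 0")
    case True
    with T show ?thesis by (intro exI[of _ "cost e + 1 + T'"] conjI) (auto intro: exec.intros(6)[simplified])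
  next
    case False
    with T show ?thesis by (intro exI[of _ "cost e + 1 + T"] conjI) (auto intro: exec.intros(5)[simplified])
  qed
qed (auto intro: exec.intros(1-3)[simplified])

fun written_regs :: "com \<Rightarrow> nat set" where
  "written_regs (Set r e) = {r}"
| "written_regs (Seq P Q) = written_regs P \<union> written_regs Q"
| "written_regs (If e P Q) = written_regs P \<union> written_regs Q"
| "written_regs (While e P) = written_regs P"
| "written_regs _ = {}"

fun written_arrs :: "com \<Rightarrow> nat set" where
  "written_arrs (Put a e f) = {a}"
| "written_arrs (Seq P Q) = written_arrs P \<union> written_arrs Q"
| "written_arrs (If e P Q) = written_arrs P \<union> written_arrs Q"
| "written_arrs (While e P) = written_arrs P"
| "written_arrs _ = {}"

lemma exec_frame:
  "exec wl P s T s' \<Longrightarrow>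
    (\<forall>r. r \<notin> written_regs P \<longrightarrow> reg s' r = reg s r) \<and> (\<forall>a. a \<notin> written_arrs P \<longrightarrow> arr s' a = arr s a)"
  by (induction rule: exec.induct) (auto simp: set_reg_def set_arr_def)

definition terminates :: "nat \<Rightarrow> com \<Rightarrow> nat \<Rightarrow> (state \<Rightarrow> bool) \<Rightarrow> state \<Rightarrow> bool" where
  "terminates wl P t Q s \<longleftrightarrow> (\<exists>T s'. exec wl P s T s' \<and> T \<le> t \<and> Q s')"

lemma terminates_mono:
  "terminates wl P t Q s \<Longrightarrow> t \<le> t' \<Longrightarrow> (\<And>s'. Q s' \<Longrightarrow> Q' s') \<Longrightarrow> terminates wl P t' Q' s"
  unfolding terminates_def by (meson le_trans)

lemma terminates_Seq:
  assumes "terminates wl P t Q s" and "\<And>s'. Q s' \<Longrightarrow> terminates wl P' t' Q' s'"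
  shows "terminates wl (Seq P P') (t + t') Q' s"
  using assms unfolding terminates_def by (meson add_mono exec.intros(4))

lemma terminates_loopfree:
  "loopfree P \<Longrightarrow> maxtime P \<le> t \<Longrightarrow> Q (run wl P s) \<Longrightarrow> terminates wl P t Q s"
  unfolding terminates_def by (meson exec_loopfree le_trans)

lemma terminates_Seq_loopfree:
  "loopfree P \<Longrightarrow> terminates wl P' t Q (run wl P s) \<Longrightarrow> terminates wl (Seq P P') (maxtime P + t) Q s"
  by (rule terminates_Seq[where Q = "\<lambda>s'. s' = run wl P s"]) (auto intro: terminates_loopfree)

lemma terminates_frame:
  assumes "terminates wl P t Q s"
  shows "terminates wl P t (\<lambda>s'. Q s' \<and> (\<forall>r. r \<notin> written_regs P \<longrightarrow> reg s' r = reg s r) \<and>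
    (\<forall>a. a \<notin> written_arrs P \<longrightarrow> arr s' a = arr s a)) s"
  using assms exec_frame unfolding terminates_def by blast

lemma val_Less: "0 < wl \<Longrightarrow> val wl s (Bin Less e f) = of_bool (val wl s e < val wl s f)"
  by simp

lemma val_Less_eq_0: "0 < wl \<Longrightarrow> val wl s (Bin Less e f) = 0 \<longleftrightarrow> val wl s f \<le> val wl s e"
  by (simp add: val_Less not_less del: val.simps(4))

text \<open>The second argument of the invariant is a potential that pays for the remaining running time.\<close>

lemma exec_While:
  assumes "I s k"
    and step: "\<And>s k. I s k \<Longrightarrow> val wl s e \<noteq> 0 \<Longrightarrow>
      \<exists>T s' k'. exec wl P s T s' \<and> I s' k' \<and> k' + T + cost e + 1 \<le> k"
  shows "\<exists>T s' k'. exec wl (While e P) s T s' \<and> I s' k' \<and> val wl s' e = 0 \<and> T + k' \<le> k + cost e + 1"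
  using assms(1)
proof (induction k arbitrary: s rule: less_induct)
  case (less k)
  show ?case
  proof (cases "val wl s e = 0")
    case True
    have "cost e + 1 + k \<le> k + cost e + 1" by simp
    then show ?thesis using exec.intros(7)[OF True] less.prems True by blast
  next
    case False
    from step[OF less.prems False] obtain T s' k' where
      s': "exec wl P s T s'" "I s' k'" "k' + T + cost e + 1 \<le> k" by blast
    then have "k' < k" by simp
    from less.IH[OF this s'(2)] obtain T' s'' k'' where
      s'': "exec wl (While e P) s' T' s''" "I s'' k''" "val wl s'' e = 0" "T' + k'' \<le> k' + cost e + 1" by blast
    have "exec wl (While e P) s (cost e + 1 + T + T') s''" using False s'(1) s''(1) by (rule exec.intros(8))
    moreover have "cost e + 1 + T + T' + k'' \<le> k + cost e + 1" using s'(3) s''(4) by simp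
    ultimately show ?thesis using s''(2,3) by blast
  qed
qed

lemma terminates_While_loopfree:
  assumes "loopfree P" and I: "I s"
    and step: "\<And>s. I s \<Longrightarrow> val wl s e \<noteq> 0 \<Longrightarrow> I (run wl P s) \<and> m (run wl P s) < m s"
    and t: "(maxtime P + cost e + 1) * m s + cost e + 1 \<le> t"
  shows "terminates wl (While e P) t (\<lambda>s'. I s' \<and> val wl s' e = 0) s"
proof -
  let ?c = "maxtime P + cost e + 1"
  let ?I = "\<lambda>s k. I s \<and> k = ?c * m s"
  have "\<exists>T s' k'. exec wl (While e P) s T s' \<and> ?I s' k' \<and> val wl s' e = 0 \<and> T + k' \<le> ?c * m s + cost e + 1"
  proof (rule exec_While[where I = ?I])
    fix s k assume s: "?I s k" "val wl s e \<noteq> 0"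
    obtain T where T: "T \<le> maxtime P" "exec wl P s T (run wl P s)" using exec_loopfree[OF assms(1)] by blast
    from step[of s] s have "Suc (m (run wl P s)) \<le> m s" by simp
    then have "?c * Suc (m (run wl P s)) \<le> ?c * m s" by (rule mult_le_mono2)
    then have "?c * m (run wl P s) + T + cost e + 1 \<le> k" using T(1) s(1) by simp
    then show "\<exists>T s' k'. exec wl P s T s' \<and> ?I s' k' \<and> k' + T + cost e + 1 \<le> k"
      using step[of s] s T(2) by blast
  qed (use I in simp)
  then obtain T s' where "exec wl (While e P) s T s'" "I s'" "val wl s' e = 0" "T \<le> ?c * m s + cost e + 1"
    by auto
  then show ?thesis using t unfolding terminates_def by (meson le_trans)
qed

fun block :: "com list \<Rightarrow> com" where
  "block [] = Skip"
| "block (P # Ps) = Seq P (block Ps)"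

unbundle bit_operations_syntax

section \<open>Binary logarithms and exclusive or\<close>

lemma floor_log_bounds:
  assumes "0 < x" shows "2 ^ floor_log x \<le> x" "x < 2 ^ Suc (floor_log x)"
  using assms floor_log_exp2_le floor_log_exp2_gt by auto

lemma floor_log_ge: "2 ^ k \<le> x \<Longrightarrow> k \<le> floor_log x"
  using floor_log_le_iff[of "2 ^ k" x] by simp

lemma floor_log_less: "0 < x \<Longrightarrow> x < 2 ^ k \<Longrightarrow> floor_log x < k"
  by (meson floor_log_bounds(1) order_le_less_trans power_less_imp_less_exp one_less_numeral_iff semiring_norm(76))

lemma drop_bit_eq_0_iff_less: "drop_bit k (x::nat) = 0 \<longleftrightarrow> x < 2 ^ k"
  by (simp add: drop_bit_eq_div div_eq_0_iff)

lemma drop_bit_floor_log: "0 < x \<Longrightarrow> drop_bit (floor_log x) x = 1"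
  using floor_log_bounds[of x] by (simp add: drop_bit_eq_div div_nat_eqI)

lemma xor_less_floor_log:
  assumes "0 < x" "0 < y" "floor_log x = floor_log y"
  shows "x XOR y < 2 ^ floor_log y"
proof -
  have "drop_bit (floor_log y) (x XOR y) = 0"
    using drop_bit_floor_log[OF assms(1)] drop_bit_floor_log[OF assms(2)] assms(3)
    by (simp only: drop_bit_xor xor_self_eq)
  then show ?thesis by (simp only: drop_bit_eq_0_iff_less)
qed

lemma floor_log_xor:
  assumes "floor_log x < floor_log y"
  shows "floor_log (x XOR y) = floor_log y" "0 < x XOR y"
proof -
  have y: "0 < y" using assms by (cases y) auto
  have x: "x < 2 ^ floor_log y"
  proof (cases "x = 0")
    case False
    then have "x < 2 ^ Suc (floor_log x)" using floor_log_bounds by auto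
    also have "\<dots> \<le> 2 ^ floor_log y" using assms by (intro power_increasing) auto
    finally show ?thesis .
  qed simp
  have "drop_bit (floor_log y) (x XOR y) = 1"
    using drop_bit_floor_log[OF y] x drop_bit_eq_0_iff_less[of "floor_log y" x] by (simp add: drop_bit_xor)
  then have d: "(x XOR y) div 2 ^ floor_log y = 1" by (simp add: drop_bit_eq_div)
  then show "0 < x XOR y" by (metis div_0 gr0I zero_neq_one)
  have "2 ^ floor_log y \<le> x XOR y" using d by (metis div_eq_0_iff linorder_not_less zero_neq_one)
  moreover have "x XOR y < 2 * 2 ^ floor_log y"
    using d by (metis dividend_less_times_div mult.commute mult_2 one_add_one  nat_1_add_1 pos2 zero_less_power div_less_iff_less_mult lessI Suc_1 One_nat_def)
  ultimately show "floor_log (x XOR y) = floor_log y" by (intro floor_log_eqI) auto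
qed

text \<open>A common highest bit cancels in the XOR, whereas of two different highest bits the
  larger one survives. The machine can thus compare rounded logarithms in constant time although it
  has no instruction for them.\<close>

lemma same_floor_log_test:
  assumes "0 < y" "y \<le> x"
  shows "x XOR y < y \<longleftrightarrow> floor_log x = floor_log y"
proof
  assume "floor_log x = floor_log y"
  then have "x XOR y < 2 ^ floor_log y" using assms by (intro xor_less_floor_log) auto
  then show "x XOR y < y" using floor_log_bounds(1)[OF assms(1)] by simp
next
  assume less: "x XOR y < y"
  show "floor_log x = floor_log y"
  proof (rule ccontr)
    assume "floor_log x \<noteq> floor_log y"
    then have "floor_log y < floor_log x" using floor_log_le_iff[OF assms(2)] by simp
    then have "floor_log (x XOR y) = floor_log x" using floor_log_xor[of y x] by (simp add: xor.commute)
    then show False using \<open>floor_log y < floor_log x\<close> floor_log_le_iff[of "x XOR y" y] less by simp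
  qed
qed

text \<open>XOR is addition without carries. The bound keeps keys within a machine word.\<close>

lemma xor_le_add: "x XOR y \<le> x + (y::nat)"
proof (induction x arbitrary: y rule: less_induct)
  case (less x)
  show ?case
  proof (cases "x = 0")
    case False
    then have "(x div 2) XOR (y div 2) \<le> x div 2 + y div 2" by (intro less) auto
    then show ?thesis
      by (subst xor_nat_rec) (auto simp: of_bool_def elim!: oddE evenE)
  qed simp
qed

text \<open>This is what makes the key of two points at least as large as their distance, and hence
  as the weights of the adjacent steps.\<close>

lemma diff_le_xor: "b - a \<le> a XOR (b::nat)"
proof -
  have "b = a XOR (a XOR b)" by (metis xor.left_neutral xor.assoc xor_self_eq)
  also have "\<dots> \<le> a + (a XOR b)" by (rule xor_le_add)
  finally show ?thesis by simp
qed

text \<open>Two consecutive steps of an increasing sequence change different highest bits: a bit that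
  was switched from 0 to 1 has to be switched back, which changes a higher bit.\<close>

lemma floor_log_xor_distinct:
  assumes "a < b" "b < (c::nat)"
  shows "floor_log (a XOR b) \<noteq> floor_log (b XOR c)"
proof
  define k where "k = floor_log (a XOR b)"
  assume eq: "floor_log (a XOR b) = floor_log (b XOR c)"
  have pos: "0 < a XOR b" "0 < b XOR c" using diff_le_xor[of b a] diff_le_xor[of c b] assms by auto
  \<comment> \<open>The bits above \<open>k\<close> agree, so bit \<open>k\<close> is off in the
    smaller number and on in the larger one.\<close>
  have step: "even (drop_bit k x) \<and> odd (drop_bit k y)"
    if "x < y" "drop_bit k (x XOR y) = 1" for x y :: nat
  proof -
    have "drop_bit k x \<le> drop_bit k y" using that(1) by (simp add: drop_bit_eq_div div_le_mono)
    moreover have y: "drop_bit k y = drop_bit k x XOR 1"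
      using that(2) by (metis drop_bit_xor xor.left_neutral xor.assoc xor_self_eq)
    ultimately show ?thesis
      by (cases "even (drop_bit k x)") (auto simp: xor_one_eq xor_Suc_0_eq simp del: drop_bit_xor elim!: oddE)
  qed
  have "odd (drop_bit k b)" using step[OF assms(1)] drop_bit_floor_log[OF pos(1)] unfolding k_def by simp
  moreover have "even (drop_bit k b)" using step[OF assms(2)] drop_bit_floor_log[OF pos(2)] eq unfolding k_def by simp
  ultimately show False by simp
qed

section \<open>Grammars in topological order\<close>

definition topological :: "'a rhs list \<Rightarrow> bool" where
  "topological rs \<longleftrightarrow> (\<forall>i < length rs. normal_rhs (rs ! i) \<and> rhs_vars (rs ! i) \<subseteq> {..<i})"

text \<open>Strings and heights are left folds: each value is computed from the values of earlier
  rules, so appending rules leaves the old values unchanged.\<close>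

definition fold_rules :: "('b list \<Rightarrow> 'a rhs \<Rightarrow> 'b) \<Rightarrow> 'a rhs list \<Rightarrow> 'b list" where
  "fold_rules f rs = foldl (\<lambda>xs R. xs @ [f xs R]) [] rs"

lemma fold_rules_Nil [simp]: "fold_rules f [] = []"
  by (simp add: fold_rules_def)

lemma fold_rules_snoc [simp]: "fold_rules f (rs @ [R]) = fold_rules f rs @ [f (fold_rules f rs) R]"
  by (simp add: fold_rules_def)

lemma length_fold_rules [simp]: "length (fold_rules f rs) = length rs"
  by (induction rs rule: rev_induct) auto

fun expand :: "'a list list \<Rightarrow> 'a rhs \<Rightarrow> 'a list" where
  "expand xs (Term a) = [a]"
| "expand xs (Vars Bs) = concat (map ((!) xs) Bs)"
| "expand xs (Power B t) = concat (replicate t (xs ! B))"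

fun rhs_height :: "nat list \<Rightarrow> 'a rhs \<Rightarrow> nat" where
  "rhs_height hs (Term a) = 1"
| "rhs_height hs (Vars Bs) = Suc (Max (set (map ((!) hs) Bs)))"
| "rhs_height hs (Power B t) = Suc (hs ! B)"

abbreviation "exps \<equiv> fold_rules expand"
abbreviation "heights \<equiv> fold_rules rhs_height"

lemma topological_snoc [simp]:
  "topological (rs @ [R]) \<longleftrightarrow> topological rs \<and> normal_rhs R \<and> rhs_vars R \<subseteq> {..<length rs}"
  by (auto simp: topological_def nth_append less_Suc_eq)

lemma nth_fold_rules:
  assumes "\<And>R xs ys. (\<forall>B \<in> rhs_vars R. xs ! B = ys ! B) \<Longrightarrow> f xs R = f ys R"
    and "topological rs" and "i < length rs"
  shows "fold_rules f rs ! i = f (fold_rules f rs) (rs ! i)"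
  using assms(2,3)
proof (induction rs rule: rev_induct)
  case (snoc R rs)
  have *: "f (fold_rules f (rs @ [R])) R' = f (fold_rules f rs) R'" if "rhs_vars R' \<subseteq> {..<length rs}" for R'
  proof (rule assms(1), rule ballI)
    fix B assume "B \<in> rhs_vars R'"
    then have "B < length rs" using that by auto
    then show "fold_rules f (rs @ [R]) ! B = fold_rules f rs ! B" by (simp add: nth_append)
  qed
  have rs: "topological rs" "rhs_vars R \<subseteq> {..<length rs}" using snoc.prems(1) by auto
  show ?case
  proof (cases "i < length rs")
    case True
    then have "rhs_vars (rs ! i) \<subseteq> {..<length rs}" using rs(1) by (force simp: topological_def)
    then have "f (fold_rules f (rs @ [R])) (rs ! i) = fold_rules f rs ! i"
      using * snoc.IH[OF rs(1) True] by simp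
    then show ?thesis using True by (simp add: nth_append del: fold_rules_snoc) (simp add: nth_append)
  next
    case False
    then have "i = length rs" using snoc.prems(2) by simp
    then show ?thesis using *[OF rs(2)] by (simp add: nth_append)
  qed
qed simp

lemma nth_exps: "topological rs \<Longrightarrow> i < length rs \<Longrightarrow> exps rs ! i = expand (exps rs) (rs ! i)"
proof (rule nth_fold_rules)
  fix R :: "'a rhs" and xs ys :: "'a list list"
  assume *: "\<forall>B \<in> rhs_vars R. xs ! B = ys ! B"
  then show "expand xs R = expand ys R" by (cases R) (auto intro: arg_cong[where f = concat])
qed

lemma nth_heights: "topological rs \<Longrightarrow> i < length rs \<Longrightarrow> heights rs ! i = rhs_height (heights rs) (rs ! i)"
proof (rule nth_fold_rules)
  fix R :: "'a rhs" and xs ys :: "nat list"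
  assume *: "\<forall>B \<in> rhs_vars R. xs ! B = ys ! B"
  show "rhs_height xs R = rhs_height ys R"
  proof (cases R)
    case (Vars Bs)
    then have "map ((!) xs) Bs = map ((!) ys) Bs" using * by simp
    then show ?thesis using Vars by (metis rhs_height.simps(2))
  qed (use * in auto)
qed

lemma derives_exps:
  assumes "topological rs" and "i < length rs"
  shows "derives \<lparr>rules = rs, start = st\<rparr> i (exps rs ! i)"
  using assms(2)
proof (induction i rule: less_induct)
  case (less i)
  have IH: "derives \<lparr>rules = rs, start = st\<rparr> B (exps rs ! B)" if "B \<in> rhs_vars (rs ! i)" for B
    using less that assms(1) by (meson less_trans lessThan_iff subsetD topological_def)
  show ?case
  proof (cases "rs ! i")
    case (Term a)
    then show ?thesis using less.prems nth_exps[OF assms(1) less.prems] by (auto intro: derives_Term)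
  next
    case (Vars Bs)
    then have "list_all2 (derives \<lparr>rules = rs, start = st\<rparr>) Bs (map ((!) (exps rs)) Bs)"
      using IH by (auto simp: list.rel_map intro!: list.rel_refl_strong)
    then show ?thesis
      using Vars less.prems nth_exps[OF assms(1) less.prems] by (auto intro: derives_Vars)
  next
    case (Power B t)
    then show ?thesis
      using IH less.prems nth_exps[OF assms(1) less.prems] by (auto intro: derives_Power)
  qed
qed

lemma parse_tree_heights:
  assumes "topological rs" and "i < length rs"
  shows "\<exists>T. parse_tree (unroll \<lparr>rules = rs, start = st\<rparr>) i T \<and> height T = heights rs ! i"
  using assms(2)
proof (induction i rule: less_induct)
  case (less i)
  let ?G = "unroll \<lparr>rules = rs, start = st\<rparr>"
  have "\<forall>B. \<exists>T. B \<in> rhs_vars (rs ! i) \<longrightarrow> parse_tree ?G B T \<and> height T = heights rs ! B"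
    using less assms(1) by (meson less_trans lessThan_iff subsetD topological_def)
  then obtain T where
    T: "\<And>B. B \<in> rhs_vars (rs ! i) \<Longrightarrow> parse_tree ?G B (T B) \<and> height (T B) = heights rs ! B"
    by metis
  have G: "length (rules ?G) = length rs" "rules ?G ! i = unroll_rhs (rs ! i)"
    using less.prems by (auto simp: unroll_def)
  have normal: "normal_rhs (rs ! i)" using assms(1) less.prems by (simp add: topological_def)
  note h = nth_heights[OF assms(1) less.prems]
  have node: "parse_tree ?G i (Node i (map T Bs))"
    if "unroll_rhs (rs ! i) = Vars Bs" "set Bs \<subseteq> rhs_vars (rs ! i)" for Bs
    using that less.prems G T
    by (intro parse_tree.intros(2)[where Bs = Bs]) (auto simp: list.rel_map intro!: list.rel_refl_strong)
  show ?case
  proof (cases "rs ! i")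
    case (Term a)
    then have "parse_tree ?G i (Node i [Leaf a])" using less.prems G by (intro parse_tree.intros) auto
    then show ?thesis using Term h by (intro exI[of _ "Node i [Leaf a]"]) auto
  next
    case (Vars Bs)
    then have "map (height \<circ> T) Bs = map ((!) (heights rs)) Bs" using T by simp
    then have "height (Node i (map T Bs)) = heights rs ! i" using Vars h by (simp del: map_eq_conv set_map)
    then show ?thesis using node[of Bs] Vars by auto
  next
    case (Power B t)
    then have "height (Node i (map T (replicate t B))) = heights rs ! i"
      using h T[of B] normal by (cases t) auto
    then show ?thesis using node[of "replicate t B"] Power by (metis unroll_rhs.simps(1) rhs_vars.simps(3) set_replicate_conv_if empty_subsetI order_refl)
  qed
qed

text \<open>The identity serves as ranking. Since the start variable must rank highest, it has to be
  the last rule, and the construction has to emit it last.\<close>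

lemma topological_grammar:
  assumes "topological rs" and "rs \<noteq> []"
  defines "G \<equiv> \<lparr>rules = rs, start = length rs - 1\<rparr>"
  shows "is_rlslp G" and "generates G (last (exps rs))" and "depth G = last (heights rs)"
    and "\<forall>R \<in> set (rules G). normal_rhs R"
proof -
  have last: "length rs - 1 < length rs" using assms(2) by simp
  have ne: "fold_rules f rs \<noteq> []" for f :: "'b list \<Rightarrow> 'a rhs \<Rightarrow> 'b"
    using assms(2) by (metis length_0_conv length_fold_rules)
  show normal: "\<forall>R \<in> set (rules G). normal_rhs R"
    using assms(1) by (auto simp: G_def topological_def in_set_conv_nth)
  have "rlslp_rhs R" if "normal_rhs R" for R :: "'a rhs" using that by (cases R) auto
  moreover have acyclic: "acyclic_grammar G"
  proof -
    have vars: "B < A" if "A < length rs" "B \<in> rhs_vars (rs ! A)" for A B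
      using that assms(1) by (auto simp: topological_def)
    then have "B < length rs" if "A < length rs" "B \<in> rhs_vars (rs ! A)" for A B
      using that by (meson less_trans)
    with vars last show ?thesis
      unfolding acyclic_grammar_def by (intro conjI exI[of _ id]) (auto simp: G_def)
  qed
  ultimately show "is_rlslp G" using normal by (simp add: is_rlslp_def)
  show "generates G (last (exps rs))"
    unfolding generates_def using derives_exps[OF assms(1) last] ne[of expand] by (simp add: G_def last_conv_nth)
  obtain T where T: "parse_tree (unroll G) (start G) T" "height T = last (heights rs)"
    using parse_tree_heights[OF assms(1) last, of "length rs - 1"] ne[of rhs_height] by (auto simp: G_def last_conv_nth)
  have "start G < length (rules G)" using last by (simp add: G_def)
  then have "(THE T. parse_tree (unroll G) (start G) T) = T"
    using parse_tree_unique[OF acyclic] T(1) by (intro the1_equality)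
  then show "depth G = last (heights rs)" using T(2) by (simp add: depth_def)
qed

lemma length_le_sum_list: "\<forall>x \<in> set xs. 1 \<le> f x \<Longrightarrow> length xs \<le> (\<Sum>x\<leftarrow>xs. f x)" for f :: "'a \<Rightarrow> nat"
  by (induction xs) auto

lemma rhs_size_pos: "rlslp_rhs R \<Longrightarrow> 0 < rhs_size R"
  by (cases R) auto

lemma length_le_grammar_size: "is_rlslp G \<Longrightarrow> length (rules G) \<le> grammar_size G"
  unfolding grammar_size_def is_rlslp_def by (intro length_le_sum_list) (auto simp: Suc_le_eq rhs_size_pos)

section \<open>Binarization\<close>

text \<open>Only local equations for \<open>ex\<close> are recorded. Acyclicity follows from them:
  strings are nonempty, so children derive strictly shorter strings. Excluding \<open>st\<close> as
  a child makes the start a source of the graph.\<close>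

locale binary_grammar =
  fixes V st n :: nat and kd lc rc :: "nat \<Rightarrow> nat" and ex :: "nat \<Rightarrow> nat list"
  assumes start: "st < V" "length (ex st) = n"
    and rule: "v < V \<Longrightarrow>
      kd v = 0 \<and> ex v = [lc v] \<or>
      kd v = 1 \<and> lc v < V \<and> rc v < V \<and> lc v \<noteq> st \<and> rc v \<noteq> st \<and> ex v = ex (lc v) @ ex (rc v) \<or>
      kd v = 2 \<and> lc v < V \<and> lc v \<noteq> st \<and> 2 < rc v \<and> ex v = concat (replicate (rc v) (ex (lc v)))"
    and nonempty: "v < V \<Longrightarrow> ex v \<noteq> []"

text \<open>
  Arrays 3, 4, 5 hold \<open>kd\<close>, \<open>lc\<close>, \<open>rc\<close>; 6 the numbers of unvisited edges into the vertices; 7 the vertices in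
  topological order; 8 their numbers of occurrences \<open>N\<close>; 9 the lengths \<open>ln\<close>; 10 and 11 the functions
  \<open>heavy\<close> and \<open>M\<close>; 12 to 14 further data of the vertices and 15 to 20 the stack nodes. Registers 4, 5, 8 hold
  \<open>V\<close>, \<open>st\<close> and the current vertex, 20 and 21 the size of the output and the number of nodes.
\<close>

definition binarize_vertex :: com where
  "binarize_vertex =
     If (Bin Eq (Bin Add (Reg 2) (Const 1)) (Get 1 (Bin Add (Reg 3) (Const 1))))
       (block [Put 3 (Reg 2) (Const 0), Put 4 (Reg 2) (Get 2 (Reg 2))])
       (block [Put 3 (Reg 2) (Get 0 (Reg 3)), Put 4 (Reg 2) (Get 1 (Get 2 (Reg 2))),
          If (Bin Eq (Get 0 (Reg 3)) (Const 2))
            (Put 5 (Reg 2) (Get 2 (Bin Add (Reg 2) (Const 1))))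
            (If (Bin Eq (Bin Add (Reg 2) (Const 2)) (Get 1 (Bin Add (Reg 3) (Const 1))))
               (Put 5 (Reg 2) (Get 1 (Get 2 (Bin Add (Reg 2) (Const 1)))))
               (Put 5 (Reg 2) (Bin Add (Reg 2) (Const 1))))])"

definition binarize_step :: com where
  "binarize_step = block [
     If (Bin Eq (Reg 2) (Get 1 (Bin Add (Reg 3) (Const 1)))) (Set 3 (Bin Add (Reg 3) (Const 1))) Skip,
     binarize_vertex,
     Set 2 (Bin Add (Reg 2) (Const 1))]"

definition binarize :: com where
  "binarize = Seq
     (block [Set 4 (Get 1 (Reg 0)), Set 5 (Get 1 (Reg 1)), Set 2 (Const 0), Set 3 (Const 0)])
     (While (Bin Less (Reg 2) (Reg 4)) binarize_step)"

definition offset :: "'a rhs list \<Rightarrow> nat \<Rightarrow> nat" where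
  "offset rs A = (\<Sum>R\<leftarrow>take A rs. rhs_size R)"

lemma offset_0 [simp]: "offset rs 0 = 0"
  by (simp add: offset_def)

lemma offset_Suc: "A < length rs \<Longrightarrow> offset rs (Suc A) = offset rs A + rhs_size (rs ! A)"
  by (simp add: offset_def take_Suc_conv_app_nth)

lemma offset_mono: "A \<le> B \<Longrightarrow> B \<le> length rs \<Longrightarrow> offset rs A \<le> offset rs B"
  by (induction rule: dec_induct) (auto simp: offset_Suc)

lemma offset_length: "offset (rules G) (length (rules G)) = grammar_size G"
  by (simp add: offset_def grammar_size_def)

lemma nth_concat_offset:
  assumes "A < length rs" "i < rhs_size (rs ! A)" "\<And>R. length (f R) = rhs_size R"
  shows "concat (map f rs) ! (offset rs A + i) = f (rs ! A) ! i"
  using assms(1,2)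
proof (induction rs arbitrary: A)
  case (Cons R rs)
  show ?case
  proof (cases A)
    case 0
    then show ?thesis using Cons.prems assms(3) by (simp add: nth_append)
  next
    case (Suc B)
    then have "offset (R # rs) A = length (f R) + offset rs B" by (simp add: offset_def assms(3))
    then show ?thesis using Suc Cons by (simp add: nth_append)
  qed
qed simp

lemma length_rhs_cells [simp]: "length (rhs_cells R) = rhs_size R"
  by (cases R) auto

lemma concat_replicate_Suc: "concat (replicate (Suc t) xs) = xs @ concat (replicate t xs)"
  by simp

locale rlslp_input =
  fixes G :: "nat rlslp" and w :: "nat list"
  assumes G: "is_rlslp G" and w: "generates G w"
begin

abbreviation "rs \<equiv> rules G"
abbreviation "off \<equiv> offset rs"
abbreviation "width A \<equiv> rhs_size (rs ! A)"

definition string :: "nat \<Rightarrow> nat list" where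
  "string A = (THE u. derives G A u)"

lemma acyclic: "acyclic_grammar G"
  using G by (simp add: is_rlslp_def)

lemma derives_iff: "A < length rs \<Longrightarrow> derives G A u \<longleftrightarrow> u = string A"
  unfolding string_def using derives_unique[OF acyclic] by (metis the_equality)

lemma rule_vars: "A < length rs \<Longrightarrow> B \<in> rhs_vars (rs ! A) \<Longrightarrow> B < length rs \<and> B \<noteq> start G"
  using acyclic unfolding acyclic_grammar_def by (metis less_asym)

lemma start_less: "start G < length rs"
  using acyclic unfolding acyclic_grammar_def by blast

lemma string_start: "string (start G) = w"
  using w derives_iff[OF start_less] unfolding generates_def by simp

lemma wellformed: "A < length rs \<Longrightarrow> rlslp_rhs (rs ! A)"
  using G by (simp add: is_rlslp_def)

lemma size_pos: "A < length rs \<Longrightarrow> 0 < width A"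
  by (rule rhs_size_pos[OF wellformed])

lemma string_Term: "A < length rs \<Longrightarrow> rs ! A = Term a \<Longrightarrow> string A = [a]"
  using derives_Term[of A G a] derives_iff by simp

lemma string_Vars:
  assumes A: "A < length rs" "rs ! A = Vars Bs"
  shows "string A = concat (map string Bs)"
proof -
  have "list_all2 (derives G) Bs (map string Bs)"
    using A rule_vars[OF A(1)] by (auto simp: list.rel_map derives_iff intro!: list.rel_refl_strong)
  then show ?thesis using derives_Vars[OF A] derives_iff[OF A(1)] by simp
qed

lemma string_Power: "A < length rs \<Longrightarrow> rs ! A = Power B t \<Longrightarrow> string A = concat (replicate t (string B))"
  using derives_Power[of A G B t "string B"] derives_iff rule_vars[of A B] by simp

lemma string_nonempty: "A < length rs \<Longrightarrow> string A \<noteq> []"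
proof (rule acyclic_grammar_induct[OF acyclic])
  fix A assume A: "A < length rs" and IH: "\<And>B. B \<in> rhs_vars (rs ! A) \<Longrightarrow> string B \<noteq> []"
  show "string A \<noteq> []"
  proof (cases "rs ! A")
    case (Vars Bs)
    then obtain B Bs' where "Bs = B # Bs'" using wellformed[OF A] by (cases Bs) auto
    then show ?thesis using string_Vars[OF A Vars] IH[of B] Vars by simp
  next
    case (Power B t)
    then show ?thesis using string_Power[OF A Power] IH[of B] wellformed[OF A] by (cases t) auto
  qed (simp add: string_Term[OF A])
qed

text \<open>Vertex \<open>off A + i\<close> of the binarized grammar stands for the suffix of the right-hand side
  of \<open>A\<close> that starts at position \<open>i\<close>, except that the last position of each right-hand side is
  an isolated vertex unless it is the only one.\<close>

definition suffix :: "nat rhs \<Rightarrow> nat \<Rightarrow> nat list" where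
  "suffix R i = (if i + 1 = rhs_size R then [rhs_cells R ! i] else
     case R of Term a \<Rightarrow> [a] | Vars Bs \<Rightarrow> concat (map string (drop i Bs))
     | Power B t \<Rightarrow> concat (replicate t (string B)))"

definition suffixes :: "nat \<Rightarrow> nat list" where
  "suffixes p = concat (map (\<lambda>R. map (suffix R) [0..<rhs_size R]) rs) ! p"

lemma suffixes_off: "A < length rs \<Longrightarrow> i < width A \<Longrightarrow> suffixes (off A + i) = suffix (rs ! A) i"
  unfolding suffixes_def by (subst nth_concat_offset) auto

lemma suffixes_off_0:
  assumes A: "A < length rs"
  shows "suffixes (off A) = string A"
proof -
  have "suffixes (off A) = suffix (rs ! A) 0" using suffixes_off[OF A, of 0] size_pos[OF A] by simp
  also have "\<dots> = string A"
    using string_Term[OF A] string_Vars[OF A] string_Power[OF A] wellformed[OF A]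
    by (cases "rs ! A") (auto simp: suffix_def)
  finally show ?thesis .
qed

text \<open>A suffix of length one would be a unit rule. Hence the last but one position of a long
  right-hand side refers directly to the last variable. The last cell (for a power, the exponent) is
  kept as an unreachable leaf, so that vertex numbers coincide with cell addresses.\<close>

definition vertex_ok :: "(nat \<Rightarrow> nat) \<Rightarrow> (nat \<Rightarrow> nat) \<Rightarrow> (nat \<Rightarrow> nat) \<Rightarrow> nat \<Rightarrow> nat \<Rightarrow> bool" where
  "vertex_ok kd lc rc A i \<longleftrightarrow> (let R = rs ! A; p = off A + i in
     if i + 1 = rhs_size R then kd p = 0 \<and> lc p = rhs_cells R ! i
     else kd p = rhs_kind R \<and> lc p = off (rhs_cells R ! i) \<and>
       rc p = (if rhs_kind R = 2 then rhs_cells R ! (i + 1)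
               else if i + 2 = rhs_size R then off (rhs_cells R ! (i + 1)) else p + 1))"

lemma vertex_ok_upd:
  "off A + i \<noteq> p \<Longrightarrow> vertex_ok (kd(p := x)) (lc(p := y)) (rc(p := z)) A i \<longleftrightarrow> vertex_ok kd lc rc A i"
  by (simp add: vertex_ok_def Let_def)

lemma off_less: "A < length rs \<Longrightarrow> i < width A \<Longrightarrow> off A + i < grammar_size G"
  using offset_mono[of "Suc A" "length rs" rs] offset_Suc[of A rs] offset_length[of G] by simp

text \<open>Together with \<open>rule_vars\<close> this makes the start vertex a source of the
  binarized graph.\<close>

lemma off_neq_start:
  assumes A: "A < length rs" and i: "i < width A" and *: "0 < i \<or> A \<noteq> start G"
  shows "off A + i \<noteq> off (start G)"
proof (cases "A < start G" "A = start G" rule: bool.exhaust[case_product bool.exhaust])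
  case True_True
  then show ?thesis by simp
next
  case True_False
  then have "off (Suc A) \<le> off (start G)" using start_less by (intro offset_mono) auto
  then show ?thesis using i offset_Suc[OF A] by simp
next
  case False_True
  then show ?thesis using * by simp
next
  case False_False
  then have "off (Suc (start G)) \<le> off A" using A by (intro offset_mono) auto
  then show ?thesis using size_pos[OF start_less] offset_Suc[OF start_less] by simp
qed

lemma binary_grammarI:
  assumes ok: "\<And>p. p < grammar_size G \<Longrightarrow> \<exists>A i. A < length rs \<and> i < width A \<and> p = off A + i \<and> vertex_ok kd lc rc A i"
  shows "binary_grammar (grammar_size G) (off (start G)) (length w) kd lc rc suffixes"
proof
  show "off (start G) < grammar_size G" using off_less[OF start_less, of 0] size_pos[OF start_less] by simp
  show "length (suffixes (off (start G))) = length w"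
    using suffixes_off_0[OF start_less] string_start by simp
next
  fix v assume "v < grammar_size G"
  then obtain A i where A: "A < length rs" and i: "i < width A" and v: "v = off A + i"
    and v_ok: "vertex_ok kd lc rc A i"
    using ok by blast
  have ex: "suffixes v = suffix (rs ! A) i" using suffixes_off A i v by simp
  have var: "off B < grammar_size G \<and> off B \<noteq> off (start G) \<and> suffixes (off B) = string B \<and> string B \<noteq> []"
    if "B \<in> rhs_vars (rs ! A)" for B
    using rule_vars[OF A that] off_less[of B 0] off_neq_start[of B 0] size_pos[of B]
      suffixes_off_0[of B] string_nonempty[of B] by simp
  let ?Q = "(kd v = 0 \<and> suffixes v = [lc v] \<or>
      kd v = 1 \<and> lc v < grammar_size G \<and> rc v < grammar_size G \<and> lc v \<noteq> off (start G) \<and>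
        rc v \<noteq> off (start G) \<and> suffixes v = suffixes (lc v) @ suffixes (rc v) \<or>
      kd v = 2 \<and> lc v < grammar_size G \<and> lc v \<noteq> off (start G) \<and> 2 < rc v \<and>
        suffixes v = concat (replicate (rc v) (suffixes (lc v)))) \<and> suffixes v \<noteq> []"
  have "?Q"
  proof (cases "i + 1 = width A")
    case True
    then show ?thesis using v_ok ex v by (simp add: vertex_ok_def suffix_def Let_def)
  next
    case False
    show ?thesis
    proof (cases "rs ! A")
      case (Term a)
      then show ?thesis using False i by simp
    next
      case (Vars Bs)
      have i': "i + 1 < length Bs" using False i Vars by simp
      then have in_vars: "Bs ! i \<in> rhs_vars (rs ! A)" "Bs ! (i + 1) \<in> rhs_vars (rs ! A)"
        using Vars by auto
      have kd: "kd v = 1" "lc v = off (Bs ! i)"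
        "rc v = (if i + 2 = length Bs then off (Bs ! (i + 1)) else v + 1)"
        using v_ok False Vars v by (auto simp: vertex_ok_def Let_def)
      have split: "suffixes v = string (Bs ! i) @ concat (map string (drop (i + 1) Bs))"
        using ex False Vars i' Cons_nth_drop_Suc[of i Bs, symmetric] by (simp add: suffix_def)
      have "rc v < grammar_size G \<and> rc v \<noteq> off (start G) \<and> suffixes (rc v) = concat (map string (drop (i + 1) Bs))"
      proof (cases "i + 2 = length Bs")
        case True
        then have "drop (i + 1) Bs = [Bs ! (i + 1)]"
          using Cons_nth_drop_Suc[of "i + 1" Bs, symmetric] by simp
        then show ?thesis using kd(3) True var[OF in_vars(2)] by simp
      next
        case False
        then have "suffixes (off A + (i + 1)) = concat (map string (drop (i + 1) Bs))"
          using suffixes_off[OF A, of "i + 1"] Vars i' by (simp add: suffix_def)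
        then show ?thesis
          using kd(3) False v off_less[OF A, of "i + 1"] off_neq_start[OF A, of "i + 1"] i' Vars by simp
      qed
      then show ?thesis using var[OF in_vars(1)] kd split by simp
    next
      case (Power B t)
      then have "i = 0" using False i by simp
      then show ?thesis
        using var[of B] ex v_ok v Power wellformed[OF A] concat_replicate_Suc[of "t - 1" "string B"]
        by (auto simp: vertex_ok_def suffix_def Let_def)
    qed
  qed
  then show "kd v = 0 \<and> suffixes v = [lc v] \<or>
      kd v = 1 \<and> lc v < grammar_size G \<and> rc v < grammar_size G \<and> lc v \<noteq> off (start G) \<and>
        rc v \<noteq> off (start G) \<and> suffixes v = suffixes (lc v) @ suffixes (rc v) \<or>
      kd v = 2 \<and> lc v < grammar_size G \<and> lc v \<noteq> off (start G) \<and> 2 < rc v \<and>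
        suffixes v = concat (replicate (rc v) (suffixes (lc v)))" "suffixes v \<noteq> []"
    by blast+
qed

text \<open>The rule index in register 3 is advanced only when the next cell is read, hence the
  non-strict upper bound. One conditional increment per cell is enough because right-hand sides are
  nonempty.\<close>

definition binarize_inv :: "state \<Rightarrow> bool" where
  "binarize_inv s \<longleftrightarrow> arr s 0 = arr (initial G) 0 \<and> arr s 1 = arr (initial G) 1 \<and> arr s 2 = arr (initial G) 2 \<and>
     reg s 4 = grammar_size G \<and> reg s 5 = off (start G) \<and>
     reg s 3 < length rs \<and> off (reg s 3) \<le> reg s 2 \<and> reg s 2 \<le> off (Suc (reg s 3)) \<and>
     (\<forall>p < reg s 2. \<exists>A i. A < length rs \<and> i < width A \<and> p = off A + i \<and>
        vertex_ok (arr s 3) (arr s 4) (arr s 5) A i)"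

lemma initial_arrays:
  "A < length rs \<Longrightarrow> arr (initial G) 0 A = rhs_kind (rs ! A)"
  "A \<le> length rs \<Longrightarrow> arr (initial G) 1 A = off A"
  "A < length rs \<Longrightarrow> i < width A \<Longrightarrow> arr (initial G) 2 (off A + i) = rhs_cells (rs ! A) ! i"
proof -
  assume A: "A < length rs" "i < width A"
  have "length (cells G) = grammar_size G"
    by (simp add: cells_def length_concat grammar_size_def comp_def)
  then show "arr (initial G) 2 (off A + i) = rhs_cells (rs ! A) ! i"
    using off_less[OF A] nth_concat_offset[OF A, of rhs_cells]
    by (simp add: initial_def zero_padded_def) (simp add: cells_def)
qed (auto simp: initial_def zero_padded_def kinds_def offsets_def offset_def simp del: upt_Suc)

lemma binarize_step:
  assumes wl: "grammar_size G + 2 < 2 ^ wl" and inv: "binarize_inv s" and less: "reg s 2 < reg s 4"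
  shows "binarize_inv (run wl binarize_step s)" "reg (run wl binarize_step s) 2 = Suc (reg s 2)"
proof -
  let ?s' = "run wl binarize_step s"
  define p where "p = reg s 2"
  define A where "A = (if p = off (Suc (reg s 3)) then Suc (reg s 3) else reg s 3)"
  define i where "i = p - off A"
  have arrs: "arr s 0 = arr (initial G) 0" "arr s 1 = arr (initial G) 1" "arr s 2 = arr (initial G) 2"
    and r: "reg s 4 = grammar_size G" "reg s 5 = off (start G)" "reg s 3 < length rs"
      "off (reg s 3) \<le> p" "p \<le> off (Suc (reg s 3))" "p < grammar_size G"
    and old: "\<And>q. q < p \<Longrightarrow> \<exists>A i. A < length rs \<and> i < width A \<and> q = off A + i \<and>
        vertex_ok (arr s 3) (arr s 4) (arr s 5) A i"
    using inv less unfolding binarize_inv_def p_def by auto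
  have A: "A < length rs"
  proof (cases "p = off (Suc (reg s 3))")
    case True
    then show ?thesis using r offset_length[of G] unfolding A_def by (metis Suc_lessI less_irrefl)
  qed (simp add: A_def r)
  have off_Suc: "off (Suc A) = off A + width A" using offset_Suc[OF A] .
  have i: "i < width A" "p = off A + i"
    using r size_pos[OF A] off_Suc unfolding i_def A_def by (auto split: if_splits)
  have len: "length rs \<le> grammar_size G" using length_le_grammar_size[OF G] .
  have "0 < wl" using wl by (cases wl) auto
  then have nums: "1 mod 2 ^ wl = (1::nat)" "2 mod 2 ^ wl = (2::nat)" "Suc 0 mod 2 ^ wl = 1"
    "Suc (reg s 3) mod 2 ^ wl = Suc (reg s 3)" "Suc A mod 2 ^ wl = Suc A"
    "Suc p mod 2 ^ wl = Suc p" "(2 + p) mod 2 ^ wl = p + 2" "Suc (Suc p) mod 2 ^ wl = p + 2"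
    using wl r len A by (auto intro!: mod_less)
  have lookup: "arr s 0 A = rhs_kind (rs ! A)" "arr s 1 (Suc A) = off (Suc A)" "arr s 2 p = rhs_cells (rs ! A) ! i"
    "arr s 1 (Suc (reg s 3)) = off (Suc (reg s 3))"
    using A r(3) i arrs initial_arrays by auto
  have lookup': "arr s 2 (Suc p) = rhs_cells (rs ! A) ! Suc i" if "Suc i < width A"
    using initial_arrays(3)[OF A that] arrs i(2) by simp
  have var: "arr s 1 (rhs_cells (rs ! A) ! j) = off (rhs_cells (rs ! A) ! j)"
    if "rhs_cells (rs ! A) ! j \<in> rhs_vars (rs ! A)" for j
    using rule_vars[OF A that] initial_arrays(2) arrs by simp
  have kind: "rhs_kind (rs ! A) = 2 \<and> i = 0 \<and> width A = 2 \<and> rhs_cells (rs ! A) ! 0 \<in> rhs_vars (rs ! A) \<or>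
      rhs_kind (rs ! A) = 1 \<and> (\<forall>j < width A. rhs_cells (rs ! A) ! j \<in> rhs_vars (rs ! A))" if "Suc i \<noteq> width A"
    using that i(1) by (cases "rs ! A") auto
  have "run wl (If (Bin Eq (Reg 2) (Get 1 (Bin Add (Reg 3) (Const 1)))) (Set 3 (Bin Add (Reg 3) (Const 1))) Skip) s
      = set_reg 3 A s"
    using nums(3,4) lookup(4) \<open>0 < wl\<close> by (simp add: A_def p_def set_reg_def)
  then have s': "?s' = run wl (Set 2 (Bin Add (Reg 2) (Const 1))) (run wl binarize_vertex (set_reg 3 A s))"
    by (simp only: binarize_step_def block.simps run.simps(1,4))
  have "reg ?s' 2 = Suc p \<and> reg ?s' 3 = A \<and> reg ?s' 4 = reg s 4 \<and> reg ?s' 5 = reg s 5 \<and>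
    arr ?s' 0 = arr s 0 \<and> arr ?s' 1 = arr s 1 \<and> arr ?s' 2 = arr s 2 \<and>
    (\<exists>x y z. arr ?s' 3 = (arr s 3)(p := x) \<and> arr ?s' 4 = (arr s 4)(p := y) \<and> arr ?s' 5 = (arr s 5)(p := z)) \<and>
    vertex_ok (arr ?s' 3) (arr ?s' 4) (arr ?s' 5) A i"
  proof (cases "Suc i = width A")
    case True
    have z: "\<exists>z. arr s 5 = (arr s 5)(p := z)" by (metis fun_upd_triv)
    from True show ?thesis unfolding s' using nums lookup off_Suc i \<open>0 < wl\<close> z
      by (simp add: binarize_vertex_def set_reg_def set_arr_def p_def[symmetric] vertex_ok_def) metis
  next
    case False
    note kind = kind[OF False]
    have Suc_i: "Suc i < width A" using False i(1) by simp
    have neq: "Suc p \<noteq> off (Suc A)" and le2: "Suc (Suc p) = off (Suc A) \<longleftrightarrow> Suc (Suc i) = width A"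
      using off_Suc i False by auto
    show ?thesis
    proof (cases "rhs_kind (rs ! A) = 2")
      case True
      then have "rhs_cells (rs ! A) ! i \<in> rhs_vars (rs ! A)" using kind by auto
      with True show ?thesis unfolding s'
        using nums lookup lookup'[OF Suc_i] i(2) False neq var[of i] \<open>0 < wl\<close>
        by (simp add: binarize_vertex_def set_reg_def set_arr_def p_def[symmetric] vertex_ok_def)
          (metis fun_upd_triv)
    next
      case kind2: False
      then have vars: "rhs_cells (rs ! A) ! i \<in> rhs_vars (rs ! A)" "rhs_cells (rs ! A) ! Suc i \<in> rhs_vars (rs ! A)"
        using kind i(1) Suc_i by auto
      show ?thesis unfolding s'
        using nums lookup lookup'[OF Suc_i] i(2) False neq kind2 var[OF vars(1)] var[OF vars(2)] le2 \<open>0 < wl\<close>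
        by (cases "Suc (Suc i) = width A";
            simp add: binarize_vertex_def set_reg_def set_arr_def p_def[symmetric] vertex_ok_def;
            metis fun_upd_triv)
    qed
  qed
  then obtain x y z where s': "reg ?s' 2 = Suc p" "reg ?s' 3 = A" "reg ?s' 4 = reg s 4" "reg ?s' 5 = reg s 5"
    "arr ?s' 0 = arr s 0" "arr ?s' 1 = arr s 1" "arr ?s' 2 = arr s 2"
    "arr ?s' 3 = (arr s 3)(p := x)" "arr ?s' 4 = (arr s 4)(p := y)" "arr ?s' 5 = (arr s 5)(p := z)"
    "vertex_ok (arr ?s' 3) (arr ?s' 4) (arr ?s' 5) A i"
    by blast
  show "reg ?s' 2 = Suc (reg s 2)" using s' by (simp add: p_def)
  have "\<exists>A i. A < length rs \<and> i < width A \<and> q = off A + i \<and> vertex_ok (arr ?s' 3) (arr ?s' 4) (arr ?s' 5) A i"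
    if "q < Suc p" for q
  proof (cases "q = p")
    case True
    then show ?thesis using A i s'(11) by blast
  next
    case False
    then have "q < p" using that by simp
    from old[OF this] show ?thesis using False s'(8-10) by (metis vertex_ok_upd)
  qed
  then show "binarize_inv ?s'" unfolding binarize_inv_def using s' arrs r A i off_Suc by auto
qed

lemma terminates_binarize:
  assumes wl: "grammar_size G + 2 < 2 ^ wl"
  shows "terminates wl binarize (100 * (grammar_size G + 1)) (\<lambda>s.
    binary_grammar (grammar_size G) (reg s 5) (length w) (arr s 3) (arr s 4) (arr s 5) suffixes \<and>
    suffixes (reg s 5) = w \<and> reg s 4 = grammar_size G \<and> reg s 0 = length (rules G)) (initial G)"
proof -
  let ?I = "binarize_inv"
  let ?P = "block [Set 4 (Get 1 (Reg 0)), Set 5 (Get 1 (Reg 1)), Set 2 (Const 0), Set 3 (Const 0)]"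
  let ?s1 = "run wl ?P (initial G)"
  have ini: "reg (initial G) 0 = length rs" "reg (initial G) (Suc 0) = start G"
    by (simp_all add: initial_def zero_padded_def)
  have "terminates wl (While (Bin Less (Reg 2) (Reg 4)) binarize_step) (95 * grammar_size G + 10)
     (\<lambda>s. ?I s \<and> val wl s (Bin Less (Reg 2) (Reg 4)) = 0) ?s1"
  proof (rule terminates_While_loopfree[where m = "\<lambda>s. grammar_size G - reg s 2" and I = ?I and s = ?s1])
    show "loopfree binarize_step" by (simp add: binarize_step_def binarize_vertex_def)
    have "0 < length rs" using start_less by auto
    then show "?I ?s1"
      using start_less ini initial_arrays(2)[of "length rs"] initial_arrays(2)[of "start G"] offset_length[of G]
      by (simp add: binarize_inv_def set_reg_def)
    show "?I (run wl binarize_step s) \<and>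
        grammar_size G - reg (run wl binarize_step s) 2 < grammar_size G - reg s 2"
      if "?I s" "val wl s (Bin Less (Reg 2) (Reg 4)) \<noteq> 0" for s
    proof -
      have less: "reg s 2 < reg s 4" using that(2) by (cases "reg s 2 < reg s 4") auto
      moreover have "reg s 4 = grammar_size G" using that(1) by (simp add: binarize_inv_def)
      ultimately show ?thesis using binarize_step[OF wl that(1) less] by simp
    qed
    show "(maxtime binarize_step + cost (Bin Less (Reg 2) (Reg 4)) + 1) * (grammar_size G - reg ?s1 2)
        + cost (Bin Less (Reg 2) (Reg 4)) + 1 \<le> 95 * grammar_size G + 10"
      by (simp add: binarize_step_def binarize_vertex_def set_reg_def)
  qed
  then have "terminates wl binarize (maxtime ?P + (95 * grammar_size G + 10))
      (\<lambda>s. ?I s \<and> val wl s (Bin Less (Reg 2) (Reg 4)) = 0) (initial G)"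
    unfolding binarize_def by (rule terminates_Seq_loopfree[rotated]) simp
  from terminates_frame[OF this] show ?thesis
  proof (rule terminates_mono)
    fix s
    assume s: "((?I s \<and> val wl s (Bin Less (Reg 2) (Reg 4)) = 0) \<and>
      (\<forall>r. r \<notin> written_regs binarize \<longrightarrow> reg s r = reg (initial G) r) \<and>
      (\<forall>a. a \<notin> written_arrs binarize \<longrightarrow> arr s a = arr (initial G) a))"
    have "0 < wl" using wl by (cases wl) auto
    then have "reg s 2 \<ge> grammar_size G" using s by (auto simp: binarize_inv_def val_Less simp del: val.simps(4))
    then have "binary_grammar (grammar_size G) (off (start G)) (length w) (arr s 3) (arr s 4) (arr s 5) suffixes"
      using s by (intro binary_grammarI) (auto simp: binarize_inv_def)
    moreover have "reg s 0 = reg (initial G) 0" using s by (simp add: binarize_def binarize_step_def binarize_vertex_def)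
    ultimately show "binary_grammar (grammar_size G) (reg s 5) (length w) (arr s 3) (arr s 4) (arr s 5) suffixes \<and>
      suffixes (reg s 5) = w \<and> reg s 4 = grammar_size G \<and> reg s 0 = length rs"
      using s ini suffixes_off_0[OF start_less] string_start by (simp add: binarize_inv_def)
  qed simp
qed

end

section \<open>Topological order and numbers of occurrences\<close>

context binary_grammar
begin

definition ln :: "nat \<Rightarrow> nat" where
  "ln v = length (ex v)"

text \<open>An edge is a vertex with a slot, so two equal children give two parallel edges; a power
  rule has one edge, whose multiplicity is the exponent.\<close>

definition edges :: "(nat \<times> nat) set" where
  "edges = {(u, i). u < V \<and> (kd u = 1 \<and> i < 2 \<or> kd u = 2 \<and> i = 0)}"

definition target :: "nat \<times> nat \<Rightarrow> nat" where
  "target e = (if snd e = 0 then lc (fst e) else rc (fst e))"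

definition mult :: "nat \<times> nat \<Rightarrow> nat" where
  "mult e = (if kd (fst e) = 2 then rc (fst e) else 1)"

lemma ln_pos: "v < V \<Longrightarrow> 0 < ln v"
  using nonempty by (simp add: ln_def)

lemma length_concat_replicate: "length (concat (replicate t xs)) = t * length xs"
  by (induction t) auto

lemma edges_from:
  assumes "u < V"
  shows "{e \<in> edges. fst e = u} = (if kd u = 1 then {(u, 0), (u, 1)} else if kd u = 2 then {(u, 0)} else {})"
  using assms by (auto simp: edges_def)

lemma finite_edges: "finite edges"
proof (rule finite_subset)
  show "edges \<subseteq> {..<V} \<times> {..<2}" by (auto simp: edges_def)
qed simp

lemma edge_vertices: "e \<in> edges \<Longrightarrow> fst e < V \<and> target e < V \<and> target e \<noteq> st"
  using rule[of "fst e"] by (auto simp: edges_def target_def split: if_splits)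

lemma ln_rule:
  "v < V \<Longrightarrow> kd v = 0 \<Longrightarrow> ln v = 1"
  "v < V \<Longrightarrow> kd v = 1 \<Longrightarrow> ln v = ln (lc v) + ln (rc v)"
  "v < V \<Longrightarrow> kd v = 2 \<Longrightarrow> ln v = rc v * ln (lc v) \<and> 2 < rc v"
  using rule[of v] by (auto simp: ln_def length_concat_replicate)

lemma ln_target_less:
  assumes e: "e \<in> edges"
  shows "ln (target e) < ln (fst e)"
proof -
  have u: "fst e < V" and c: "target e < V" using edge_vertices[OF e] by auto
  show ?thesis
  proof (cases "kd (fst e) = 1")
    case True
    then have "lc (fst e) < V" "rc (fst e) < V" using rule[OF u] by auto
    then show ?thesis using ln_rule(2)[OF u True] ln_pos by (auto simp: target_def)
  next
    case False
    then have k: "kd (fst e) = 2" and t: "target e = lc (fst e)" using e by (auto simp: edges_def target_def)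
    have "1 * ln (target e) < rc (fst e) * ln (lc (fst e))"
      unfolding t using ln_rule(3)[OF u k] ln_pos[OF c] t by (intro mult_strict_right_mono) auto
    then show ?thesis using ln_rule(3)[OF u k] by simp
  qed
qed

lemma sum_edges_from:
  assumes u: "u < V"
  shows "(\<Sum>e\<in>{e \<in> edges. fst e = u}. mult e * x * ln (target e)) \<le> x * ln u"
  using ln_rule[OF u] by (simp add: edges_from[OF u] mult_def target_def algebra_simps)

definition indegree :: "(nat \<times> nat) set \<Rightarrow> nat \<Rightarrow> nat" where
  "indegree F v = card {e \<in> F. target e = v}"

lemma indegree_insert:
  assumes "finite F" "e \<notin> F"
  shows "indegree (insert e F) = (indegree F)(target e := indegree F (target e) + 1)"
proof
  fix v
  have "{e' \<in> insert e F. target e' = v} = (if target e = v then insert e {e' \<in> F. target e' = v} else {e' \<in> F. target e' = v})"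
    by auto
  then show "indegree (insert e F) v = ((indegree F)(target e := indegree F (target e) + 1)) v"
    using assms by (simp add: indegree_def)
qed

text \<open>\<open>P\<close> contains the visited edges; \<open>h\<close> vertices have been popped
  from the queue \<open>q\<close> and \<open>t\<close> have been inserted. The inequality with the
  two sums is conservation of length: the \<open>n\<close> letters are charged to vertices not yet
  popped and to unvisited edges of popped vertices. It bounds the partial counts \<open>N\<close> at
  every moment of the run, so that no intermediate value overflows.\<close>

definition kahn :: "(nat \<times> nat) set \<Rightarrow> nat \<Rightarrow> nat \<Rightarrow> (nat \<Rightarrow> nat) \<Rightarrow> (nat \<Rightarrow> nat) \<Rightarrow> (nat \<Rightarrow> nat) \<Rightarrow> bool" where
  "kahn P h t q N dg \<longleftrightarrow>
     P \<subseteq> {e \<in> edges. fst e \<in> q ` {..<h}} \<and>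
     (\<forall>v < V. dg v = indegree (edges - P) v) \<and>
     h \<le> t \<and> inj_on q {..<t} \<and> q ` {..<t} = {v. v < V \<and> (\<forall>e \<in> edges. target e = v \<longrightarrow> e \<in> P)} \<and>
     0 < t \<and> q 0 = st \<and>
     (\<forall>i < t. \<forall>e \<in> edges. target e = q i \<longrightarrow> fst e \<in> q ` {..<i}) \<and>
     (\<forall>v < V. N v = of_bool (v = st) + (\<Sum>e\<in>{e \<in> P. target e = v}. mult e * N (fst e))) \<and>
     (\<Sum>v\<in>{..<V} - q ` {..<h}. N v * ln v) +
       (\<Sum>e\<in>{e \<in> edges - P. fst e \<in> q ` {..<h}}. mult e * N (fst e) * ln (target e)) \<le> n \<and>
     (\<forall>v < V. N v * ln v \<le> n)"

lemma kahn_bound: "kahn P h t q N dg \<Longrightarrow> \<forall>v < V. N v * ln v \<le> n"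
  unfolding kahn_def by (elim conjE)

lemma kahn_pop:
  assumes k: "kahn P h t q N dg" and h: "h < t" and P: "P = {e \<in> edges. fst e \<in> q ` {..<h}}"
  shows "kahn P (Suc h) t q N dg"
proof -
  define u where "u = q h"
  have inj: "inj_on q {..<t}" using k by (simp add: kahn_def)
  have u: "u < V" using k h unfolding kahn_def u_def by blast
  have u_new: "u \<notin> q ` {..<h}"
  proof
    assume "u \<in> q ` {..<h}"
    then obtain j where "j < h" "q j = q h" unfolding u_def by auto
    then show False using inj h by (auto dest: inj_onD)
  qed
  have img: "q ` {..<Suc h} = insert u (q ` {..<h})" by (auto simp: u_def less_Suc_eq)
  have "(\<Sum>v\<in>{..<V} - q ` {..<h}. N v * ln v) = N u * ln u + (\<Sum>v\<in>{..<V} - q ` {..<Suc h}. N v * ln v)"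
    unfolding img using u u_new by (subst sum.remove[of _ u]) (auto intro!: sum.cong)
  moreover have "{e \<in> edges - P. fst e \<in> q ` {..<h}} = {}"
    unfolding P by auto
  then have "(\<Sum>e\<in>{e \<in> edges - P. fst e \<in> q ` {..<h}}. mult e * N (fst e) * ln (target e)) = 0"
    by (simp only: sum.empty)
  moreover have "{e \<in> edges - P. fst e \<in> q ` {..<Suc h}} = {e \<in> edges. fst e = u}"
    unfolding img P using u_new by auto
  then have "(\<Sum>e\<in>{e \<in> edges - P. fst e \<in> q ` {..<Suc h}}. mult e * N (fst e) * ln (target e)) \<le> N u * ln u"
  proof -
    assume "{e \<in> edges - P. fst e \<in> q ` {..<Suc h}} = {e \<in> edges. fst e = u}"
    moreover have "(\<Sum>e\<in>{e \<in> edges. fst e = u}. mult e * N (fst e) * ln (target e)) =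
        (\<Sum>e\<in>{e \<in> edges. fst e = u}. mult e * N u * ln (target e))"
      by (rule sum.cong) auto
    ultimately show ?thesis using sum_edges_from[OF u, of "N u"] by simp
  qed
  moreover have "P \<subseteq> {e \<in> edges. fst e \<in> q ` {..<Suc h}}" unfolding img P by auto
  moreover have "(\<Sum>v\<in>{..<V} - q ` {..<h}. N v * ln v) +
       (\<Sum>e\<in>{e \<in> edges - P. fst e \<in> q ` {..<h}}. mult e * N (fst e) * ln (target e)) \<le> n"
    using k unfolding kahn_def by (elim conjE)
  ultimately have "P \<subseteq> {e \<in> edges. fst e \<in> q ` {..<Suc h}}" "Suc h \<le> t"
    "(\<Sum>v\<in>{..<V} - q ` {..<Suc h}. N v * ln v) +
       (\<Sum>e\<in>{e \<in> edges - P. fst e \<in> q ` {..<Suc h}}. mult e * N (fst e) * ln (target e)) \<le> n"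
    using h by linarith+
  then show ?thesis using k unfolding kahn_def by (elim conjE) (intro conjI; assumption)
qed

lemma kahn_visit:
  assumes k: "kahn P h t q N dg" and e: "e \<in> edges" "e \<notin> P" "fst e \<in> q ` {..<h}"
  defines "c \<equiv> target e" and "x \<equiv> mult e * N (fst e)"
  shows "N c + x \<le> n" "0 < dg c"
    and "kahn (insert e P) h (if dg c = 1 then Suc t else t) (if dg c = 1 then q(t := c) else q)
      (N(c := N c + x)) (dg(c := dg c - 1))"
proof -
  let ?t = "if dg c = 1 then Suc t else t"
  let ?q = "if dg c = 1 then q(t := c) else q"
  let ?N = "N(c := N c + x)"
  have c: "c < V" "c \<noteq> st" using edge_vertices[OF e(1)] by (auto simp: c_def)
  have sub: "P \<subseteq> {e \<in> edges. fst e \<in> q ` {..<h}}" and dg: "\<And>v. v < V \<Longrightarrow> dg v = indegree (edges - P) v"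
    and h: "h \<le> t" and inj: "inj_on q {..<t}"
    and img: "q ` {..<t} = {v. v < V \<and> (\<forall>e \<in> edges. target e = v \<longrightarrow> e \<in> P)}"
    and order: "\<And>i e. i < t \<Longrightarrow> e \<in> edges \<Longrightarrow> target e = q i \<Longrightarrow> fst e \<in> q ` {..<i}"
    and N: "\<And>v. v < V \<Longrightarrow> N v = of_bool (v = st) + (\<Sum>e\<in>{e \<in> P. target e = v}. mult e * N (fst e))"
    and total: "(\<Sum>v\<in>{..<V} - q ` {..<h}. N v * ln v) +
       (\<Sum>e\<in>{e \<in> edges - P. fst e \<in> q ` {..<h}}. mult e * N (fst e) * ln (target e)) \<le> n"
    and bound: "\<And>v. v < V \<Longrightarrow> N v * ln v \<le> n" and q0: "0 < t" "q 0 = st"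
    using k unfolding kahn_def by (elim conjE; simp)+
  have fin: "finite P" "finite (edges - P)" using finite_edges sub by (auto intro: finite_subset)
  have c_new: "c \<notin> q ` {..<t}" using e unfolding img c_def by auto
  have "q ` {..<h} \<subseteq> q ` {..<t}" using h by auto
  then have c_new': "c \<notin> q ` {..<h}" and neq: "fst e \<noteq> c" using c_new e(3) by auto
  have src: "fst e' \<noteq> c" if "e' \<in> P" for e' using sub that c_new' by auto
  have "{..<V} - q ` {..<h} = insert c ({..<V} - q ` {..<h} - {c})" using c c_new' by auto
  then have sum1: "(\<Sum>v\<in>{..<V} - q ` {..<h}. M v * ln v) = M c * ln c + (\<Sum>v\<in>{..<V} - q ` {..<h} - {c}. M v * ln v)"
    for M :: "nat \<Rightarrow> nat" using c c_new' by (subst sum.remove[of _ c]) auto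
  let ?F = "{e \<in> edges - P. fst e \<in> q ` {..<h}}"
  have F: "{e' \<in> edges - insert e P. fst e' \<in> q ` {..<h}} = ?F - {e}" by auto
  have sum2: "(\<Sum>e\<in>?F. mult e * N (fst e) * ln (target e)) =
      x * ln c + (\<Sum>e\<in>?F - {e}. mult e * N (fst e) * ln (target e))"
    unfolding x_def c_def using e fin by (subst sum.remove[of _ e]) auto
  \<comment> \<open>The target has not been popped, so its charge and the charge of the edge are
    separate summands of the total.\<close>
  have all: "(N c + x) * ln c \<le> n" using total sum1[of N] sum2 by (simp add: algebra_simps)
  have "N c + x \<le> (N c + x) * ln c" using ln_pos[OF c(1)] by simp
  then show "N c + x \<le> n" using all by (rule le_trans)
  have e_split: "edges - P = insert e (edges - insert e P)" using e by auto
  have deg: "indegree (edges - P) = (indegree (edges - insert e P))(c := indegree (edges - insert e P) c + 1)"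
    unfolding c_def by (subst e_split, rule indegree_insert) (use finite_edges in auto)
  then show dg_pos: "0 < dg c" using dg[OF c(1)] by simp
  have dg_1: "dg c = 1 \<longleftrightarrow> (\<forall>e' \<in> edges. target e' = c \<longrightarrow> e' \<in> insert e P)"
  proof -
    have "dg c = 1 \<longleftrightarrow> indegree (edges - insert e P) c = 0" using dg[OF c(1)] deg by simp
    also have "\<dots> \<longleftrightarrow> {e' \<in> edges - insert e P. target e' = c} = {}"
      unfolding indegree_def using finite_edges by (subst card_0_eq) auto
    finally show ?thesis by auto
  qed
  have qh: "?q ` {..<h} = q ` {..<h}" using h by auto
  have deg': "\<forall>v < V. (dg(c := dg c - 1)) v = indegree (edges - insert e P) v" using dg deg by simp
  have sub': "insert e P \<subseteq> {e \<in> edges. fst e \<in> ?q ` {..<h}}" using sub e qh by auto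
  have h': "h \<le> ?t" using h by simp
  have inj': "inj_on ?q {..<?t}"
  proof (cases "dg c = 1")
    case True
    then show ?thesis using inj c_new by (auto simp: lessThan_Suc inj_on_def)
  qed (use inj in simp)
  have img': "?q ` {..<?t} = {v. v < V \<and> (\<forall>e' \<in> edges. target e' = v \<longrightarrow> e' \<in> insert e P)}"
  proof -
    have "?q ` {..<?t} = q ` {..<t} \<union> (if dg c = 1 then {c} else {})"
      by (auto simp: lessThan_Suc)
    also have "\<dots> = {v. v < V \<and> (\<forall>e' \<in> edges. target e' = v \<longrightarrow> e' \<in> insert e P)}" (is "_ = ?R")
    proof (rule set_eqI)
      fix v
      show "v \<in> q ` {..<t} \<union> (if dg c = 1 then {c} else {}) \<longleftrightarrow> v \<in> ?R"
      proof (cases "v = c")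
        case True
        then show ?thesis using c_new dg_1 c by auto
      next
        case False
        then show ?thesis unfolding img by (auto simp: c_def)
      qed
    qed
    finally show ?thesis .
  qed
  have pos': "0 < ?t" "?q 0 = st" using q0 by auto
  have order': "fst e' \<in> ?q ` {..<i}" if i: "i < ?t" and e': "e' \<in> edges" "target e' = ?q i" for i e'
  proof (cases "i < t")
    case True
    then have "fst e' \<in> q ` {..<i}" using order e' by (auto split: if_splits)
    also have "q ` {..<i} = ?q ` {..<i}" using True by auto
    finally show ?thesis .
  next
    case False
    then have "i = t" "dg c = 1" using i by (auto split: if_splits)
    then have "e' \<in> insert e P" using e' dg_1 by auto
    then have "fst e' \<in> q ` {..<h}" using sub e by auto
    also have "q ` {..<h} \<subseteq> ?q ` {..<i}" using h \<open>i = t\<close> by auto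
    finally show ?thesis .
  qed
  have N': "?N v = of_bool (v = st) + (\<Sum>e\<in>{e' \<in> insert e P. target e' = v}. mult e * ?N (fst e))"
    if v: "v < V" for v
  proof -
    have "(\<Sum>e\<in>{e' \<in> insert e P. target e' = v}. mult e * ?N (fst e)) =
        (\<Sum>e\<in>{e' \<in> insert e P. target e' = v}. mult e * N (fst e))"
      using src neq by (intro sum.cong) auto
    also have "\<dots> = (\<Sum>e\<in>{e' \<in> P. target e' = v}. mult e * N (fst e)) + (if v = c then x else 0)"
    proof -
      have "{e' \<in> insert e P. target e' = v} = (if v = c then insert e {e' \<in> P. target e' = v} else {e' \<in> P. target e' = v})"
        by (auto simp: c_def)
      then show ?thesis using fin e by (simp add: x_def)
    qed
    finally have "(\<Sum>e\<in>{e' \<in> insert e P. target e' = v}. mult e * ?N (fst e)) =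
        (\<Sum>e\<in>{e' \<in> P. target e' = v}. mult e * N (fst e)) + (if v = c then x else 0)" .
    then show ?thesis using N[OF v] by (simp only: fun_upd_apply) (cases "v = c"; simp)
  qed
  have total': "(\<Sum>v\<in>{..<V} - ?q ` {..<h}. ?N v * ln v) +
      (\<Sum>e\<in>{e' \<in> edges - insert e P. fst e' \<in> ?q ` {..<h}}. mult e * ?N (fst e) * ln (target e)) \<le> n"
  proof -
    have "(\<Sum>v\<in>{..<V} - q ` {..<h} - {c}. ?N v * ln v) = (\<Sum>v\<in>{..<V} - q ` {..<h} - {c}. N v * ln v)"
      by (intro sum.cong) auto
    moreover have "(\<Sum>e\<in>?F - {e}. mult e * ?N (fst e) * ln (target e)) =
        (\<Sum>e\<in>?F - {e}. mult e * N (fst e) * ln (target e))"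
      using c_new' by (intro sum.cong) auto
    ultimately show ?thesis
      unfolding qh F using total sum1[of N] sum1[of ?N] sum2 by (simp add: algebra_simps)
  qed
  have bound': "?N v * ln v \<le> n" if "v < V" for v using bound[OF that] all by simp
  show "kahn (insert e P) h ?t ?q ?N (dg(c := dg c - 1))"
    unfolding kahn_def using deg'
    by (intro conjI allI impI ballI sub' h' inj' img' pos' order' N' total' bound') simp_all
qed

definition traversal :: "(nat \<Rightarrow> nat) \<Rightarrow> (nat \<Rightarrow> nat) \<Rightarrow> bool" where
  "traversal q N \<longleftrightarrow> inj_on q {..<V} \<and> q ` {..<V} = {..<V} \<and> q 0 = st \<and>
     (\<forall>i < V. \<forall>e \<in> edges. target e = q i \<longrightarrow> fst e \<in> q ` {..<i}) \<and>
     (\<forall>v < V. N v = of_bool (v = st) + (\<Sum>e\<in>{e \<in> edges. target e = v}. mult e * N (fst e))) \<and>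
     (\<forall>v < V. N v * ln v \<le> n)"

lemma kahn_end:
  assumes k: "kahn P t t q N dg" and P: "P = {e \<in> edges. fst e \<in> q ` {..<t}}"
  shows "t = V" "traversal q N"
proof -
  have img: "q ` {..<t} = {v. v < V \<and> (\<forall>e \<in> edges. target e = v \<longrightarrow> e \<in> P)}" and inj: "inj_on q {..<t}"
    using k by (auto simp: kahn_def)
  have eq: "q ` {..<t} = {..<V}"
  proof (rule ccontr)
    assume "q ` {..<t} \<noteq> {..<V}"
    then have "{..<V} - q ` {..<t} \<noteq> {}" using img by auto
    \<comment> \<open>A longest vertex that was never inserted has an unvisited incoming edge; the
      source of that edge was never inserted either, and it is longer.\<close>
    then have "Max (ln ` ({..<V} - q ` {..<t})) \<in> ln ` ({..<V} - q ` {..<t})"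
      by (intro Max_in) auto
    then obtain v where v: "v \<in> {..<V} - q ` {..<t}" "ln v = Max (ln ` ({..<V} - q ` {..<t}))"
      by auto
    then obtain e where e: "e \<in> edges" "target e = v" "e \<notin> P" using img by auto
    then have "fst e \<in> {..<V} - q ` {..<t}" using edge_vertices P by auto
    then have "ln (fst e) \<le> ln v" unfolding v(2) by (intro Max_ge) auto
    then show False using ln_target_less[OF e(1)] e(2) by simp
  qed
  have "card (q ` {..<t}) = t" using inj by (simp add: card_image)
  then show V: "t = V" using eq by simp
  have "P = edges" using P eq edge_vertices by auto
  then show "traversal q N"
    using k eq unfolding kahn_def traversal_def V by (elim conjE) (intro conjI; simp only:)
qed

end

section \<open>Topological sorting as a program\<close>

definition indegree_step :: com where
  "indegree_step = block [
     If (Bin Eq (Get 3 (Reg 2)) (Const 0)) Skip (block [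
       Put 6 (Get 4 (Reg 2)) (Bin Add (Get 6 (Get 4 (Reg 2))) (Const 1)),
       If (Bin Eq (Get 3 (Reg 2)) (Const 1))
         (Put 6 (Get 5 (Reg 2)) (Bin Add (Get 6 (Get 5 (Reg 2))) (Const 1))) Skip]),
     Set 2 (Bin Add (Reg 2) (Const 1))]"

text \<open>All sources are queued, not only the start: otherwise the edges of an unreachable source
  would keep the in-degrees of reachable vertices positive. The start is put in front separately, so
  that the later sweeps, which run backwards, end with it.\<close>

definition seed_step :: com where
  "seed_step = block [
     If (Get 6 (Reg 2)) Skip
       (If (Bin Eq (Reg 2) (Reg 5)) Skip
          (block [Put 7 (Reg 7) (Reg 2), Set 7 (Bin Add (Reg 7) (Const 1))])),
     Set 2 (Bin Add (Reg 2) (Const 1))]"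

definition visit :: com where
  "visit = block [
     Put 8 (Reg 9) (Bin Add (Get 8 (Reg 9)) (Reg 10)),
     Put 6 (Reg 9) (Bin Sub (Get 6 (Reg 9)) (Const 1)),
     If (Get 6 (Reg 9)) Skip (block [Put 7 (Reg 7) (Reg 9), Set 7 (Bin Add (Reg 7) (Const 1))])]"

definition kahn_step :: com where
  "kahn_step = block [
     Set 8 (Get 7 (Reg 6)), Set 6 (Bin Add (Reg 6) (Const 1)),
     If (Bin Eq (Get 3 (Reg 8)) (Const 0)) Skip
       (If (Bin Eq (Get 3 (Reg 8)) (Const 2))
          (block [Set 9 (Get 4 (Reg 8)), Set 10 (Bin Mul (Get 5 (Reg 8)) (Get 8 (Reg 8))), visit])
          (block [Set 9 (Get 4 (Reg 8)), Set 10 (Get 8 (Reg 8)), visit,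
             Set 9 (Get 5 (Reg 8)), Set 10 (Get 8 (Reg 8)), visit]))]"

definition toposort :: com where
  "toposort =
     Seq (Seq (Set 2 (Const 0)) (While (Bin Less (Reg 2) (Reg 4)) indegree_step))
       (Seq (Seq (block [Put 7 (Const 0) (Reg 5), Set 7 (Const 1), Set 2 (Const 0)])
            (While (Bin Less (Reg 2) (Reg 4)) seed_step))
          (Seq (block [Put 8 (Reg 5) (Const 1), Set 6 (Const 0)])
            (While (Bin Less (Reg 6) (Reg 7)) kahn_step)))"

context binary_grammar
begin

definition holds_input :: "state \<Rightarrow> bool" where
  "holds_input s \<longleftrightarrow> arr s 3 = kd \<and> arr s 4 = lc \<and> arr s 5 = rc \<and> reg s 4 = V \<and> reg s 5 = st"

lemma n_pos: "0 < n"
  using start nonempty by auto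

lemma kd_cases: "v < V \<Longrightarrow> kd v = 0 \<or> kd v = 1 \<or> kd v = 2"
  using rule[of v] by auto

lemma indegree_le: "F \<subseteq> edges \<Longrightarrow> indegree F v \<le> 2 * V"
proof -
  assume "F \<subseteq> edges"
  then have "{e \<in> F. target e = v} \<subseteq> {..<V} \<times> {..<2}" by (auto simp: edges_def)
  then have "indegree F v \<le> card ({..<V} \<times> {..<2::nat})" unfolding indegree_def by (intro card_mono) auto
  then show ?thesis by simp
qed

lemma wl_pos: "256 * (n + V) < 2 ^ wl \<Longrightarrow> 0 < wl \<and> 1 < wl"
  using n_pos by (cases wl; cases "wl - 1") auto

lemma small_mod: "256 * (n + V) < 2 ^ wl \<Longrightarrow> x \<le> 256 * (n + V) \<Longrightarrow> x mod 2 ^ wl = x" for x :: nat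
  by simp

lemma indegree_step:
  assumes wl: "256 * (n + V) < 2 ^ wl" and inp: "holds_input s" and p: "reg s 2 < V"
    and dg: "\<forall>v < V. arr s 6 v = indegree {e \<in> edges. fst e < reg s 2} v"
  defines "s' \<equiv> run wl indegree_step s"
  shows "holds_input s'" "reg s' 2 = Suc (reg s 2)"
    "\<forall>v < V. arr s' 6 v = indegree {e \<in> edges. fst e < Suc (reg s 2)} v"
proof -
  define p where "p = reg s 2"
  let ?E = "{e \<in> edges. fst e < p}"
  have fin: "finite ?E" "?E \<subseteq> edges" using finite_edges by auto
  have E: "{e \<in> edges. fst e < Suc p} = {e \<in> edges. fst e = p} \<union> ?E" by auto
  have le: "indegree F v + 1 < 2 ^ wl" if "F \<subseteq> edges" for F v using indegree_le[OF that, of v] wl n_pos by simp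
  note simps = indegree_step_def s'_def set_reg_def set_arr_def holds_input_def p_def[symmetric]
  have w: "0 < wl" "1 < wl" "Suc p < 2 ^ wl" using wl_pos[OF wl] wl p by (auto simp: p_def)
  have pV: "p < V" using p by (simp add: p_def)
  consider "kd p = 0" | "kd p = 1" | "kd p = 2" using kd_cases[OF pV] by metis
  then have "holds_input s' \<and> reg s' 2 = Suc p \<and>
    (\<forall>v < V. arr s' 6 v = indegree {e \<in> edges. fst e < Suc p} v)"
  proof cases
    case 1
    then have "{e \<in> edges. fst e < Suc p} = ?E" unfolding E edges_from[OF pV] by simp
    with 1 inp w dg show ?thesis by (simp add: simps)
  next
    case 2
    have c: "lc p < V" "rc p < V" using rule[OF pV] 2 by auto
    have in_edges: "(p, 0) \<in> edges" "(p, 1) \<in> edges" using 2 pV by (auto simp: edges_def)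
    have "{e \<in> edges. fst e < Suc p} = insert (p, 1) (insert (p, 0) ?E)" unfolding E edges_from[OF pV] using 2 by auto
    moreover have "indegree (insert (p, 0) ?E) = (indegree ?E)(lc p := indegree ?E (lc p) + 1)"
      using fin by (subst indegree_insert) (auto simp: target_def)
    moreover have "indegree (insert (p, 1) (insert (p, 0) ?E)) =
        (indegree (insert (p, 0) ?E))(rc p := indegree (insert (p, 0) ?E) (rc p) + 1)"
      using fin by (subst indegree_insert) (auto simp: target_def)
    moreover have "indegree ?E v + 1 < 2 ^ wl" "indegree (insert (p, 0) ?E) v + 1 < 2 ^ wl"
      "indegree (insert (p, 0) ?E) (lc p) + 1 < 2 ^ wl" for v
      using le[of ?E v] le[of "insert (p, 0) ?E"] fin in_edges by auto
    ultimately show ?thesis using 2 inp w dg c by (simp add: simps)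
  next
    case 3
    have c: "lc p < V" using rule[OF pV] 3 by auto
    have "{e \<in> edges. fst e < Suc p} = insert (p, 0) ?E" unfolding E edges_from[OF pV] using 3 by auto
    moreover have "indegree (insert (p, 0) ?E) = (indegree ?E)(lc p := indegree ?E (lc p) + 1)"
      using fin by (subst indegree_insert) (auto simp: target_def)
    moreover have "indegree ?E v + 1 < 2 ^ wl" for v
      using le[of ?E v] fin by auto
    ultimately show ?thesis using 3 inp w dg c by (simp add: simps)
  qed
  then show "holds_input s'" "reg s' 2 = Suc (reg s 2)"
    "\<forall>v < V. arr s' 6 v = indegree {e \<in> edges. fst e < Suc (reg s 2)} v"
    by (auto simp: p_def)
qed

definition seeded :: "state \<Rightarrow> bool" where
  "seeded s \<longleftrightarrow> holds_input s \<and> (\<forall>v < V. arr s 6 v = indegree edges v) \<and> reg s 2 \<le> V \<and>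
     inj_on (arr s 7) {..<reg s 7} \<and> 0 < reg s 7 \<and> arr s 7 0 = st \<and>
     arr s 7 ` {..<reg s 7} = insert st {v. v < reg s 2 \<and> indegree edges v = 0}"

lemma seed_step:
  assumes wl: "256 * (n + V) < 2 ^ wl" and s: "seeded s" and p: "reg s 2 < V"
  shows "seeded (run wl seed_step s)" "reg (run wl seed_step s) 2 = Suc (reg s 2)"
proof -
  define p where "p = reg s 2"
  define t where "t = reg s 7"
  define q where "q = arr s 7"
  have s': "holds_input s" "\<And>v. v < V \<Longrightarrow> arr s 6 v = indegree edges v" "inj_on q {..<t}" "0 < t" "q 0 = st"
    "q ` {..<t} = insert st {v. v < p \<and> indegree edges v = 0}" and pV: "p < V"
    using s p by (auto simp: seeded_def p_def t_def q_def)
  have "q ` {..<t} \<subseteq> {..<V}" using s'(6) pV start by auto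
  then have "card (q ` {..<t}) \<le> card {..<V}" by (intro card_mono) auto
  then have t: "t \<le> V" using s'(3) by (simp add: card_image)
  have dg: "arr s 6 p = indegree edges p" and inp: "holds_input s" and st: "reg s 5 = st"
    using s' pV by (auto simp: holds_input_def)
  have w: "0 < wl" "1 < wl" "Suc p < 2 ^ wl" "Suc t < 2 ^ wl" using wl_pos[OF wl] wl pV t n_pos by auto
  have less: "{v. v < Suc p \<and> indegree edges v = 0} =
      (if indegree edges p = 0 then insert p {v. v < p \<and> indegree edges v = 0} else {v. v < p \<and> indegree edges v = 0})"
    by (auto simp: less_Suc_eq)
  note simps = seed_step_def set_reg_def set_arr_def holds_input_def seeded_def p_def[symmetric] t_def[symmetric] q_def[symmetric]
  have "seeded (run wl seed_step s) \<and> reg (run wl seed_step s) 2 = Suc p"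
  proof (cases "indegree edges p = 0 \<and> p \<noteq> st")
    case True
    then have "p \<notin> q ` {..<t}" using s'(6) by auto
    then have "inj_on (q(t := p)) {..<Suc t}" using s'(3) by (auto simp: lessThan_Suc inj_on_def)
    moreover have "q(t := p) ` {..<Suc t} = insert p (q ` {..<t})" by (auto simp: lessThan_Suc)
    moreover have "run wl seed_step s = set_reg 2 (Suc p) (set_reg 7 (Suc t) (set_arr 7 t p s))"
      using True dg st w by (simp add: seed_step_def set_reg_def set_arr_def p_def[symmetric] t_def[symmetric])
    ultimately show ?thesis using True s' pV less by (simp add: simps insert_commute)
  next
    case False
    then have "insert st {v. v < Suc p \<and> indegree edges v = 0} = insert st {v. v < p \<and> indegree edges v = 0}"
      by (auto simp: less_Suc_eq)
    moreover have "run wl seed_step s = set_reg 2 (Suc p) s"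
      using False dg st w
      by (cases "indegree edges p = 0") (simp_all add: seed_step_def set_reg_def set_arr_def p_def[symmetric])
    moreover from calculation s'(6) have "q ` {..<t} = insert st {v. v < Suc p \<and> indegree edges v = 0}"
      by (simp only:)
    then have "seeded (set_reg 2 (Suc p) s)"
      using s'(1-5) pV by (simp add: seeded_def holds_input_def set_reg_def q_def t_def)
    ultimately show ?thesis by (simp add: set_reg_def)
  qed
  then show "seeded (run wl seed_step s)" "reg (run wl seed_step s) 2 = Suc (reg s 2)" by (auto simp: p_def)
qed

lemma kahn_start:
  assumes s: "seeded s" "reg s 2 = V"
  shows "kahn {} 0 (reg s 7) (arr s 7) ((\<lambda>_. 0)(st := 1)) (arr s 6)"
proof -
  have no_edge: "indegree edges v = 0 \<longleftrightarrow> (\<forall>e \<in> edges. target e \<noteq> v)" for v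
    using finite_edges by (auto simp: indegree_def)
  then have st: "indegree edges st = 0" using edge_vertices by auto
  have img: "arr s 7 ` {..<reg s 7} = {v. v < V \<and> indegree edges v = 0}"
    using s st start unfolding seeded_def by auto
  have "\<forall>e \<in> edges. target e \<noteq> arr s 7 i" if "i < reg s 7" for i
  proof -
    have "arr s 7 i \<in> arr s 7 ` {..<reg s 7}" using that by auto
    then show ?thesis using img no_edge by simp
  qed
  then have order: "\<forall>i < reg s 7. \<forall>e \<in> edges. target e = arr s 7 i \<longrightarrow> fst e \<in> arr s 7 ` {..<i}" by blast
  have "(\<Sum>v\<in>{..<V}. ((\<lambda>_. 0)(st := 1)) v * ln v) = (\<Sum>v\<in>{st}. ln v)"
    using start(1) by (intro sum.mono_neutral_cong_right) auto
  then have "(\<Sum>v\<in>{..<V}. ((\<lambda>_. 0)(st := 1)) v * ln v) \<le> n" using start(2) by (simp add: ln_def)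
  moreover have "ln st \<le> n" using start(2) by (simp add: ln_def)
  ultimately show ?thesis
    unfolding kahn_def using s order img no_edge by (simp add: seeded_def)
qed

lemma visit:
  assumes wl: "256 * (n + V) < 2 ^ wl" and inp: "holds_input s"
    and k: "kahn P h (reg s 7) (arr s 7) (arr s 8) (arr s 6)"
    and e: "e \<in> edges" "e \<notin> P" "fst e \<in> arr s 7 ` {..<h}"
    and r: "reg s 9 = target e" "reg s 10 = mult e * arr s 8 (fst e)"
  defines "s' \<equiv> run wl visit s"
  shows "kahn (insert e P) h (reg s' 7) (arr s' 7) (arr s' 8) (arr s' 6)" "holds_input s'"
    "reg s' 8 = reg s 8" "reg s' 6 = reg s 6" "arr s' 7 ` {..<h} = arr s 7 ` {..<h}" "arr s' 8 (fst e) = arr s 8 (fst e)"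
proof -
  define t where "t = reg s 7"
  define N where "N = arr s 8"
  define dg where "dg = arr s 6"
  define q where "q = arr s 7"
  note k' = k[folded t_def N_def dg_def q_def] and e' = e[folded q_def]
  note v = kahn_visit[OF k' e']
  have c: "target e < V" using edge_vertices e(1) by auto
  have neq: "fst e \<noteq> target e" using ln_target_less[OF e(1)] by auto
  have inj: "inj_on q {..<t}" and "q ` {..<t} \<subseteq> {..<V}" and h: "h \<le> t" using k' by (auto simp: kahn_def)
  then have "card (q ` {..<t}) \<le> card {..<V}" by (intro card_mono) auto
  then have t: "t \<le> V" using inj by (simp add: card_image)
  have "dg (target e) \<le> 2 * V" using k' c indegree_le[of "edges - P"] by (simp add: kahn_def)
  then have w: "0 < wl" "1 < wl" "Suc t < 2 ^ wl" "dg (target e) < 2 ^ wl"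
    "N (target e) + mult e * N (fst e) < 2 ^ wl"
    using wl_pos[OF wl] wl t n_pos v(1) by auto
  note simps = visit_def s'_def set_reg_def set_arr_def holds_input_def t_def[symmetric] q_def[symmetric]
    dg_def[symmetric] N_def[symmetric]
  have s': "arr s' 8 = N(target e := N (target e) + mult e * N (fst e))" "arr s' 6 = dg(target e := dg (target e) - 1)"
    "reg s' 7 = (if dg (target e) = 1 then Suc t else t)" "arr s' 7 = (if dg (target e) = 1 then q(t := target e) else q)"
    using r[folded N_def] w v(2) by (auto simp: simps)
  show "kahn (insert e P) h (reg s' 7) (arr s' 7) (arr s' 8) (arr s' 6)" unfolding s' using v(3) .
  show "holds_input s'" "reg s' 8 = reg s 8" "reg s' 6 = reg s 6" using inp r w by (auto simp: simps)
  show "arr s' 7 ` {..<h} = arr s 7 ` {..<h}" unfolding s' using h by (auto simp: q_def)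
  show "arr s' 8 (fst e) = arr s 8 (fst e)" unfolding s' using neq by (simp add: N_def)
qed

lemma kahn_step:
  assumes wl: "256 * (n + V) < 2 ^ wl" and inp: "holds_input s"
    and k: "kahn {e \<in> edges. fst e \<in> arr s 7 ` {..<reg s 6}} (reg s 6) (reg s 7) (arr s 7) (arr s 8) (arr s 6)"
    and less: "reg s 6 < reg s 7"
  defines "s' \<equiv> run wl kahn_step s"
  shows "kahn {e \<in> edges. fst e \<in> arr s' 7 ` {..<reg s' 6}} (reg s' 6) (reg s' 7) (arr s' 7) (arr s' 8) (arr s' 6)"
    and "holds_input s'" "reg s' 6 = Suc (reg s 6)"
proof -
  define h where "h = reg s 6"
  define u where "u = arr s 7 h"
  define P where "P = {e \<in> edges. fst e \<in> arr s 7 ` {..<h}}"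
  define s1 where "s1 = set_reg 6 (Suc h) (set_reg 8 u s)"
  have k0: "kahn P h (reg s 7) (arr s 7) (arr s 8) (arr s 6)" using k by (simp add: P_def h_def)
  have hlt: "h < reg s 7" using less by (simp add: h_def)
  have k1: "kahn P (Suc h) (reg s1 7) (arr s1 7) (arr s1 8) (arr s1 6)"
    using kahn_pop[OF k0 hlt P_def] by (simp add: s1_def set_reg_def)
  have inj: "inj_on (arr s 7) {..<reg s 7}" and q: "arr s 7 ` {..<reg s 7} \<subseteq> {..<V}" using k0 by (auto simp: kahn_def)
  then have "card (arr s 7 ` {..<reg s 7}) \<le> card {..<V}" by (intro card_mono) auto
  then have "reg s 7 \<le> V" using inj by (simp add: card_image)
  then have w: "0 < wl" "1 < wl" "Suc h < 2 ^ wl" using wl_pos[OF wl] wl hlt n_pos by auto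
  have u: "u < V" using q hlt by (auto simp: u_def)
  have u_new: "u \<notin> arr s 7 ` {..<h}"
  proof
    assume "u \<in> arr s 7 ` {..<h}"
    then obtain j where "j < h" "arr s 7 j = arr s 7 h" unfolding u_def by auto
    then show False using inj hlt by (auto dest: inj_onD)
  qed
  have inp1: "holds_input s1" using inp by (simp add: s1_def set_reg_def holds_input_def)
  have img: "arr s1 7 ` {..<Suc h} = insert u (arr s 7 ` {..<h})"
    by (auto simp: u_def s1_def set_reg_def less_Suc_eq)
  have P': "{e \<in> edges. fst e \<in> arr s1 7 ` {..<Suc h}} = {e \<in> edges. fst e = u} \<union> P"
    unfolding img P_def by auto
  have new: "(u, i) \<notin> P" for i using u_new by (simp add: P_def)
  have s': "s' = run wl (If (Bin Eq (Get 3 (Reg 8)) (Const 0)) Skip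
       (If (Bin Eq (Get 3 (Reg 8)) (Const 2))
          (block [Set 9 (Get 4 (Reg 8)), Set 10 (Bin Mul (Get 5 (Reg 8)) (Get 8 (Reg 8))), visit])
          (block [Set 9 (Get 4 (Reg 8)), Set 10 (Get 8 (Reg 8)), visit,
             Set 9 (Get 5 (Reg 8)), Set 10 (Get 8 (Reg 8)), visit]))) s1"
    using w by (simp add: s'_def kahn_step_def s1_def u_def h_def set_reg_def)
  have r1: "reg s1 8 = u" "reg s1 6 = Suc h" by (simp_all add: s1_def set_reg_def)
  have arr1: "arr s1 3 = kd" "arr s1 4 = lc" "arr s1 5 = rc" using inp1 by (auto simp: holds_input_def)
  have "kahn {e \<in> edges. fst e \<in> arr s' 7 ` {..<Suc h}} (Suc h) (reg s' 7) (arr s' 7) (arr s' 8) (arr s' 6) \<and>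
    holds_input s' \<and> reg s' 6 = Suc h"
  proof -
    consider "kd u = 0" | "kd u = 1" | "kd u = 2" using kd_cases[OF u] by metis
    then show ?thesis
    proof cases
      case 1
      then have "s' = s1" using w r1 arr1 by (simp add: s')
      moreover have "{e \<in> edges. fst e \<in> arr s1 7 ` {..<Suc h}} = P" unfolding P' edges_from[OF u] using 1 by simp
      ultimately show ?thesis using k1 inp1 r1 by simp
    next
      case 2
      have e: "(u, 0) \<in> edges" "(u, 1) \<in> edges" using 2 u by (auto simp: edges_def)
      have t: "target (u, 0) = lc u" "target (u, 1) = rc u" "mult (u, 0) = 1" "mult (u, 1) = 1"
        using 2 by (auto simp: target_def mult_def)
      define s2 where "s2 = set_reg 10 (arr s1 8 u) (set_reg 9 (lc u) s1)"
      define s3 where "s3 = run wl visit s2"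
      define s4 where "s4 = set_reg 10 (arr s3 8 u) (set_reg 9 (rc u) s3)"
      have s2: "holds_input s2" "kahn P (Suc h) (reg s2 7) (arr s2 7) (arr s2 8) (arr s2 6)"
        "reg s2 9 = target (u, 0)" "reg s2 10 = mult (u, 0) * arr s2 8 (fst (u, 0))"
        "fst (u, 0) \<in> arr s2 7 ` {..<Suc h}" "reg s2 8 = u" "reg s2 6 = Suc h" "arr s2 7 = arr s1 7"
        using inp1 k1 t img r1 by (auto simp: s2_def set_reg_def holds_input_def)
      note v = visit[OF wl s2(1,2) e(1) new s2(5,3,4), folded s3_def]
      have s4: "holds_input s4" "kahn (insert (u, 0) P) (Suc h) (reg s4 7) (arr s4 7) (arr s4 8) (arr s4 6)"
        "reg s4 9 = target (u, 1)" "reg s4 10 = mult (u, 1) * arr s4 8 (fst (u, 1))"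
        "fst (u, 1) \<in> arr s4 7 ` {..<Suc h}" "(u, 1) \<notin> insert (u, 0) P" "reg s4 6 = Suc h" "arr s4 7 = arr s3 7"
        using v s2 t new by (auto simp: s4_def set_reg_def holds_input_def)
      note v' = visit[OF wl s4(1,2) e(2) s4(6,5,3,4)]
      have "run wl (Set 10 (Get 8 (Reg 8))) (run wl (Set 9 (Get 4 (Reg 8))) s1) = s2"
        using r1 arr1 by (simp add: s2_def set_reg_def)
      moreover have "run wl (Set 10 (Get 8 (Reg 8))) (run wl (Set 9 (Get 5 (Reg 8))) s3) = s4"
        using v(2,3) s2(6) by (simp add: s4_def set_reg_def holds_input_def)
      ultimately have "s' = run wl visit s4"
        using w r1 arr1 2 small_mod[OF wl, of 2] n_pos by (simp add: s' s3_def del: run.simps(2))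
      moreover have "{e \<in> edges. fst e \<in> arr s1 7 ` {..<Suc h}} = insert (u, 1) (insert (u, 0) P)"
        unfolding P' edges_from[OF u] using 2 by auto
      moreover have "arr (run wl visit s4) 7 ` {..<Suc h} = arr s1 7 ` {..<Suc h}"
        using v'(5) v(5) s4(8) s2(8) by simp
      ultimately show ?thesis using v'(1,2,4) s4(7) by simp
    next
      case 3
      have e: "(u, 0) \<in> edges" using 3 u by (auto simp: edges_def)
      have t: "target (u, 0) = lc u" "mult (u, 0) = rc u" using 3 by (auto simp: target_def mult_def)
      define s2 where "s2 = set_reg 10 (rc u * arr s1 8 u) (set_reg 9 (lc u) s1)"
      have s2: "holds_input s2" "kahn P (Suc h) (reg s2 7) (arr s2 7) (arr s2 8) (arr s2 6)"
        "reg s2 9 = target (u, 0)" "reg s2 10 = mult (u, 0) * arr s2 8 (fst (u, 0))"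
        "fst (u, 0) \<in> arr s2 7 ` {..<Suc h}" "reg s2 8 = u" "reg s2 6 = Suc h" "arr s2 7 = arr s1 7"
        using inp1 k1 t img r1 by (auto simp: s2_def set_reg_def holds_input_def)
      note v = visit[OF wl s2(1,2) e(1) new s2(5,3,4)]
      have "arr s1 8 u * ln u \<le> n" using kahn_bound[OF k1] u by blast
      then have "rc u * arr s1 8 u * ln (lc u) \<le> n" using ln_rule(3)[OF u 3] by (simp add: algebra_simps)
      moreover have "0 < ln (lc u)" using rule[OF u] 3 ln_pos by auto
      ultimately have "rc u * arr s1 8 u \<le> n" by (metis le_trans mult.right_neutral mult_le_mono2 Suc_leI One_nat_def)
      then have "rc u * arr s1 8 u < 2 ^ wl" using wl n_pos by simp
      then have "s' = run wl visit s2"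
        using w r1 arr1 3 small_mod[OF wl, of 2] n_pos unfolding s2_def by (simp add: s') (simp add: set_reg_def)
      moreover have "{e \<in> edges. fst e \<in> arr s1 7 ` {..<Suc h}} = insert (u, 0) P"
        unfolding P' edges_from[OF u] using 3 by auto
      ultimately show ?thesis using v(1,2,4,5) s2(7,8) by simp
    qed
  qed
  then show "kahn {e \<in> edges. fst e \<in> arr s' 7 ` {..<reg s' 6}} (reg s' 6) (reg s' 7) (arr s' 7) (arr s' 8) (arr s' 6)"
    "holds_input s'" "reg s' 6 = Suc (reg s 6)"
    by (auto simp: h_def)
qed

lemma terminates_toposort:
  assumes wl: "256 * (n + V) < 2 ^ wl" and inp: "holds_input s"
    and zero: "\<And>v. arr s 6 v = 0" "\<And>v. arr s 8 v = 0"
  shows "terminates wl toposort (200 * (V + 1)) (\<lambda>s'. holds_input s' \<and> traversal (arr s' 7) (arr s' 8)) s"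
proof -
  have w: "0 < wl" "1 < wl" using wl_pos[OF wl] by auto
  let ?s1 = "run wl (Set 2 (Const 0)) s"
  let ?I1 = "\<lambda>s'. holds_input s' \<and> reg s' 2 \<le> V \<and> arr s' 8 = arr s 8 \<and>
    (\<forall>v < V. arr s' 6 v = indegree {e \<in> edges. fst e < reg s' 2} v)"
  have frame: "arr (run wl indegree_step s) 8 = arr s 8" "arr (run wl seed_step s) 8 = arr s 8" for s
    by (simp_all add: indegree_step_def seed_step_def set_reg_def set_arr_def)
  have 1: "terminates wl (While (Bin Less (Reg 2) (Reg 4)) indegree_step) (50 * V + 10)
      (\<lambda>s'. ?I1 s' \<and> val wl s' (Bin Less (Reg 2) (Reg 4)) = 0) ?s1"
  proof (rule terminates_While_loopfree[where m = "\<lambda>s. V - reg s 2" and I = ?I1 and s = ?s1])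
    show "?I1 ?s1" using inp zero by (simp add: set_reg_def holds_input_def indegree_def)
    show "?I1 (run wl indegree_step s) \<and> V - reg (run wl indegree_step s) 2 < V - reg s 2"
      if s: "?I1 s" "val wl s (Bin Less (Reg 2) (Reg 4)) \<noteq> 0" for s
    proof -
      have "reg s 2 < V" using s unfolding val_Less_eq_0[OF w(1)] by (simp add: holds_input_def)
      then show ?thesis using indegree_step[OF wl, of s] s(1) frame by simp
    qed
  qed (simp_all add: indegree_step_def set_reg_def)
  let ?P2 = "block [Put 7 (Const 0) (Reg 5), Set 7 (Const 1), Set 2 (Const 0)]"
  let ?I2 = "\<lambda>s'. seeded s' \<and> arr s' 8 = arr s 8"
  have 2: "terminates wl (Seq ?P2 (While (Bin Less (Reg 2) (Reg 4)) seed_step)) (maxtime ?P2 + (50 * V + 10))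
      (\<lambda>s'. ?I2 s' \<and> val wl s' (Bin Less (Reg 2) (Reg 4)) = 0) s1"
    if s1: "?I1 s1" "val wl s1 (Bin Less (Reg 2) (Reg 4)) = 0" for s1
  proof (rule terminates_Seq_loopfree)
    have "V \<le> reg s1 2" using s1 unfolding val_Less_eq_0[OF w(1)] by (simp add: holds_input_def)
    then have V: "reg s1 2 = V" using s1(1) by simp
    have all: "{e \<in> edges. fst e < V} = edges" using edge_vertices by auto
    show "terminates wl (While (Bin Less (Reg 2) (Reg 4)) seed_step) (50 * V + 10)
      (\<lambda>s'. ?I2 s' \<and> val wl s' (Bin Less (Reg 2) (Reg 4)) = 0) (run wl ?P2 s1)" (is "terminates _ _ _ _ ?s2")
    proof (rule terminates_While_loopfree[where m = "\<lambda>s. V - reg s 2" and I = ?I2 and s = ?s2])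
      show "?I2 ?s2" using s1(1) w all unfolding V
        by (auto simp: set_reg_def set_arr_def holds_input_def seeded_def inj_on_def)
      show "?I2 (run wl seed_step s) \<and> V - reg (run wl seed_step s) 2 < V - reg s 2"
        if s: "?I2 s" "val wl s (Bin Less (Reg 2) (Reg 4)) \<noteq> 0" for s
      proof -
        have "reg s 2 < V" using s unfolding val_Less_eq_0[OF w(1)] by (simp add: seeded_def holds_input_def)
        then show ?thesis using seed_step[OF wl, of s] s(1) frame by simp
      qed
    qed (simp_all add: seed_step_def set_reg_def set_arr_def)
  qed simp
  let ?P3 = "block [Put 8 (Reg 5) (Const 1), Set 6 (Const 0)]"
  let ?I3 = "\<lambda>s. holds_input s \<and>
    kahn {e \<in> edges. fst e \<in> arr s 7 ` {..<reg s 6}} (reg s 6) (reg s 7) (arr s 7) (arr s 8) (arr s 6)"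
  have 3: "terminates wl (Seq ?P3 (While (Bin Less (Reg 6) (Reg 7)) kahn_step)) (maxtime ?P3 + (85 * V + 10))
      (\<lambda>s'. ?I3 s' \<and> val wl s' (Bin Less (Reg 6) (Reg 7)) = 0) s2"
    if s2: "?I2 s2" "val wl s2 (Bin Less (Reg 2) (Reg 4)) = 0" for s2
  proof (rule terminates_Seq_loopfree)
    have "V \<le> reg s2 2" using s2 unfolding val_Less_eq_0[OF w(1)] by (simp add: seeded_def holds_input_def)
    then have V: "reg s2 2 = V" using s2(1) by (simp add: seeded_def)
    have s2': "seeded s2" using s2 by simp
    have [simp]: "arr s2 8 = (\<lambda>_. 0)" using s2(1) zero by auto
    show "terminates wl (While (Bin Less (Reg 6) (Reg 7)) kahn_step) (85 * V + 10)
      (\<lambda>s'. ?I3 s' \<and> val wl s' (Bin Less (Reg 6) (Reg 7)) = 0) (run wl ?P3 s2)" (is "terminates _ _ _ _ ?s3")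
    proof (rule terminates_While_loopfree[where m = "\<lambda>s. V - reg s 6" and I = ?I3 and s = ?s3])
      show "?I3 ?s3" using kahn_start[OF s2' V] s2' w
        by (simp add: set_reg_def set_arr_def holds_input_def seeded_def)
      show "?I3 (run wl kahn_step s) \<and> V - reg (run wl kahn_step s) 6 < V - reg s 6"
        if s: "?I3 s" "val wl s (Bin Less (Reg 6) (Reg 7)) \<noteq> 0" for s
      proof -
        have less: "reg s 6 < reg s 7" using s unfolding val_Less_eq_0[OF w(1)] by simp
        have "inj_on (arr s 7) {..<reg s 7}" "arr s 7 ` {..<reg s 7} \<subseteq> {..<V}" using s by (auto simp: kahn_def)
        then have "reg s 7 \<le> V" using card_mono[of "{..<V}" "arr s 7 ` {..<reg s 7}"] by (simp add: card_image)
        then show ?thesis using kahn_step[OF wl, of s] s(1) less by simp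
      qed
    qed (simp_all add: kahn_step_def visit_def set_reg_def set_arr_def)
  qed simp
  have "terminates wl toposort (maxtime (Set 2 (Const 0)) + (50 * V + 10) + ((maxtime ?P2 + (50 * V + 10)) +
      (maxtime ?P3 + (85 * V + 10)))) (\<lambda>s'. ?I3 s' \<and> val wl s' (Bin Less (Reg 6) (Reg 7)) = 0) s"
    unfolding toposort_def
  proof (rule terminates_Seq)
    show "terminates wl (Seq (Set 2 (Const 0)) (While (Bin Less (Reg 2) (Reg 4)) indegree_step))
        (maxtime (Set 2 (Const 0)) + (50 * V + 10)) (\<lambda>s'. ?I1 s' \<and> val wl s' (Bin Less (Reg 2) (Reg 4)) = 0) s"
      using 1 by (intro terminates_Seq_loopfree) (auto simp del: val.simps)
  next
    fix s1 assume s1: "?I1 s1 \<and> val wl s1 (Bin Less (Reg 2) (Reg 4)) = 0"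
    then show "terminates wl (Seq (Seq ?P2 (While (Bin Less (Reg 2) (Reg 4)) seed_step))
        (Seq ?P3 (While (Bin Less (Reg 6) (Reg 7)) kahn_step)))
      ((maxtime ?P2 + (50 * V + 10)) + (maxtime ?P3 + (85 * V + 10)))
      (\<lambda>s'. ?I3 s' \<and> val wl s' (Bin Less (Reg 6) (Reg 7)) = 0) s1"
      by (intro terminates_Seq[OF 2 3]) (simp_all del: val.simps)
  qed
  then show ?thesis
  proof (rule terminates_mono)
    fix s' assume s': "?I3 s' \<and> val wl s' (Bin Less (Reg 6) (Reg 7)) = 0"
    then have "reg s' 7 \<le> reg s' 6" unfolding val_Less_eq_0[OF w(1)] by simp
    moreover have "reg s' 6 \<le> reg s' 7" using s' by (simp add: kahn_def)
    ultimately have "reg s' 6 = reg s' 7" by simp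
    then show "holds_input s' \<and> traversal (arr s' 7) (arr s' 8)"
      using s' kahn_end(2)[of _ "reg s' 7" "arr s' 7" "arr s' 8" "arr s' 6"] by auto
  qed simp
qed

end

section \<open>Heavy edges\<close>

locale traversed = binary_grammar +
  fixes q N :: "nat \<Rightarrow> nat"
  assumes traversal: "traversal q N"
begin

lemmas inj_q = traversal[unfolded traversal_def, THEN conjunct1]
  and q_image = traversal[unfolded traversal_def, THEN conjunct2, THEN conjunct1]
  and q_0 = traversal[unfolded traversal_def, THEN conjunct2, THEN conjunct2, THEN conjunct1]
  and q_order = traversal[unfolded traversal_def, THEN conjunct2, THEN conjunct2, THEN conjunct2,
    THEN conjunct1, rule_format]
  and N_eq = traversal[unfolded traversal_def, THEN conjunct2, THEN conjunct2, THEN conjunct2,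
    THEN conjunct2, THEN conjunct1, rule_format]
  and N_ln = traversal[unfolded traversal_def, THEN conjunct2, THEN conjunct2, THEN conjunct2,
    THEN conjunct2, THEN conjunct2, rule_format]

lemma q_less: "i < V \<Longrightarrow> q i < V"
  using q_image by auto

lemma N_le: "v < V \<Longrightarrow> N v \<le> n"
  using N_ln[of v] ln_pos[of v] by (metis One_nat_def Suc_leI le_trans mult.right_neutral mult_le_mono2)

lemma ln_le: "v < V \<Longrightarrow> 0 < N v \<Longrightarrow> ln v \<le> n"
  using N_ln[of v] by (metis One_nat_def Suc_leI le_trans mult.left_neutral mult_le_mono1)

lemma N_st: "N st = 1"
proof -
  have "{e \<in> edges. target e = st} = {}" using edge_vertices by auto
  with N_eq[OF start(1)] have "N st = of_bool (st = st) + (\<Sum>e\<in>{}. mult e * N (fst e))" by (simp only:)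
  then show ?thesis by simp
qed

lemma edge_N: "e \<in> edges \<Longrightarrow> mult e * N (fst e) \<le> N (target e)"
proof -
  assume e: "e \<in> edges"
  have "mult e * N (fst e) \<le> (\<Sum>e'\<in>{e' \<in> edges. target e' = target e}. mult e' * N (fst e'))"
    using e finite_edges by (intro member_le_sum) auto
  then show ?thesis using N_eq[of "target e"] edge_vertices[OF e] by simp
qed

lemma mult_pos: "e \<in> edges \<Longrightarrow> 0 < mult e"
  using ln_rule(3)[of "fst e"] by (auto simp: mult_def edges_def)

lemma edge_N_le: "e \<in> edges \<Longrightarrow> N (fst e) \<le> N (target e)"
  using edge_N[of e] mult_pos[of e] by (metis One_nat_def Suc_leI le_trans mult.left_neutral mult_le_mono1)

lemma child_later:
  assumes i: "i < V" and e: "e \<in> edges" "fst e = q i"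
  shows "target e \<in> q ` {Suc i..<V}"
proof -
  have "target e \<in> q ` {..<V}" using edge_vertices[OF e(1)] q_image by auto
  then obtain j where j: "j < V" "target e = q j" by auto
  have "fst e \<in> q ` {..<j}" by (rule q_order[OF j(1) e(1) j(2)])
  then obtain k where "k < j" "q k = q i" using e(2) by auto
  then have "k = i" using inj_q i j by (auto dest: inj_onD)
  then show ?thesis using j \<open>k < j\<close> by auto
qed

definition same_class :: "nat \<Rightarrow> nat \<Rightarrow> bool" where
  "same_class u v \<longleftrightarrow> floor_log (ln u) = floor_log (ln v) \<and> floor_log (N u) = floor_log (N v)"

text \<open>The slot of the heavy child, counted from 1; 0 if there is none.\<close>

definition heavy :: "nat \<Rightarrow> nat" where
  "heavy u = (if u < V \<and> kd u = 1 \<and> 0 < N u then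
     if same_class u (lc u) then 1 else if same_class u (rc u) then 2 else 0 else 0)"

definition heavy_child :: "nat \<Rightarrow> nat" where
  "heavy_child u = (if heavy u = 1 then lc u else rc u)"

definition light_child :: "nat \<Rightarrow> nat" where
  "light_child u = (if heavy u = 1 then rc u else lc u)"

text \<open>The occurrences of \<open>v\<close> that continue a heavy path from above; at the
  remaining \<open>N v - M v\<close> ones the path is entered.\<close>

definition M :: "nat \<Rightarrow> nat" where
  "M v = (\<Sum>u\<in>{u. u < V \<and> heavy u \<noteq> 0 \<and> heavy_child u = v}. N u)"

lemma heavy_cases: "heavy u = 0 \<or> heavy u = 1 \<or> heavy u = 2"
  by (simp add: heavy_def)

lemma heavyD:
  assumes "heavy u \<noteq> 0"
  shows "u < V" "kd u = 1" "0 < N u" "heavy_child u < V" "light_child u < V"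
    "ln u = ln (heavy_child u) + ln (light_child u)" "same_class u (heavy_child u)"
    "ex u = (if heavy u = 1 then ex (heavy_child u) @ ex (light_child u) else ex (light_child u) @ ex (heavy_child u))"
    "(u, heavy u - 1) \<in> edges" "target (u, heavy u - 1) = heavy_child u"
    "(u, 2 - heavy u) \<in> edges" "target (u, 2 - heavy u) = light_child u" "heavy u - 1 \<noteq> 2 - heavy u"
    "mult (u, i) = 1"
proof -
  show u: "u < V" "kd u = 1" "0 < N u" using assms by (auto simp: heavy_def split: if_splits)
  show "same_class u (heavy_child u)"
    using assms by (auto simp: heavy_def heavy_child_def split: if_splits)
  show "heavy_child u < V" "light_child u < V" "ln u = ln (heavy_child u) + ln (light_child u)"
    "ex u = (if heavy u = 1 then ex (heavy_child u) @ ex (light_child u) else ex (light_child u) @ ex (heavy_child u))"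
    using rule[OF u(1)] u(2) heavy_cases[of u] by (auto simp: heavy_child_def light_child_def ln_def)
  show "(u, heavy u - 1) \<in> edges" "target (u, heavy u - 1) = heavy_child u"
    "(u, 2 - heavy u) \<in> edges" "target (u, 2 - heavy u) = light_child u" "heavy u - 1 \<noteq> 2 - heavy u"
    "mult (u, i) = 1"
    using assms u heavy_cases[of u]
    by (auto simp: edges_def target_def heavy_child_def light_child_def mult_def)
qed

lemma finite_heavy: "finite {u. u < V \<and> P u}"
  by (rule finite_subset[of _ "{..<V}"]) auto

lemma M_eq: "M v = (\<Sum>e\<in>(\<lambda>u. (u, heavy u - 1)) ` {u. u < V \<and> heavy u \<noteq> 0 \<and> heavy_child u = v}. N (fst e))"
  unfolding M_def by (subst sum.reindex) (auto simp: inj_on_def)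

lemma N_ge_sum_edges:
  assumes "F \<subseteq> {e \<in> edges. target e = v}" "v < V"
  shows "(\<Sum>e\<in>F. N (fst e)) \<le> N v"
proof -
  have "(\<Sum>e\<in>F. N (fst e)) \<le> (\<Sum>e\<in>F. mult e * N (fst e))"
    by (rule sum_mono) (use assms mult_pos in \<open>auto simp: Suc_le_eq\<close>)
  also have "\<dots> \<le> (\<Sum>e\<in>{e \<in> edges. target e = v}. mult e * N (fst e))"
    using assms finite_edges by (intro sum_mono2) auto
  also have "\<dots> \<le> N v" using N_eq[OF assms(2)] by simp
  finally show ?thesis .
qed

lemma heavy_edges_subset:
  "(\<lambda>u. (u, heavy u - 1)) ` {u. u < V \<and> heavy u \<noteq> 0 \<and> heavy_child u = v} \<subseteq> {e \<in> edges. target e = v}"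
  using heavyD(9,10) by auto

lemma M_le: "v < V \<Longrightarrow> M v \<le> N v"
  unfolding M_eq by (rule N_ge_sum_edges[OF heavy_edges_subset])

lemma M_st: "M st = 0"
proof -
  have "heavy_child u \<noteq> st" if "heavy u \<noteq> 0" for u
    using heavyD(9,10)[OF that] edge_vertices by metis
  then have "{u. u < V \<and> heavy u \<noteq> 0 \<and> heavy_child u = st} = {}" by auto
  then show ?thesis by (simp only: M_def sum.empty)
qed

lemma N_le_M: "heavy u \<noteq> 0 \<Longrightarrow> N u \<le> M (heavy_child u)"
  unfolding M_def using heavyD(1)[of u] by (intro member_le_sum) (auto intro: finite_heavy)

text \<open>A light edge is different from all heavy edges into its target, so their contributions
  to \<open>N\<close> add up. Every occurrence of the source is therefore an entry at the
  target.\<close>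

lemma light_edge_N:
  assumes e: "e \<in> edges" and light: "heavy (fst e) = 0 \<or> snd e \<noteq> heavy (fst e) - 1"
  shows "N (fst e) + M (target e) \<le> N (target e)"
proof -
  let ?F = "(\<lambda>u. (u, heavy u - 1)) ` {u. u < V \<and> heavy u \<noteq> 0 \<and> heavy_child u = target e}"
  have "e \<notin> ?F" using light by auto
  moreover have "finite ?F" by (intro finite_imageI finite_heavy)
  ultimately have "N (fst e) + M (target e) = (\<Sum>e\<in>insert e ?F. N (fst e))" unfolding M_eq by simp
  also have "\<dots> \<le> N (target e)"
    using e edge_vertices heavy_edges_subset by (intro N_ge_sum_edges) auto
  finally show ?thesis .
qed

text \<open>Two heavy parents would each contribute at least \<open>2 ^ k\<close> occurrences to a
  child that has fewer than \<open>2 ^ Suc k\<close>.\<close>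

lemma heavy_unique:
  assumes "heavy u \<noteq> 0" "heavy u' \<noteq> 0" "heavy_child u = heavy_child u'"
  shows "u = u'"
proof (rule ccontr)
  assume neq: "u \<noteq> u'"
  note h = heavyD[OF assms(1)] and h' = heavyD[OF assms(2)]
  let ?v = "heavy_child u"
  have "(\<Sum>e\<in>{(u, heavy u - 1), (u', heavy u' - 1)}. N (fst e)) \<le> N ?v"
    using h(9,10) h'(9,10) assms(3) h(4) by (intro N_ge_sum_edges) auto
  then have sum: "N u + N u' \<le> N ?v" using neq by simp
  have "floor_log (N u) = floor_log (N ?v)" "floor_log (N u') = floor_log (N ?v)"
    using h(7) h'(7) assms(3) by (simp_all add: same_class_def)
  then have "2 ^ floor_log (N ?v) \<le> N u" "2 ^ floor_log (N ?v) \<le> N u'"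
    using floor_log_bounds(1)[OF h(3)] floor_log_bounds(1)[OF h'(3)] by auto
  moreover have "0 < N ?v" using sum h(3) by simp
  then have "N ?v < 2 * 2 ^ floor_log (N ?v)" using floor_log_bounds(2) by simp
  ultimately show False using sum by simp
qed

text \<open>The heavy child takes at least \<open>2 ^ k\<close> of fewer than
  \<open>2 ^ Suc k\<close> letters, so fewer than \<open>2 ^ k\<close> remain.\<close>

lemma light_class:
  assumes "heavy u \<noteq> 0"
  shows "floor_log (ln (light_child u)) < floor_log (ln u)"
proof -
  note h = heavyD[OF assms]
  have "ln (light_child u) < 2 ^ floor_log (ln u)"
    using floor_log_bounds(1)[of "ln (heavy_child u)"] floor_log_bounds(2)[of "ln u"]
      ln_pos[OF h(4)] ln_pos[OF h(1)] h(6,7) by (simp add: same_class_def)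
  then show ?thesis using ln_pos[OF h(5)] by (intro floor_log_less)
qed

text \<open>For a binary rule this is the failure of \<open>same_class\<close> along both edges. A
  power rule at least halves the length, which changes the first logarithm; this is why only binary
  rules have heavy edges.\<close>

lemma core_class:
  assumes u: "heavy u = 0" "0 < N u" and e: "e \<in> edges" "fst e = u"
  shows "floor_log (ln (target e)) < floor_log (ln u) \<or>
    floor_log (ln (target e)) = floor_log (ln u) \<and> floor_log (N u) < floor_log (N (target e))"
proof -
  have v: "u < V" using edge_vertices[OF e(1)] e(2) by simp
  have le: "floor_log (ln (target e)) \<le> floor_log (ln u)" "floor_log (N u) \<le> floor_log (N (target e))"
    using ln_target_less[OF e(1)] edge_N_le[OF e(1)] e(2) by (auto intro: floor_log_le_iff)
  show ?thesis
  proof (cases "kd u = 1")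
    case True
    then have "\<not> same_class u (target e)"
      using u v e by (auto simp: heavy_def target_def split: if_splits)
    then show ?thesis using le by (auto simp: same_class_def)
  next
    case False
    then have k: "kd u = 2" "target e = lc u" using e by (auto simp: edges_def target_def)
    have pos: "0 < ln (lc u)" using edge_vertices[OF e(1)] k(2) ln_pos by auto
    have "2 * ln (lc u) \<le> ln u" using ln_rule(3)[OF v k(1)] by simp
    then have "floor_log (2 * ln (lc u)) \<le> floor_log (ln u)" by (rule floor_log_le_iff)
    then show ?thesis using k pos by simp
  qed
qed

end

text \<open>The comparison must be with the smaller number: a child is shorter than its parent but
  occurs at least as often, so the roles are exchanged in the second factor. The product of the two
  truth values is their conjunction.\<close>

abbreviation same_class_test :: "expr \<Rightarrow> expr" where
  "same_class_test v \<equiv> Bin Mul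
     (Bin Less (Bin Xor (Get 9 (Reg 8)) (Get 9 v)) (Get 9 v))
     (Bin Less (Bin Xor (Get 8 v) (Get 8 (Reg 8))) (Get 8 (Reg 8)))"

lemma val_Less_and_Less:
  "0 < wl \<Longrightarrow> val wl s (Bin Mul (Bin Less a b) (Bin Less c d)) \<noteq> 0 \<longleftrightarrow>
    val wl s a < val wl s b \<and> val wl s c < val wl s d"
  by (cases "val wl s a < val wl s b"; cases "val wl s c < val wl s d"; simp)

section \<open>Computing lengths and heavy edges\<close>

definition measure_binary :: com where
  "measure_binary = block [
     Put 9 (Reg 8) (Bin Add (Get 9 (Reg 9)) (Get 9 (Reg 10))),
     If (same_class_test (Reg 9))
       (block [Put 10 (Reg 8) (Const 1), Put 11 (Reg 9) (Bin Add (Get 11 (Reg 9)) (Get 8 (Reg 8)))])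
       (If (same_class_test (Reg 10))
          (block [Put 10 (Reg 8) (Const 2), Put 11 (Reg 10) (Bin Add (Get 11 (Reg 10)) (Get 8 (Reg 8)))])
          Skip)]"

definition measure_step :: com where
  "measure_step = block [
     Set 2 (Bin Sub (Reg 2) (Const 1)), Set 8 (Get 7 (Reg 2)),
     If (Get 8 (Reg 8))
       (block [Set 9 (Get 4 (Reg 8)), Set 10 (Get 5 (Reg 8)),
          If (Bin Eq (Get 3 (Reg 8)) (Const 0)) (Put 9 (Reg 8) (Const 1))
            (If (Bin Eq (Get 3 (Reg 8)) (Const 2))
               (Put 9 (Reg 8) (Bin Mul (Get 9 (Reg 9)) (Reg 10))) measure_binary)])
       Skip]"

definition measure_all :: com where
  "measure_all = Seq (Set 2 (Reg 4)) (While (Reg 2) measure_step)"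

context traversed
begin

text \<open>Lengths are claimed only for vertices with occurrences. For these
  \<open>N v * ln v \<le> n\<close> gives a bound, while an unreachable vertex may derive a string
  whose length does not fit into a word.\<close>

definition measured :: "state \<Rightarrow> bool" where
  "measured s \<longleftrightarrow> holds_input s \<and> arr s 7 = q \<and> arr s 8 = N \<and> reg s 2 \<le> V \<and>
     (\<forall>v \<in> q ` {reg s 2..<V}. 0 < N v \<longrightarrow> arr s 9 v = ln v) \<and>
     (\<forall>v < V. arr s 10 v = (if v \<in> q ` {reg s 2..<V} then heavy v else 0)) \<and>
     (\<forall>v < V. arr s 11 v = (\<Sum>u\<in>{u \<in> q ` {reg s 2..<V}. heavy u \<noteq> 0 \<and> heavy_child u = v}. N u))"

lemma measure_binary:
  assumes wl: "256 * (n + V) < 2 ^ wl" and inp: "arr s 8 = N"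
    and u: "u < V" "reg s 8 = u" "kd u = 1" "0 < N u" and c: "reg s 9 = lc u" "reg s 10 = rc u"
    and len: "arr s 9 (lc u) = ln (lc u)" "arr s 9 (rc u) = ln (rc u)"
    and h: "arr s 10 u = 0" and m: "arr s 11 (heavy_child u) + N u \<le> n"
  defines "s' \<equiv> run wl measure_binary s"
  shows "reg s' = reg s" "\<forall>a. a \<notin> {9, 10, 11} \<longrightarrow> arr s' a = arr s a"
    "arr s' 9 = (arr s 9)(u := ln u)" "arr s' 10 = (arr s 10)(u := heavy u)"
    "arr s' 11 = (if heavy u = 0 then arr s 11 else (arr s 11)(heavy_child u := arr s 11 (heavy_child u) + N u))"
proof -
  have w: "0 < wl" "1 < wl" "2 mod 2 ^ wl = (2::nat)"
    using wl_pos[OF wl] small_mod[OF wl, of 2] n_pos by auto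
  have cV: "lc u < V" "rc u < V" using rule[OF u(1)] u(3) by auto
  have e: "(u, 0) \<in> edges" "(u, 1) \<in> edges" using u by (auto simp: edges_def)
  have Nc: "N u \<le> N (lc u)" "N u \<le> N (rc u)"
    using edge_N_le[OF e(1)] edge_N_le[OF e(2)] by (auto simp: target_def)
  have ln_u: "ln u = ln (lc u) + ln (rc u)" by (rule ln_rule(2)[OF u(1,3)])
  have small: "ln u \<le> n" "N (lc u) \<le> n" "N (rc u) \<le> n" "N u \<le> n"
    using ln_le N_le u cV by auto
  have neq: "lc u \<noteq> u" "rc u \<noteq> u" using ln_target_less[OF e(1)] ln_target_less[OF e(2)] by (auto simp: target_def)
  have xor_small: "(x XOR y) mod 2 ^ wl = x XOR y" if "x \<le> n" "y \<le> n" for x y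
    using small_mod[OF wl, of "x XOR y"] xor_le_add[of x y] that by simp
  have test1: "ln u XOR ln v < ln v \<longleftrightarrow> floor_log (ln u) = floor_log (ln v)" if "v = lc u \<or> v = rc u" for v
    using that ln_u cV ln_pos by (intro same_floor_log_test) auto
  have test2: "N v XOR N u < N u \<longleftrightarrow> floor_log (N v) = floor_log (N u)" if "v = lc u \<or> v = rc u" for v
    using that Nc u(4) by (intro same_floor_log_test) auto
  have mods: "(ln u XOR ln v) mod 2 ^ wl = ln u XOR ln v" "(N v XOR N u) mod 2 ^ wl = N v XOR N u"
    if "v = lc u \<or> v = rc u" for v
    using that xor_small small ln_u by auto
  have ln_mod: "(ln (lc u) + ln (rc u)) mod 2 ^ wl = ln u" using small_mod[OF wl, of "ln u"] small ln_u by simp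
  define s1 where "s1 = set_arr 9 u (ln u) s"
  have s1: "run wl (Put 9 (Reg 8) (Bin Add (Get 9 (Reg 9)) (Get 9 (Reg 10)))) s = s1"
    using u c len ln_mod by (simp add: s1_def)
  have test: "val wl s1 (same_class_test (Reg k)) \<noteq> 0 \<longleftrightarrow> same_class u v"
    if "k = 9 \<and> v = lc u \<or> k = 10 \<and> v = rc u" for k v
  proof -
    have v: "v = lc u \<or> v = rc u" "v \<noteq> u" "arr s 9 v = ln v" "reg s k = v" using that neq len c by auto
    then have "val wl s1 (Get 9 (Reg k)) = ln v" "val wl s1 (Get 9 (Reg 8)) = ln u"
      "val wl s1 (Get 8 (Reg k)) = N v" "val wl s1 (Get 8 (Reg 8)) = N u"
      using u inp by (simp_all add: s1_def set_arr_def)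
    then show ?thesis unfolding val_Less_and_Less[OF w(1)]
      using mods[OF v(1)] test1[OF v(1)] test2[OF v(1)] by (simp add: same_class_def del: val.simps(2,3)) metis
  qed
  have m_mod: "(arr s 11 (heavy_child u) + N u) mod 2 ^ wl = arr s 11 (heavy_child u) + N u"
    using small_mod[OF wl] m by simp
  have s': "s' = (if same_class u (lc u) then set_arr 11 (lc u) (arr s 11 (heavy_child u) + N u) (set_arr 10 u 1 s1)
      else if same_class u (rc u) then set_arr 11 (rc u) (arr s 11 (heavy_child u) + N u) (set_arr 10 u 2 s1) else s1)"
  proof -
    let ?P = "\<lambda>k c. block [Put 10 (Reg 8) (Const c), Put 11 (Reg k) (Bin Add (Get 11 (Reg k)) (Get 8 (Reg 8)))]"
    have t: "val wl s1 (same_class_test (Reg 9)) \<noteq> 0 \<longleftrightarrow> same_class u (lc u)"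
      "val wl s1 (same_class_test (Reg 10)) \<noteq> 0 \<longleftrightarrow> same_class u (rc u)"
      using test by auto
    have "s' = (if same_class u (lc u) then run wl (?P 9 1) s1 else if same_class u (rc u) then run wl (?P 10 2) s1 else s1)"
      unfolding s'_def measure_binary_def block.simps run.simps(1,4,5) s1 t ..
    moreover have "run wl (?P 9 1) s1 = set_arr 11 (lc u) (arr s 11 (heavy_child u) + N u) (set_arr 10 u 1 s1)"
      if "same_class u (lc u)"
      using that m_mod u c inp w by (simp add: s1_def set_arr_def heavy_child_def heavy_def)
    moreover have "run wl (?P 10 2) s1 = set_arr 11 (rc u) (arr s 11 (heavy_child u) + N u) (set_arr 10 u 2 s1)"
      if "same_class u (rc u)" "\<not> same_class u (lc u)"
      using that m_mod u c inp w by (simp add: s1_def set_arr_def heavy_child_def heavy_def)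
    ultimately show ?thesis
      by (cases "same_class u (lc u)"; cases "same_class u (rc u)"; simp only: if_True if_False simp_thms)
  qed
  show "reg s' = reg s" "\<forall>a. a \<notin> {9, 10, 11} \<longrightarrow> arr s' a = arr s a" "arr s' 9 = (arr s 9)(u := ln u)"
    unfolding s' by (auto simp: s1_def set_arr_def)
  have idem: "(arr s 10)(u := 0) = arr s 10" using h by auto
  show "arr s' 10 = (arr s 10)(u := heavy u)"
    "arr s' 11 = (if heavy u = 0 then arr s 11 else (arr s 11)(heavy_child u := arr s 11 (heavy_child u) + N u))"
    unfolding s' using u idem by (auto simp: s1_def set_arr_def heavy_def heavy_child_def)
qed

lemma measure_step:
  assumes wl: "256 * (n + V) < 2 ^ wl" and s: "measured s" and pos: "0 < reg s 2"
  shows "measured (run wl measure_step s)" "reg (run wl measure_step s) 2 = reg s 2 - 1"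
proof -
  define i where "i = reg s 2 - 1"
  define u where "u = q i"
  define s1 where "s1 = set_reg 8 u (set_reg 2 i s)"
  let ?R = "q ` {Suc i..<V}"
  let ?sum = "\<lambda>A v. \<Sum>u\<in>{u \<in> A. heavy u \<noteq> 0 \<and> heavy_child u = v}. N u"
  have w: "0 < wl" "1 < wl" "2 mod 2 ^ wl = (2::nat)"
    using wl_pos[OF wl] small_mod[OF wl, of 2] n_pos by auto
  have i: "reg s 2 = Suc i" "i < V" using pos s by (auto simp: i_def measured_def)
  have inp: "holds_input s" "arr s 7 = q" "arr s 8 = N"
    and len: "\<And>v. v \<in> ?R \<Longrightarrow> 0 < N v \<Longrightarrow> arr s 9 v = ln v"
    and hv: "\<And>v. v < V \<Longrightarrow> arr s 10 v = (if v \<in> ?R then heavy v else 0)"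
    and m: "\<And>v. v < V \<Longrightarrow> arr s 11 v = ?sum ?R v"
    using s by (auto simp: measured_def i(1))
  have u: "u < V" using q_less[OF i(2)] by (simp add: u_def)
  have u_new: "u \<notin> ?R"
  proof
    assume "u \<in> ?R"
    then obtain j where "Suc i \<le> j" "j < V" "u = q j" by auto
    then show False unfolding u_def using inj_q i by (auto dest: inj_onD)
  qed
  have R: "q ` {i..<V} = insert u ?R"
  proof -
    have "{i..<V} = insert i {Suc i..<V}" using i(2) by auto
    then show ?thesis by (simp add: u_def)
  qed
  have R_less: "v < V" if "v \<in> ?R" for v using that q_less by auto
  have child: "target e \<in> ?R" if "e \<in> edges" "fst e = u" for e
    using child_later[OF i(2) that(1)] that(2) by (simp add: u_def)
  have sum: "?sum (insert u ?R) v = ?sum ?R v + (if heavy u \<noteq> 0 \<and> heavy_child u = v then N u else 0)" for v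
  proof -
    have "{u' \<in> insert u ?R. heavy u' \<noteq> 0 \<and> heavy_child u' = v} =
        (if heavy u \<noteq> 0 \<and> heavy_child u = v then insert u {u \<in> ?R. heavy u \<noteq> 0 \<and> heavy_child u = v}
         else {u \<in> ?R. heavy u \<noteq> 0 \<and> heavy_child u = v})" by auto
    then show ?thesis using u_new by simp
  qed
  have step: "run wl (Set 8 (Get 7 (Reg 2))) (run wl (Set 2 (Bin Sub (Reg 2) (Const 1))) s) = s1"
    using i w inp(2) small_mod[OF wl, of i] by (simp add: s1_def u_def set_reg_def)
  have r1: "reg s1 8 = u" "reg s1 2 = i" "arr s1 = arr s" "reg s1 4 = reg s 4" "reg s1 5 = reg s 5"
    by (simp_all add: s1_def set_reg_def)
  have arrs: "arr s1 3 = kd" "arr s1 4 = lc" "arr s1 5 = rc" "arr s1 8 = N" using inp r1 by (simp_all add: holds_input_def)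
  let ?B = "block [Set 9 (Get 4 (Reg 8)), Set 10 (Get 5 (Reg 8)),
          If (Bin Eq (Get 3 (Reg 8)) (Const 0)) (Put 9 (Reg 8) (Const 1))
            (If (Bin Eq (Get 3 (Reg 8)) (Const 2))
               (Put 9 (Reg 8) (Bin Mul (Get 9 (Reg 9)) (Reg 10))) measure_binary)]"
  have run: "run wl measure_step s = (if N u \<noteq> 0 then run wl ?B s1 else s1)"
    unfolding measure_step_def block.simps run.simps(1,4,5) step by (simp add: r1 arrs inp)
  define s2 where "s2 = set_reg 10 (rc u) (set_reg 9 (lc u) s1)"
  have step2: "run wl (Set 10 (Get 5 (Reg 8))) (run wl (Set 9 (Get 4 (Reg 8))) s1) = s2"
    using r1 arrs by (simp add: s2_def set_reg_def)
  have r2: "reg s2 8 = u" "reg s2 9 = lc u" "reg s2 10 = rc u" "reg s2 2 = i" "arr s2 = arr s"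
      "reg s2 4 = reg s 4" "reg s2 5 = reg s 5"
    by (simp_all add: s2_def set_reg_def r1)
  have finish: "measured s' \<and> reg s' 2 = i"
    if "arr s' 9 = (arr s 9)(u := x)" "arr s' 10 = (arr s 10)(u := heavy u)"
      "arr s' 11 = (if heavy u = 0 then arr s 11 else (arr s 11)(heavy_child u := arr s 11 (heavy_child u) + N u))"
      "0 < N u \<longrightarrow> x = ln u" "\<forall>a. a \<notin> {9, 10, 11} \<longrightarrow> arr s' a = arr s a"
      "reg s' 2 = i" "reg s' 4 = reg s 4" "reg s' 5 = reg s 5" for s' x
  proof -
    have "holds_input s'" using inp that(5,7,8) by (simp add: holds_input_def)
    moreover have "arr s' 7 = q" "arr s' 8 = N" using inp that(5) by simp_all
    moreover have "\<forall>v \<in> insert u ?R. 0 < N v \<longrightarrow> arr s' 9 v = ln v" using that(1,4) len by simp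
    moreover have "\<forall>v < V. arr s' 10 v = (if v \<in> insert u ?R then heavy v else 0)" using that(2) hv by simp
    moreover have "\<forall>v < V. arr s' 11 v = ?sum (insert u ?R) v" unfolding sum using that(3) m by simp
    ultimately show ?thesis using i that(6) by (simp add: measured_def R)
  qed
  have "measured (run wl measure_step s) \<and> reg (run wl measure_step s) 2 = i"
  proof (cases "N u = 0")
    case True
    then have "heavy u = 0" by (simp add: heavy_def)
    then show ?thesis using True hv[OF u] u_new r1 by (intro finish[where x = "arr s 9 u"]) (auto simp: run)
  next
    case False
    consider "kd u = 0" | "kd u = 1" | "kd u = 2" using kd_cases[OF u] by metis
    then show ?thesis
    proof cases
      case 1
      then have "heavy u = 0" by (simp add: heavy_def)
      moreover have "run wl measure_step s = set_arr 9 u 1 s2"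
        unfolding run block.simps run.simps(1,4,5) step2 using False 1 w r2 inp by (simp add: holds_input_def)
      ultimately show ?thesis using hv[OF u] u_new r2 ln_rule(1)[OF u 1]
        by (intro finish[where x = 1]) (auto simp: set_arr_def)
    next
      case 2
      have e: "(u, 0) \<in> edges" "(u, 1) \<in> edges" using 2 u by (auto simp: edges_def)
      have c: "lc u \<in> ?R" "rc u \<in> ?R" using child[OF e(1)] child[OF e(2)] by (auto simp: target_def)
      have Nc: "0 < N (lc u)" "0 < N (rc u)"
        using edge_N_le[OF e(1)] edge_N_le[OF e(2)] False by (auto simp: target_def)
      have h: "arr s 10 u = 0" using hv[OF u] u_new by simp
      have hV: "heavy_child u < V" using c R_less by (simp add: heavy_child_def)
      have "arr s 11 (heavy_child u) + N u \<le> n"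
      proof (cases "heavy u = 0")
        case True
        \<comment> \<open>Without a heavy edge \<open>heavy_child u\<close> is \<open>rc u\<close>
          by default; the edge to it is light, so its count still fits beside
          \<open>M\<close>.\<close>
        then have hc: "heavy_child u = rc u" by (simp add: heavy_child_def)
        have ne: "heavy (fst (u, 1)) = 0 \<or> snd (u, 1) \<noteq> heavy (fst (u, 1)) - 1" using True by simp
        have "arr s 11 (rc u) \<le> M (rc u)"
          unfolding m[OF hV[unfolded hc]] M_def using R_less by (intro sum_mono2 finite_heavy) auto
        then show ?thesis using light_edge_N[OF e(2) ne] N_le[OF hV[unfolded hc]] hc by (simp add: target_def)
      next
        case heavy: False
        have "arr s 11 (heavy_child u) + N u = ?sum (insert u ?R) (heavy_child u)" using sum m[OF hV] heavy by simp
        also have "\<dots> \<le> M (heavy_child u)"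
          unfolding M_def using R_less u by (intro sum_mono2 finite_heavy) auto
        also have "\<dots> \<le> n" using M_le[OF hV] N_le[OF hV] by simp
        finally show ?thesis .
      qed
      then have mb: "arr s2 11 (heavy_child u) + N u \<le> n" using r2 by simp
      have run2: "run wl measure_step s = run wl measure_binary s2"
        unfolding run block.simps run.simps(1,4,5) step2 using False 2 w r2 inp by (simp add: holds_input_def)
      have "arr s2 8 = N" "arr s2 9 (lc u) = ln (lc u)" "arr s2 9 (rc u) = ln (rc u)" "arr s2 10 u = 0" "0 < N u"
        using len[OF c(1) Nc(1)] len[OF c(2) Nc(2)] h r2 inp False by auto
      note b = measure_binary[OF wl this(1) u r2(1) 2 this(5) r2(2,3) this(2,3,4) mb]
      show ?thesis unfolding run2 using b r2 by (intro finish[where x = "ln u"]) simp_all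
    next
      case 3
      have e: "(u, 0) \<in> edges" using 3 u by (auto simp: edges_def)
      have c: "lc u \<in> ?R" using child[OF e] by (auto simp: target_def)
      have Nc: "0 < N (lc u)" using edge_N_le[OF e(1)] False by (auto simp: target_def)
      have "heavy u = 0" using 3 by (simp add: heavy_def)
      moreover have "ln (lc u) * rc u = ln u" using ln_rule(3)[OF u 3] by (simp add: mult.commute)
      then have "ln (lc u) * rc u mod 2 ^ wl = ln u" using small_mod[OF wl, of "ln u"] ln_le[OF u] False by simp
      then have "run wl measure_step s = set_arr 9 u (ln u) s2"
        unfolding run block.simps run.simps(1,4,5) step2
        using False 3 w r2 inp len[OF c Nc] by (simp add: holds_input_def)
      ultimately show ?thesis using hv[OF u] u_new r2
        by (intro finish[where x = "ln u"]) (auto simp: set_arr_def)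
    qed
  qed
  then show "measured (run wl measure_step s)" "reg (run wl measure_step s) 2 = reg s 2 - 1"
    by (simp_all add: i_def)
qed

definition annotated :: "state \<Rightarrow> bool" where
  "annotated s \<longleftrightarrow> holds_input s \<and> arr s 7 = q \<and> arr s 8 = N \<and>
     (\<forall>v < V. (0 < N v \<longrightarrow> arr s 9 v = ln v) \<and> arr s 10 v = heavy v \<and> arr s 11 v = M v)"

lemma terminates_measure_all:
  assumes wl: "256 * (n + V) < 2 ^ wl" and s: "holds_input s" "arr s 7 = q" "arr s 8 = N"
    and zero: "\<And>v. arr s 10 v = 0" "\<And>v. arr s 11 v = 0"
  shows "terminates wl measure_all (200 * (V + 1)) annotated s"
proof -
  let ?s1 = "run wl (Set 2 (Reg 4)) s"
  have "terminates wl (While (Reg 2) measure_step) (150 * V + 5) (\<lambda>s. measured s \<and> val wl s (Reg 2) = 0) ?s1"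
  proof (rule terminates_While_loopfree[where m = "\<lambda>s. reg s 2" and I = measured and s = ?s1])
    show "measured ?s1" using s zero by (simp add: measured_def set_reg_def holds_input_def)
    show "measured (run wl measure_step s) \<and> reg (run wl measure_step s) 2 < reg s 2"
      if "measured s" "val wl s (Reg 2) \<noteq> 0" for s
      using measure_step[OF wl that(1)] that(2) by simp
    show "(maxtime measure_step + cost (Reg 2) + 1) * reg ?s1 2 + cost (Reg 2) + 1 \<le> 150 * V + 5"
      using s(1) by (simp add: measure_step_def measure_binary_def set_reg_def holds_input_def)
  qed (simp add: measure_step_def measure_binary_def)
  then have "terminates wl measure_all (maxtime (Set 2 (Reg 4)) + (150 * V + 5))
      (\<lambda>s. measured s \<and> val wl s (Reg 2) = 0) s"
    unfolding measure_all_def by (intro terminates_Seq_loopfree) simp_all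
  then show ?thesis
  proof (rule terminates_mono)
    fix s assume s: "measured s \<and> val wl s (Reg 2) = 0"
    then have 0: "reg s 2 = 0" by simp
    have img: "q ` {0..<V} = {..<V}" using q_image by (simp add: atLeast0LessThan)
    have m: "holds_input s" "arr s 7 = q" "arr s 8 = N" "\<forall>v \<in> {..<V}. 0 < N v \<longrightarrow> arr s 9 v = ln v"
      "\<forall>v < V. arr s 10 v = (if v \<in> {..<V} then heavy v else 0)"
      "\<forall>v < V. arr s 11 v = (\<Sum>u\<in>{u \<in> {..<V}. heavy u \<noteq> 0 \<and> heavy_child u = v}. N u)"
      using s unfolding measured_def 0 img by blast+
    then show "annotated s" by (simp add: annotated_def M_def)
  qed simp
qed

end

section \<open>Writing grammar rules\<close>

lemma run_frame:
  assumes "loopfree P"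
  shows "r \<notin> written_regs P \<Longrightarrow> reg (run wl P s) r = reg s r"
    and "a \<notin> written_arrs P \<Longrightarrow> arr (run wl P s) a = arr s a"
  using exec_loopfree[OF assms, of wl s] exec_frame by blast+

definition outputs :: "nat rhs list \<Rightarrow> state \<Rightarrow> bool" where
  "outputs rs s \<longleftrightarrow> reg s 0 = length rs \<and> reg s 20 = grammar_size \<lparr>rules = rs, start = 0\<rparr> \<and>
     array_holds (arr s 0) (kinds \<lparr>rules = rs, start = 0\<rparr>) \<and>
     array_holds (arr s 1) (offsets \<lparr>rules = rs, start = 0\<rparr>) \<and>
     array_holds (arr s 2) (cells \<lparr>rules = rs, start = 0\<rparr>)"

lemma array_holds_snoc:
  "array_holds f xs \<Longrightarrow> i = length xs \<Longrightarrow> array_holds (f(i := x)) (xs @ [x])"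
  by (simp add: array_holds_def nth_append)

lemma offsets_snoc:
  "offsets \<lparr>rules = rs @ [R], start = 0\<rparr> = offsets \<lparr>rules = rs, start = 0\<rparr> @ [grammar_size \<lparr>rules = rs @ [R], start = 0\<rparr>]"
proof -
  have "[0..<Suc (length (rs @ [R]))] = [0..<Suc (length rs)] @ [Suc (length rs)]" by simp
  then show ?thesis unfolding offsets_def grammar_size_def by (simp del: upt_Suc)
qed

definition emit :: "nat \<Rightarrow> com" where
  "emit k = block [
     Put 0 (Reg 0) (Const k), Put 2 (Reg 20) (Reg 22), Put 2 (Bin Add (Reg 20) (Const 1)) (Reg 23),
     Set 0 (Bin Add (Reg 0) (Const 1)), Set 20 (Bin Add (Reg 20) (Const 2)), Put 1 (Reg 0) (Reg 20)]"

definition emit_term :: com where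
  "emit_term = block [
     Put 0 (Reg 0) (Const 0), Put 2 (Reg 20) (Reg 22),
     Set 0 (Bin Add (Reg 0) (Const 1)), Set 20 (Bin Add (Reg 20) (Const 1)), Put 1 (Reg 0) (Reg 20)]"

lemma written_emit [simp]:
  "loopfree (emit k)" "written_regs (emit k) = {0, 20}" "written_arrs (emit k) = {0, 1, 2}"
  "loopfree emit_term" "written_regs emit_term = {0, 20}" "written_arrs emit_term = {0, 1, 2}"
  by (auto simp: emit_def emit_term_def)

lemma maxtime_emit: "maxtime (emit k) = 23" "maxtime emit_term = 18"
  by (simp_all add: emit_def emit_term_def)

lemma length_cells: "length (cells G) = grammar_size G"
proof -
  have "length (rhs_cells R) = rhs_size R" for R by (cases R) auto
  then show ?thesis by (simp add: cells_def length_concat grammar_size_def comp_def)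
qed

lemma outputs_emit:
  assumes out: "outputs rs s" and R: "rhs_kind R = k" "rhs_cells R = [reg s 22, reg s 23]"
    and k: "k \<in> {1, 2}" and bound: "length rs + grammar_size \<lparr>rules = rs, start = 0\<rparr> + 2 < 2 ^ wl"
  shows "outputs (rs @ [R]) (run wl (emit k) s)"
proof -
  let ?G = "\<lparr>rules = rs, start = 0\<rparr>" and ?s' = "run wl (emit k) s"
  let ?g = "grammar_size ?G" and ?G' = "\<lparr>rules = rs @ [R], start = 0\<rparr>"
  have w: "1 < wl"
  proof (rule ccontr)
    assume "\<not> 1 < wl"
    then have "(2::nat) ^ wl \<le> 2 ^ 1" by (intro power_increasing) auto
    then show False using bound by simp
  qed
  have size: "rhs_size R = 2" using R k by (cases R) auto
  have g': "grammar_size ?G' = ?g + 2" using size by (simp add: grammar_size_def)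
  have s: "reg s 0 = length rs" "reg s 20 = ?g" "array_holds (arr s 0) (kinds ?G)"
    "array_holds (arr s 1) (offsets ?G)" "array_holds (arr s 2) (cells ?G)"
    using out by (auto simp: outputs_def)
  have k': "k mod 2 ^ wl = k" using bound k w by auto
  have len: "length (kinds ?G) = length rs" "length (offsets ?G) = Suc (length rs)" "length (cells ?G) = ?g"
    by (simp_all add: kinds_def offsets_def length_cells)
  have s': "reg ?s' 0 = Suc (length rs)" "reg ?s' 20 = ?g + 2" "arr ?s' 0 = (arr s 0)(length rs := k)"
    "arr ?s' 1 = (arr s 1)(Suc (length rs) := ?g + 2)"
    "arr ?s' 2 = (arr s 2)(?g := reg s 22, Suc ?g := reg s 23)"
    using s bound w k' by (simp_all add: emit_def set_reg_def set_arr_def)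
  have G': "kinds ?G' = kinds ?G @ [k]" "cells ?G' = (cells ?G @ [reg s 22]) @ [reg s 23]"
    using R by (simp_all add: kinds_def cells_def)
  have "array_holds (arr ?s' 2) (cells ?G')"
    unfolding s' G' using s len by (intro array_holds_snoc) simp_all
  moreover have "array_holds (arr ?s' 0) (kinds ?G')" "array_holds (arr ?s' 1) (offsets ?G')"
    unfolding s' G' offsets_snoc g' using s len by (auto intro!: array_holds_snoc)
  ultimately show ?thesis unfolding outputs_def using s' g' by simp
qed

lemma outputs_emit_term:
  assumes out: "outputs rs s" and a: "a = reg s 22"
    and bound: "length rs + grammar_size \<lparr>rules = rs, start = 0\<rparr> + 2 < 2 ^ wl"
  shows "outputs (rs @ [Term a]) (run wl emit_term s)"
proof -
  let ?G = "\<lparr>rules = rs, start = 0\<rparr>" and ?s' = "run wl emit_term s"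
  let ?g = "grammar_size ?G" and ?G' = "\<lparr>rules = rs @ [Term a], start = 0\<rparr>"
  have w: "0 < wl" using bound by (cases wl) auto
  have g': "grammar_size ?G' = ?g + 1" by (simp add: grammar_size_def)
  have s: "reg s 0 = length rs" "reg s 20 = ?g" "array_holds (arr s 0) (kinds ?G)"
    "array_holds (arr s 1) (offsets ?G)" "array_holds (arr s 2) (cells ?G)"
    using out by (auto simp: outputs_def)
  have len: "length (kinds ?G) = length rs" "length (offsets ?G) = Suc (length rs)" "length (cells ?G) = ?g"
    by (simp_all add: kinds_def offsets_def length_cells)
  have s': "reg ?s' 0 = Suc (length rs)" "reg ?s' 20 = ?g + 1" "arr ?s' 0 = (arr s 0)(length rs := 0)"
    "arr ?s' 1 = (arr s 1)(Suc (length rs) := ?g + 1)" "arr ?s' 2 = (arr s 2)(?g := a)"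
    using s bound w a by (simp_all add: emit_term_def set_reg_def set_arr_def)
  have "kinds ?G' = kinds ?G @ [0]" "cells ?G' = cells ?G @ [a]"
    by (simp_all add: kinds_def cells_def)
  then show ?thesis
    unfolding outputs_def s' g' offsets_snoc
    using s len by (auto intro!: array_holds_snoc)
qed

text \<open>Optional variables: \<open>0\<close> stands for the empty string and \<open>Suc A\<close> for the variable \<open>A\<close>.\<close>

definition opt_exp :: "'a rhs list \<Rightarrow> nat \<Rightarrow> 'a list" where
  "opt_exp rs x = (if x = 0 then [] else exps rs ! (x - 1))"

definition opt_height :: "'a rhs list \<Rightarrow> nat \<Rightarrow> nat" where
  "opt_height rs x = (if x = 0 then 0 else heights rs ! (x - 1))"

lemma fold_rules_append: "\<exists>ys. fold_rules f (rs @ rs') = fold_rules f rs @ ys"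
proof (induction rs' rule: rev_induct)
  case (snoc R rs')
  then show ?case by (metis append.assoc fold_rules_snoc)
qed simp

lemma nth_fold_rules_append: "i < length rs \<Longrightarrow> fold_rules f (rs @ rs') ! i = fold_rules f rs ! i"
  using fold_rules_append[of f rs rs'] by (auto simp: nth_append)

lemma opt_append:
  assumes "x \<le> length rs"
  shows "opt_exp (rs @ rs') x = opt_exp rs x" "opt_height (rs @ rs') x = opt_height rs x"
  using assms by (auto simp: opt_exp_def opt_height_def intro!: nth_fold_rules_append)

lemma opt_snoc [simp]:
  "opt_exp (rs @ [R]) (Suc (length rs)) = expand (exps rs) R"
  "opt_height (rs @ [R]) (Suc (length rs)) = rhs_height (heights rs) R"
  using nth_append_length[of "exps rs" "expand (exps rs) R"] nth_append_length[of "heights rs" "rhs_height (heights rs) R"]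
  by (simp_all add: opt_exp_def opt_height_def)

definition join :: com where
  "join = If (Reg 22)
     (If (Reg 23)
        (block [Set 22 (Bin Sub (Reg 22) (Const 1)), Set 23 (Bin Sub (Reg 23) (Const 1)), emit 1, Set 24 (Reg 0)])
        (Set 24 (Reg 22)))
     (Set 24 (Reg 23))"

definition join_rules :: "'a rhs list \<Rightarrow> nat \<Rightarrow> nat \<Rightarrow> 'a rhs list" where
  "join_rules rs x y = (if x \<noteq> 0 \<and> y \<noteq> 0 then rs @ [Vars [x - 1, y - 1]] else rs)"

definition join_var :: "'a rhs list \<Rightarrow> nat \<Rightarrow> nat \<Rightarrow> nat" where
  "join_var rs x y = (if x = 0 then y else if y = 0 then x else Suc (length rs))"

lemma written_join [simp]:
  "loopfree join" "written_regs join = {0, 20, 22, 23, 24}" "written_arrs join = {0, 1, 2}"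
  by (auto simp: join_def)

lemma maxtime_join: "maxtime join = 38"
  by (simp add: join_def maxtime_emit)

lemma join_rules:
  assumes "topological rs" "x \<le> length rs" "y \<le> length rs"
  shows "topological (join_rules rs x y)" "join_var rs x y \<le> length (join_rules rs x y)"
    "\<exists>rs'. join_rules rs x y = rs @ rs'" "length (join_rules rs x y) \<le> Suc (length rs)"
    "length rs \<le> length (join_rules rs x y)"
    "opt_exp (join_rules rs x y) (join_var rs x y) = opt_exp rs x @ opt_exp rs y"
    "opt_height (join_rules rs x y) (join_var rs x y) \<le> Suc (max (opt_height rs x) (opt_height rs y))"
    "x \<noteq> 0 \<Longrightarrow> y \<noteq> 0 \<Longrightarrow> join_var rs x y = length (join_rules rs x y)"
    "x \<noteq> 0 \<or> y \<noteq> 0 \<Longrightarrow> join_var rs x y \<noteq> 0"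
  using assms by (auto simp: join_rules_def join_var_def opt_exp_def opt_height_def nth_append)

lemma run_join:
  assumes out: "outputs rs s" and le: "reg s 22 \<le> length rs" "reg s 23 \<le> length rs"
    and bound: "length rs + grammar_size \<lparr>rules = rs, start = 0\<rparr> + 2 < 2 ^ wl"
  shows "outputs (join_rules rs (reg s 22) (reg s 23)) (run wl join s)"
    "reg (run wl join s) 24 = join_var rs (reg s 22) (reg s 23)"
proof -
  have "outputs (join_rules rs (reg s 22) (reg s 23)) (run wl join s) \<and>
    reg (run wl join s) 24 = join_var rs (reg s 22) (reg s 23)"
  proof (cases "reg s 22 \<noteq> 0 \<and> reg s 23 \<noteq> 0")
    case True
    have w: "0 < wl" using bound by (cases wl) auto
    define s1 where "s1 = set_reg 23 (reg s 23 - 1) (set_reg 22 (reg s 22 - 1) s)"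
    have s1: "reg s1 22 = reg s 22 - 1" "reg s1 23 = reg s 23 - 1" "outputs rs s1"
      using out by (simp_all add: s1_def set_reg_def outputs_def)
    have "run wl join s = run wl (Set 24 (Reg 0)) (run wl (emit 1) s1)"
      using True w le bound by (simp add: join_def s1_def set_reg_def)
    moreover have "outputs (rs @ [Vars [reg s 22 - 1, reg s 23 - 1]]) (run wl (emit 1) s1)"
      by (rule outputs_emit[OF s1(3)]) (use s1 bound in auto)
    ultimately show ?thesis
      using True by (auto simp: join_rules_def join_var_def set_reg_def outputs_def)
  next
    case False
    then show ?thesis using out
      by (auto simp: join_def join_rules_def join_var_def set_reg_def outputs_def)
  qed
  then show "outputs (join_rules rs (reg s 22) (reg s 23)) (run wl join s)"
    "reg (run wl join s) 24 = join_var rs (reg s 22) (reg s 23)" by auto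
qed

lemma grammar_size_le:
  "topological rs \<Longrightarrow> grammar_size \<lparr>rules = rs, start = st\<rparr> \<le> 2 * length rs"
proof (induction rs rule: rev_induct)
  case (snoc R rs)
  have "rhs_size R \<le> 2" using snoc.prems by (cases R) auto
  then show ?case using snoc by (simp add: grammar_size_def)
qed (simp add: grammar_size_def)

text \<open>Registers 14 to 17 pass the left side, the right side, the vertex and the next node; the
  index of the new node is returned in register 12.\<close>

definition new_node :: com where
  "new_node = block [
     Set 22 (Reg 14), Set 23 (Get 17 (Reg 17)), join,
     Set 22 (Reg 24), Set 23 (Reg 15), join,
     Put 15 (Reg 21) (Reg 14), Put 16 (Reg 21) (Reg 15), Put 17 (Reg 21) (Reg 24), Put 18 (Reg 21) (Reg 16),
     Put 19 (Reg 21) (Bin Xor (Get 14 (Reg 16)) (Get 14 (Get 18 (Reg 17)))), Put 20 (Reg 21) (Reg 17),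
     Set 12 (Reg 21), Set 21 (Bin Add (Reg 21) (Const 1))]"

lemma written_new_node [simp]:
  "loopfree new_node" "written_regs new_node = {0, 12, 20, 21, 22, 23, 24}"
  "written_arrs new_node = {0, 1, 2, 15, 16, 17, 18, 19, 20}"
  by (auto simp: new_node_def)

lemma maxtime_new_node: "maxtime new_node = 115"
  by (simp add: new_node_def maxtime_join)

lemma run_new_node:
  assumes out: "outputs rs s" "topological rs" and bound: "3 * length rs + 8 < 2 ^ wl" "reg s 21 + 1 < 2 ^ wl"
    and le: "reg s 14 \<le> length rs" "reg s 15 \<le> length rs" "arr s 17 (reg s 17) \<le> length rs" "arr s 17 (reg s 17) \<noteq> 0"
    and xor: "arr s 14 (reg s 16) XOR arr s 14 (arr s 18 (reg s 17)) < 2 ^ wl"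
    and fresh: "reg s 17 < reg s 21"
  defines "s' \<equiv> run wl new_node s" and "e \<equiv> arr s 17 (reg s 17)" and "t \<equiv> reg s 21"
  shows "\<exists>rs' z. outputs (rs @ rs') s' \<and> topological (rs @ rs') \<and> length rs' \<le> 2 \<and> z \<le> length (rs @ rs') \<and>
    opt_exp (rs @ rs') z = opt_exp rs (reg s 14) @ opt_exp rs e @ opt_exp rs (reg s 15) \<and>
    opt_height (rs @ rs') z \<le> 2 + max (opt_height rs e) (max (opt_height rs (reg s 14)) (opt_height rs (reg s 15))) \<and>
    z \<noteq> 0 \<and> (reg s 14 \<noteq> 0 \<or> reg s 15 \<noteq> 0 \<longrightarrow> z = length (rs @ rs')) \<and>
    (reg s 14 = 0 \<or> reg s 15 = 0 \<longrightarrow> length rs' \<le> 1) \<and>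
    arr s' 15 = (arr s 15)(t := reg s 14) \<and> arr s' 16 = (arr s 16)(t := reg s 15) \<and>
    arr s' 17 = (arr s 17)(t := z) \<and> arr s' 18 = (arr s 18)(t := reg s 16) \<and>
    arr s' 19 = (arr s 19)(t := arr s 14 (reg s 16) XOR arr s 14 (arr s 18 (reg s 17))) \<and>
    arr s' 20 = (arr s 20)(t := reg s 17) \<and> reg s' 12 = t \<and> reg s' 21 = t + 1"
proof -
  have w: "0 < wl" using bound by (cases wl) auto
  define x where "x = reg s 14"
  define y where "y = reg s 15"
  define s1 where "s1 = set_reg 23 e (set_reg 22 x s)"
  define s2 where "s2 = run wl join s1"
  define rs1 where "rs1 = join_rules rs x e"
  define z1 where "z1 = join_var rs x e"
  define s3 where "s3 = set_reg 23 y (set_reg 22 z1 s2)"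
  define s4 where "s4 = run wl join s3"
  define rs2 where "rs2 = join_rules rs1 z1 y"
  define z where "z = join_var rs1 z1 y"
  have le': "x \<le> length rs" "y \<le> length rs" "e \<le> length rs" "e \<noteq> 0" using le by (auto simp: x_def y_def e_def)
  note j1 = join_rules[OF out(2) le'(1,3), folded rs1_def z1_def]
  have y: "y \<le> length rs1" using le'(2) j1(5) by simp
  note j2 = join_rules[OF j1(1,2) y, folded rs2_def z_def]
  obtain us where us: "rs1 = rs @ us" using j1(3) by auto
  obtain vs where vs: "rs2 = rs1 @ vs" using j2(3) by auto
  have s1: "outputs rs s1" "reg s1 22 = x" "reg s1 23 = e"
    using out by (simp_all add: s1_def set_reg_def outputs_def)
  have "length rs + grammar_size \<lparr>rules = rs, start = 0\<rparr> + 2 < 2 ^ wl"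
    using grammar_size_le[OF out(2), of 0] bound(1) by simp
  then have s2: "outputs rs1 s2" "reg s2 24 = z1"
    using run_join[OF s1(1)] s1(2,3) le' by (simp_all add: s2_def rs1_def z1_def)
  have s2f: "\<And>r. r \<notin> {0, 20, 22, 23, 24} \<Longrightarrow> reg s2 r = reg s r" "\<And>a. a \<notin> {0, 1, 2} \<Longrightarrow> arr s2 a = arr s a"
    unfolding s2_def s1_def by (simp_all add: run_frame set_reg_def)
  have s3: "outputs rs1 s3" "reg s3 22 = z1" "reg s3 23 = y"
    using s2 by (simp_all add: s3_def set_reg_def outputs_def)
  have "length rs1 + grammar_size \<lparr>rules = rs1, start = 0\<rparr> + 2 < 2 ^ wl"
    using grammar_size_le[OF j1(1), of 0] bound(1) j1(4) by simp
  then have s4: "outputs rs2 s4" "reg s4 24 = z"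
    using run_join[OF s3(1)] s3(2,3) j1(2) y by (simp_all add: s4_def rs2_def z_def)
  have s4f: "\<And>r. r \<notin> {0, 20, 22, 23, 24} \<Longrightarrow> reg s4 r = reg s r" "\<And>a. a \<notin> {0, 1, 2} \<Longrightarrow> arr s4 a = arr s a"
    unfolding s4_def s3_def by (simp_all add: run_frame set_reg_def s2f)
  have step1: "run wl (Set 23 (Get 17 (Reg 17))) (run wl (Set 22 (Reg 14)) s) = s1"
    by (simp add: s1_def x_def e_def set_reg_def)
  have step2: "run wl (Set 23 (Reg 15)) (run wl (Set 22 (Reg 24)) s2) = s3"
    using s2(2) by (simp add: s3_def y_def set_reg_def s2f)
  have s': "s' = run wl (block [Put 15 (Reg 21) (Reg 14), Put 16 (Reg 21) (Reg 15), Put 17 (Reg 21) (Reg 24),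
     Put 18 (Reg 21) (Reg 16),
     Put 19 (Reg 21) (Bin Xor (Get 14 (Reg 16)) (Get 14 (Get 18 (Reg 17)))), Put 20 (Reg 21) (Reg 17),
     Set 12 (Reg 21), Set 21 (Bin Add (Reg 21) (Const 1))]) s4"
    unfolding s'_def new_node_def block.simps(2) run.simps(4) step1 s2_def[symmetric] step2 s4_def[symmetric] ..
  have arrs: "arr s' 15 = (arr s 15)(t := x) \<and> arr s' 16 = (arr s 16)(t := y) \<and>
    arr s' 17 = (arr s 17)(t := z) \<and> arr s' 18 = (arr s 18)(t := reg s 16) \<and>
    arr s' 19 = (arr s 19)(t := arr s 14 (reg s 16) XOR arr s 14 (arr s 18 (reg s 17))) \<and>
    arr s' 20 = (arr s 20)(t := reg s 17) \<and> reg s' 12 = t \<and> reg s' 21 = t + 1"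
    unfolding s' using s4(2) s4f w xor bound(2) fresh by (simp add: set_arr_def set_reg_def x_def y_def t_def)
  have out': "outputs rs2 s'"
    unfolding s' using s4(1) by (simp add: outputs_def set_arr_def set_reg_def)
  have z1: "z1 \<noteq> 0" using j1(9) le'(4) by simp
  have "opt_exp rs2 z = opt_exp rs1 z1 @ opt_exp rs y" using j2(6) opt_append(1)[OF le'(2)] us by simp
  then have ex: "opt_exp rs2 z = opt_exp rs x @ opt_exp rs e @ opt_exp rs y" using j1(6) by simp
  have "opt_height rs2 z \<le> Suc (max (opt_height rs1 z1) (opt_height rs y))"
    using j2(7) opt_append(2)[OF le'(2)] us by simp
  then have ht: "opt_height rs2 z \<le> 2 + max (opt_height rs e) (max (opt_height rs x) (opt_height rs y))"
    using j1(7) by linarith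
  have fin: "x \<noteq> 0 \<or> y \<noteq> 0 \<longrightarrow> z = length rs2"
    using j1(8) j2(8) z1 le'(4) by (auto simp: z_def join_var_def rs2_def join_rules_def)
  have short: "x = 0 \<or> y = 0 \<longrightarrow> length (us @ vs) \<le> 1"
    using us vs j1(4) j2(4) le'(4) by (auto simp: rs1_def rs2_def join_rules_def split: if_splits)
  have "rs2 = rs @ (us @ vs)" using us vs by simp
  moreover have "length (us @ vs) \<le> 2" using j1(4) j2(4) us vs by simp
  ultimately show ?thesis
    using arrs out' ex ht fin short j2(1,2,9) z1 unfolding x_def[symmetric] y_def[symmetric]
    by (intro exI[of _ "us @ vs"] exI[of _ z]) simp
qed

section \<open>Balanced stacks along heavy paths\<close>

context traversed
begin

section \<open>Height bounds\<close>

abbreviation "fl \<equiv> floor_log"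

definition entries :: "nat \<Rightarrow> nat" where
  "entries v = N v - M v"

definition class_exp :: "nat \<Rightarrow> nat" where
  "class_exp v = fl (ln v) + fl (N v)"

text \<open>The largest key level on a path: a bottom node has the key
  \<open>128 * (ln v * N v)\<close>, which is below \<open>2 ^ (class_exp v + 9)\<close>.\<close>

definition level_bound :: "nat \<Rightarrow> nat" where
  "level_bound v = class_exp v + 8"

text \<open>Solved from \<open>light_bound\<close>. A light child \<open>x\<close> of
  \<open>u\<close> enters the trie at level \<open>fl (ln x) + fl (N u)\<close>. The term
  \<open>- fl (N u)\<close> cancels the second part of this level, and the first part completes the
  slope 28 to the slope 29 of \<open>vertex_bound\<close>. The drop of \<open>fl (ln x)\<close>
  below \<open>fl (ln u)\<close> yields the 28 that absorb the constants.\<close>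

definition side_bound :: "nat \<Rightarrow> int" where
  "side_bound v = 29 * (int (fl n) - int (fl (N v))) + 28 * (int (fl (ln v)) - 1) + 30 - int (fl (N v))"

text \<open>Along an edge that leaves a bottom vertex one of the logarithms changes. This is worth
  29 for the length, and still 27 for the occurrences after the \<open>entries\<close> term of
  \<open>vertex_bound\<close> is paid. The constant of \<open>vertex_bound\<close> is thus covered
  up to 2, and 13 leaves room for this and for the new rule.\<close>

definition node_bound :: "nat \<Rightarrow> int" where
  "node_bound v = 29 * (int (fl (ln v)) + int (fl n) - int (fl (N v))) + 13"

text \<open>The bound of \<open>node_ok\<close> for a key of level
  \<open>fl (entries v) + fl (ln v)\<close>: such a level is
  \<open>fl (N v) - fl (entries v) + 8\<close> below \<open>level_bound v\<close>, each level costs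
  2, and \<open>29 = 13 + 2 * 8\<close>.\<close>

definition vertex_bound :: "nat \<Rightarrow> int" where
  "vertex_bound v = 29 * (int (fl (ln v)) + int (fl n) - int (fl (N v))) +
     2 * (int (fl (N v)) - int (fl (entries v))) + 29"

definition low :: "nat rhs list \<Rightarrow> nat \<Rightarrow> nat \<Rightarrow> nat \<Rightarrow> bool" where
  "low rs v k x \<longleftrightarrow> x \<noteq> 0 \<longrightarrow> int (opt_height rs x) \<le> side_bound v + int k - 1"

lemma class_cong:
  assumes "same_class u v"
  shows "class_exp u = class_exp v" "level_bound u = level_bound v" "side_bound u = side_bound v"
    "node_bound u = node_bound v" "low rs u = low rs v"
  using assms by (auto simp: same_class_def class_exp_def level_bound_def side_bound_def node_bound_def low_def fun_eq_iff)

lemma same_class_sym: "same_class u v \<Longrightarrow> same_class v u"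
  and same_class_trans: "same_class u v \<Longrightarrow> same_class v w \<Longrightarrow> same_class u w"
  by (auto simp: same_class_def)

lemma low_mono: "low rs v k x \<Longrightarrow> k \<le> k' \<Longrightarrow> low rs v k' x"
  by (auto simp: low_def)

lemma low_append: "x \<le> length rs \<Longrightarrow> low (rs @ rs') v k x \<longleftrightarrow> low rs v k x"
  by (simp add: low_def opt_append)

lemma fl_N_le: "v < V \<Longrightarrow> fl (N v) \<le> fl n"
  using N_le by (intro floor_log_le_iff)

lemma class_exp_le:
  assumes v: "v < V" "0 < N v"
  shows "2 ^ class_exp v \<le> ln v * N v" "ln v * N v < 2 ^ (class_exp v + 2)" "2 ^ class_exp v \<le> n"
proof -
  note b = floor_log_bounds[OF v(2)] floor_log_bounds[OF ln_pos[OF v(1)]]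
  show 1: "2 ^ class_exp v \<le> ln v * N v"
    unfolding class_exp_def power_add using b by (intro mult_mono) auto
  have "ln v * N v < 2 ^ Suc (fl (ln v)) * 2 ^ Suc (fl (N v))"
    using b v by (intro mult_strict_mono) auto
  then show "ln v * N v < 2 ^ (class_exp v + 2)" by (simp add: class_exp_def power_add)
  show "2 ^ class_exp v \<le> n" using 1 N_ln[OF v(1)] by (simp add: mult.commute)
qed

text \<open>A node of a stack represents a segment of a heavy path; \<open>D\<close> is its height above the bottom
  of the stack. The variable \<open>ne\<close> of a node derives the string of the first vertex \<open>nw\<close> of the segment:
  it consists of the light subtrees left (\<open>nl\<close>) and right (\<open>nr\<close>) of the segment, and
  of the string of the next node \<open>nx\<close>. The key \<open>nk\<close> compares the positions of both nodes.\<close>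

abbreviation "pos s v \<equiv> arr s 13 v"
abbreviation "mu s v \<equiv> arr s 14 v"
abbreviation "tp s v \<equiv> arr s 12 v"
abbreviation "nl s t \<equiv> arr s 15 t"
abbreviation "nr s t \<equiv> arr s 16 t"
abbreviation "ne s t \<equiv> arr s 17 t"
abbreviation "nw s t \<equiv> arr s 18 t"
abbreviation "nk s t \<equiv> arr s 19 t"
abbreviation "nx s t \<equiv> arr s 20 t"

text \<open>Condition for putting a node of \<open>w\<close> with sides \<open>l\<close> and
  \<open>r\<close> on top of the node \<open>x\<close>. Key levels fall strictly from the bottom of
  the stack to its top. The sides at both ends of the link are low at the level of its key, so
  merging the two nodes costs just one level. Points increase towards the top, except that the point
  of the bottom vertex is the largest.\<close>

definition link_ok :: "nat rhs list \<Rightarrow> (nat \<Rightarrow> nat) \<Rightarrow> state \<Rightarrow> nat \<Rightarrow> nat \<Rightarrow> nat \<Rightarrow> nat \<Rightarrow> bool" where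
  "link_ok rs D s w x l r \<longleftrightarrow>
     same_class w (nw s x) \<and> ex w = opt_exp rs l @ ex (nw s x) @ opt_exp rs r \<and>
     (D x \<noteq> 0 \<longrightarrow> mu s (nw s x) < mu s w) \<and> mu s w < 2 ^ (class_exp w + 4) \<and>
     fl (mu s w XOR mu s (nw s x)) < fl (nk s x) \<and>
     (\<forall>y \<in> {l, r, nl s x, nr s x}. low rs w (fl (mu s w XOR mu s (nw s x))) y)"

text \<open>The machine does not store \<open>D\<close>. The point of a bottom vertex is at least
  \<open>2 ^ (class_exp v + 5)\<close>, whereas all other points of the path are below
  \<open>2 ^ (class_exp v + 4)\<close>; hence the key of the link to the bottom has a higher bit
  than the keys between steps. The key of the bottom node itself, four times its point, is a
  sentinel that stops merging.\<close>

definition node_ok :: "nat rhs list \<Rightarrow> (nat \<Rightarrow> nat) \<Rightarrow> state \<Rightarrow> nat \<Rightarrow> bool" where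
  "node_ok rs D s t \<longleftrightarrow>
     nw s t < V \<and> 0 < N (nw s t) \<and> ne s t \<noteq> 0 \<and> ne s t \<le> length rs \<and> opt_exp rs (ne s t) = ex (nw s t) \<and>
     int (opt_height rs (ne s t)) \<le> node_bound (nw s t) + 2 * (int (level_bound (nw s t)) - int (fl (nk s t))) \<and>
     fl (nk s t) \<le> level_bound (nw s t) \<and> nl s t \<le> length rs \<and> nr s t \<le> length rs \<and>
     (if D t = 0 then nl s t = 0 \<and> nr s t = 0 \<and> mu s (nw s t) = 32 * (ln (nw s t) * N (nw s t)) \<and>
        nk s t = 4 * mu s (nw s t)
      else nx s t < t \<and> D t = Suc (D (nx s t)) \<and> nk s t = mu s (nw s t) XOR mu s (nw s (nx s t)) \<and>
        link_ok rs D s (nw s t) (nx s t) (nl s t) (nr s t))"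

definition nodes_ok :: "nat rhs list \<Rightarrow> (nat \<Rightarrow> nat) \<Rightarrow> nat set \<Rightarrow> state \<Rightarrow> bool" where
  "nodes_ok rs D S s \<longleftrightarrow> annotated s \<and> outputs rs s \<and> topological rs \<and>
     (\<forall>t < reg s 21. node_ok rs D s t \<and> nw s t \<in> S)"

definition same_nodes :: "nat \<Rightarrow> state \<Rightarrow> state \<Rightarrow> bool" where
  "same_nodes c s s' \<longleftrightarrow> (\<forall>t < c. \<forall>a \<in> {15..20}. arr s' a t = arr s a t)"

lemma same_nodesD:
  assumes "same_nodes c s s'" "t < c"
  shows "nl s' t = nl s t" "nr s' t = nr s t" "ne s' t = ne s t" "nw s' t = nw s t" "nk s' t = nk s t" "nx s' t = nx s t"
  using assms by (auto simp: same_nodes_def)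

lemma nodes_okD:
  assumes "nodes_ok rs D S s" "t < reg s 21"
  shows "node_ok rs D s t" "nw s t \<in> S" "nw s t < V" "0 < N (nw s t)" "ne s t \<noteq> 0" "ne s t \<le> length rs"
    "nl s t \<le> length rs" "nr s t \<le> length rs"
  using assms by (auto simp: nodes_ok_def node_ok_def)

text \<open>Nodes are never overwritten and rules are only appended, so older stacks stay valid
  while newer ones share their nodes.\<close>

lemma node_ok_mono:
  assumes ok: "nodes_ok rs D S s" and t: "t < reg s 21" and same: "same_nodes (reg s 21) s s'"
    and mu: "\<And>v. v \<in> S \<Longrightarrow> mu s' v = mu s v" and D: "\<And>t. t < reg s 21 \<Longrightarrow> D' t = D t"
  shows "node_ok (rs @ rs') D' s' t"
proof -
  note same_t = same_nodesD[OF same t] and ok_t = nodes_okD[OF ok t]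
  note le = ok_t(6-8)
  show ?thesis
  proof (cases "D t = 0")
    case True
    then show ?thesis using ok_t(1) le(1)
      unfolding node_ok_def same_t mu[OF ok_t(2)] D[OF t] opt_append[OF le(1)]
      by (elim conjE, intro conjI) simp_all
  next
    case False
    then have x: "nx s t < reg s 21" "nx s t < t" using ok_t(1) t by (auto simp: node_ok_def)
    note same_x = same_nodesD[OF same x(1)] and ok_x = nodes_okD[OF ok x(1)]
    have "link_ok rs D s (nw s t) (nx s t) (nl s t) (nr s t)" using ok_t(1) False by (simp add: node_ok_def)
    then have "link_ok (rs @ rs') D' s' (nw s t) (nx s t) (nl s t) (nr s t)"
      using le ok_x(6-8) mu[OF ok_t(2)] mu[OF ok_x(2)] D[OF x(1)] same_x
      by (simp add: link_ok_def opt_append low_append)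
    then show ?thesis
      using ok_t(1) False le
      unfolding node_ok_def same_t same_x mu[OF ok_t(2)] mu[OF ok_x(2)] D[OF t] D[OF x(1)]
        opt_append[OF le(1)] if_not_P[OF False]
      by (elim conjE, intro conjI) simp_all
  qed
qed

lemma mu_le:
  assumes "nodes_ok rs D S s" "t < reg s 21"
  shows "mu s (nw s t) \<le> 32 * n"
proof -
  note t = nodes_okD[OF assms]
  note c = class_exp_le[OF t(3,4)]
  have "ln (nw s t) * N (nw s t) \<le> n" using N_ln[OF t(3)] by (simp add: mult.commute)
  moreover have "(2::nat) ^ (class_exp (nw s t) + 4) \<le> 16 * n" using c(3) by (simp add: power_add)
  ultimately show ?thesis using t(1) by (cases "D t = 0") (auto simp: node_ok_def link_ok_def)
qed

lemma annotated_frame: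
  assumes "annotated s" "\<And>a. a \<in> {3, 4, 5, 7, 8, 9, 10, 11} \<Longrightarrow> arr s' a = arr s a" "reg s' 4 = reg s 4" "reg s' 5 = reg s 5"
  shows "annotated s'"
  using assms by (simp add: annotated_def holds_input_def)

text \<open>On the way to the next node the two joins are paid by the fall of the key level from
  \<open>k'\<close> to \<open>k\<close>. On the way into a side the claim is linear in
  \<open>k\<close> and follows from \<open>k < level_bound w\<close>.\<close>

lemma node_height:
  assumes w: "w < V" and k: "k < k'" "k' \<le> level_bound w"
    and e: "int e \<le> node_bound w + 2 * (int (level_bound w) - int k')"
    and x: "x = 0 \<or> int x \<le> side_bound w + int k - 1" and y: "y = 0 \<or> int y \<le> side_bound w + int k - 1"
    and h: "h \<le> 2 + max e (max x y)"
  shows "int h \<le> node_bound w + 2 * (int (level_bound w) - int k)"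
  using fl_N_le[OF w] k e x y h
  unfolding node_bound_def side_bound_def level_bound_def class_exp_def by (auto simp: max_def split: if_splits)

lemma new_node:
  assumes wl: "256 * (n + V) < 2 ^ wl" and ok: "nodes_ok rs D S s"
    and bound: "3 * length rs + 8 < 2 ^ wl" "reg s 21 + 1 < 2 ^ wl"
    and w: "reg s 16 < V" "0 < N (reg s 16)" and x: "reg s 17 < reg s 21"
    and le: "reg s 14 \<le> length rs" "reg s 15 \<le> length rs"
    and link: "link_ok rs D s (reg s 16) (reg s 17) (reg s 14) (reg s 15)"
  defines "s' \<equiv> run wl new_node s" and "t \<equiv> reg s 21"
  shows "\<exists>rs'. nodes_ok (rs @ rs') (D(t := Suc (D (reg s 17)))) (insert (reg s 16) S) s' \<and> length rs' \<le> 2 \<and>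
    (reg s 14 = 0 \<or> reg s 15 = 0 \<longrightarrow> length rs' \<le> 1) \<and>
    (reg s 14 \<noteq> 0 \<or> reg s 15 \<noteq> 0 \<longrightarrow> ne s' t = length (rs @ rs')) \<and>
    reg s' 12 = t \<and> reg s' 21 = Suc t \<and> same_nodes t s s' \<and> nl s' t = reg s 14 \<and> nr s' t = reg s 15 \<and>
    nw s' t = reg s 16 \<and> nx s' t = reg s 17 \<and> nk s' t = mu s (reg s 16) XOR mu s (nw s (reg s 17))"
proof -
  define w where "w = reg s 16"
  define nxt where "nxt = reg s 17"
  define l where "l = reg s 14"
  define r where "r = reg s 15"
  define K where "K = mu s w XOR mu s (nw s nxt)"
  note ok_x = nodes_okD[OF ok x, folded nxt_def]
  note link' = link[unfolded link_ok_def, folded w_def nxt_def l_def r_def, folded K_def]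
  have w': "w < V" "0 < N w" using w by (simp_all add: w_def)
  have "mu s w \<le> 16 * n" using link' class_exp_le(3)[OF w'] by (simp add: power_add)
  then have "K \<le> 48 * n" unfolding K_def
    using xor_le_add[of "mu s w" "mu s (nw s nxt)"] mu_le[OF ok x] by (simp add: nxt_def)
  then have K_small: "K < 2 ^ wl" using wl by simp
  have out: "outputs rs s" "topological rs" "annotated s" using ok by (auto simp: nodes_ok_def)
  obtain rs' z where rs': "outputs (rs @ rs') s'" "topological (rs @ rs')" "length rs' \<le> 2" "z \<le> length (rs @ rs')"
    "opt_exp (rs @ rs') z = opt_exp rs l @ opt_exp rs (ne s nxt) @ opt_exp rs r"
    "opt_height (rs @ rs') z \<le> 2 + max (opt_height rs (ne s nxt)) (max (opt_height rs l) (opt_height rs r))"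
    "z \<noteq> 0" "l \<noteq> 0 \<or> r \<noteq> 0 \<longrightarrow> z = length (rs @ rs')" "l = 0 \<or> r = 0 \<longrightarrow> length rs' \<le> 1"
    and s': "arr s' 15 = (arr s 15)(t := l)" "arr s' 16 = (arr s 16)(t := r)" "arr s' 17 = (arr s 17)(t := z)"
    "arr s' 18 = (arr s 18)(t := w)" "arr s' 19 = (arr s 19)(t := K)" "arr s' 20 = (arr s 20)(t := nxt)"
    "reg s' 12 = t" "reg s' 21 = t + 1"
    using run_new_node[OF out(1,2) bound le ok_x(6,5)[unfolded nxt_def] K_small[unfolded K_def w_def nxt_def] x]
    unfolding s'_def[symmetric] t_def[symmetric] l_def[symmetric] r_def[symmetric] w_def[symmetric]
      nxt_def[symmetric] K_def[symmetric]
    by (elim exE conjE) (rule that; assumption)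
  let ?D = "D(t := Suc (D nxt))"
  have "\<forall>a \<in> {15..20}. \<exists>v. arr s' a = (arr s a)(t := v)"
  proof
    fix a :: nat assume "a \<in> {15..20}"
    then consider "a = 15" | "a = 16" | "a = 17" | "a = 18" | "a = 19" | "a = 20" by fastforce
    then show "\<exists>v. arr s' a = (arr s a)(t := v)" using s' by cases blast+
  qed
  then have same: "same_nodes t s s'" unfolding same_nodes_def by (metis fun_upd_other less_irrefl)
  have mu: "arr s' 14 = arr s 14" unfolding s'_def by (simp add: run_frame)
  have ann: "annotated s'" unfolding s'_def by (rule annotated_frame[OF out(3)]) (auto simp: run_frame)
  have xt: "nxt < t" using x by (simp add: nxt_def t_def)
  note same_x = same_nodesD[OF same xt]
  have cls: "same_class w (nw s nxt)" and kx: "fl K < fl (nk s nxt)" using link' by auto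
  note cc = class_cong[OF cls]
  have kx': "fl (nk s nxt) \<le> level_bound w" using ok_x(1) cc by (simp add: node_ok_def)
  have low: "low rs w (fl K) l" "low rs w (fl K) r" using link' by auto
  have height: "int (opt_height (rs @ rs') z) \<le> node_bound w + 2 * (int (level_bound w) - int (fl K))"
  proof (rule node_height[OF w'(1) kx kx' _ _ _ rs'(6)])
    show "int (opt_height rs (ne s nxt)) \<le> node_bound w + 2 * (int (level_bound w) - int (fl (nk s nxt)))"
      using ok_x(1) cc by (simp add: node_ok_def)
    show "opt_height rs l = 0 \<or> int (opt_height rs l) \<le> side_bound w + int (fl K) - 1"
      "opt_height rs r = 0 \<or> int (opt_height rs r) \<le> side_bound w + int (fl K) - 1"
      using low by (auto simp: low_def opt_height_def)
  qed
  have le': "l \<le> length rs" "r \<le> length rs" using le by (simp_all add: l_def r_def)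
  have "link_ok (rs @ rs') ?D s' w nxt l r"
    unfolding link_ok_def mu same_x K_def[symmetric]
    using link' le' ok_x(7,8) xt by (simp add: opt_append low_append)
  then have new: "node_ok (rs @ rs') ?D s' t"
    unfolding node_ok_def using s' rs'(4,5,7) height w' kx kx' link' le' ok_x xt mu
    by (simp add: K_def[symmetric] opt_append node_ok_def)
  have "node_ok (rs @ rs') ?D s' t' \<and> nw s' t' \<in> insert w S" if "t' < Suc t" for t'
  proof (cases "t' = t")
    case False
    then have t': "t' < reg s 21" using that by (simp add: t_def)
    have "node_ok (rs @ rs') ?D s' t'"
      by (rule node_ok_mono[OF ok t' same[unfolded t_def]]) (use mu in \<open>auto simp: t_def\<close>)
    then show ?thesis using nodes_okD(2)[OF ok t'] same_nodesD[OF same[unfolded t_def] t'] by simp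
  qed (use new s' in simp)
  then have "nodes_ok (rs @ rs') ?D (insert w S) s'"
    using rs' s' ann by (simp add: nodes_ok_def)
  then show ?thesis
    using rs'(3,8,9) s' same
    unfolding l_def[symmetric] r_def[symmetric] w_def[symmetric] nxt_def[symmetric] K_def[symmetric]
    by (intro exI[of _ rs']) simp
qed

end

section \<open>Merging the topmost nodes of a stack\<close>

definition merge_step :: com where
  "merge_step = block [
     Set 25 (Get 20 (Reg 12)),
     Set 22 (Get 15 (Reg 12)), Set 23 (Get 15 (Reg 25)), join, Set 14 (Reg 24),
     Set 22 (Get 16 (Reg 25)), Set 23 (Get 16 (Reg 12)), join, Set 15 (Reg 24),
     Set 16 (Get 18 (Reg 12)), Set 17 (Get 20 (Reg 25)), new_node]"

lemma written_merge_step [simp]: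
  "loopfree merge_step" "written_regs merge_step = {0, 12, 14, 15, 16, 17, 20, 21, 22, 23, 24, 25}"
  "written_arrs merge_step = {0, 1, 2, 15, 16, 17, 18, 19, 20}"
  by (auto simp: merge_step_def)

lemma maxtime_merge_step: "maxtime merge_step = 217"
  by (simp add: merge_step_def maxtime_join maxtime_new_node)

lemma xor_less_power:
  assumes "x < 2 ^ k" "y < 2 ^ k"
  shows "x XOR y < (2::nat) ^ k"
  using assms unfolding drop_bit_eq_0_iff_less[symmetric] by (simp only: drop_bit_xor xor_self_eq)

lemma xor_telescope: "x XOR z = (x XOR y) XOR (y XOR (z::nat))"
  by (rule bit_eqI) (auto simp: bit_xor_iff)

context traversed
begin

text \<open>One join raises the height by one, in step with one level of the trie.\<close>

lemma low_join:
  assumes "low rs w k x" "low rs w k y" "opt_height rs' z \<le> Suc (max (opt_height rs x) (opt_height rs y))"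
    "z \<noteq> 0 \<longrightarrow> x \<noteq> 0 \<or> y \<noteq> 0"
  shows "low rs' w (Suc k) z"
proof -
  have "opt_height rs 0 = 0" by (simp add: opt_height_def)
  then show ?thesis using assms unfolding low_def by (cases "x = 0"; cases "y = 0"; auto)
qed

lemma nodes_ok_frame:
  assumes ok: "nodes_ok rs D S s"
    and same: "\<And>a. a \<in> {15..20} \<Longrightarrow> arr s' a = arr s a" "reg s' 21 = reg s 21"
    and mu: "\<And>v. v \<in> S \<Longrightarrow> mu s' v = mu s v"
    and ann: "annotated s'" and out: "outputs (rs @ rs') s'" "topological (rs @ rs')"
  shows "nodes_ok (rs @ rs') D S s'"
proof -
  have n: "same_nodes (reg s 21) s s'" using same by (simp add: same_nodes_def)
  have "node_ok (rs @ rs') D s' t \<and> nw s' t \<in> S" if "t < reg s 21" for t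
    using node_ok_mono[OF ok that n mu] nodes_okD(2)[OF ok that] same by simp
  then show ?thesis using ann out same(2) by (simp add: nodes_ok_def)
qed

lemma run_join_nodes:
  assumes ok: "nodes_ok rs D S s" and le: "reg s 22 \<le> length rs" "reg s 23 \<le> length rs"
    and bound: "3 * length rs + 2 < 2 ^ wl"
  defines "s' \<equiv> run wl join s"
  shows "\<exists>us. nodes_ok (rs @ us) D S s' \<and> length us \<le> 1 \<and> reg s' 24 \<le> length (rs @ us) \<and>
    opt_exp (rs @ us) (reg s' 24) = opt_exp rs (reg s 22) @ opt_exp rs (reg s 23) \<and>
    opt_height (rs @ us) (reg s' 24) \<le> Suc (max (opt_height rs (reg s 22)) (opt_height rs (reg s 23))) \<and>
    (reg s' 24 \<noteq> 0 \<longrightarrow> reg s 22 \<noteq> 0 \<or> reg s 23 \<noteq> 0)"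
proof -
  have out: "outputs rs s" "topological rs" "annotated s" using ok by (auto simp: nodes_ok_def)
  have b: "length rs + grammar_size \<lparr>rules = rs, start = 0\<rparr> + 2 < 2 ^ wl"
    using grammar_size_le[OF out(2), of 0] bound by simp
  note j = join_rules[OF out(2) le] and r = run_join[OF out(1) le b, folded s'_def]
  obtain us where us: "join_rules rs (reg s 22) (reg s 23) = rs @ us" using j(3) by blast
  have "annotated s'" unfolding s'_def by (rule annotated_frame[OF out(3)]) (auto simp: run_frame)
  then have "nodes_ok (rs @ us) D S s'"
    using r(1) j(1) unfolding us
    by (intro nodes_ok_frame[OF ok]) (auto simp: s'_def run_frame)
  moreover have "length us \<le> 1" using j(4) us by simp
  moreover have "reg s' 24 \<noteq> 0 \<longrightarrow> reg s 22 \<noteq> 0 \<or> reg s 23 \<noteq> 0" using r(2) by (simp add: join_var_def)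
  ultimately show ?thesis using j(2,6,7) unfolding us r(2) by (intro exI[of _ us]) simp
qed

lemma core_key:
  assumes "v < V" "0 < N v" "x < 2 ^ (class_exp v + 4)" "m = 32 * (ln v * N v)"
  shows "fl (x XOR m) = fl m" "class_exp v + 5 \<le> fl m" "fl (4 * m) = fl m + 2" "fl (4 * m) \<le> level_bound v"
proof -
  note c = class_exp_le[OF assms(1,2)]
  have pos: "0 < ln v * N v" using ln_pos[OF assms(1)] assms(2) by simp
  have "2 ^ (class_exp v + 5) \<le> m" using c(1) assms(4) by (simp add: power_add)
  then show ge: "class_exp v + 5 \<le> fl m" by (rule floor_log_ge)
  have "fl x < class_exp v + 5"
    using assms(3) floor_log_less[of x "class_exp v + 4"] by (cases "x = 0") auto
  then show "fl (x XOR m) = fl m" using ge by (intro floor_log_xor) simp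
  have "m \<noteq> 0" using pos assms(4) by simp
  then have "fl (2 * (2 * m)) = Suc (Suc (fl m))"
    using floor_log_twice[of m] floor_log_twice[of "2 * m"] by (simp del: mult_2 floor_log_twice)
  then show four: "fl (4 * m) = fl m + 2" by simp
  have "4 * m < 2 ^ (class_exp v + 9)" using c(2) assms(4) by (simp add: power_add mult.commute)
  then show "fl (4 * m) \<le> level_bound v"
    using floor_log_less[of "4 * m" "class_exp v + 9"] pos assms(4) by (simp add: level_bound_def)
qed

text \<open>If one of the two topmost nodes is the bottom, the large point of the bottom vertex
  forces the key of the top above \<open>K\<close>. Otherwise three increasing points are compared
  and \<open>floor_log_xor_distinct\<close> applies. Since the highest bits always differ, comparing
  whole keys on the machine is the same as comparing their levels.\<close>

lemma key_levels:
  assumes ok: "nodes_ok rs D S s" and t: "t < reg s 21" "nw s t = h"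
    and u: "same_class u h" "x < 2 ^ (class_exp u + 4)" "D t \<noteq> 0 \<Longrightarrow> mu s h < x"
  defines "K \<equiv> x XOR mu s h"
  shows "D t \<noteq> 0 \<and> D (nx s t) \<noteq> 0 \<or> fl K < fl (nk s t)" "fl K \<noteq> fl (nk s t)"
proof -
  note n = nodes_okD[OF ok t(1)]
  have h: "h < V" "0 < N h" using n(3,4) t(2) by auto
  have x: "x < 2 ^ (class_exp h + 4)" using u class_cong(1)[OF u(1)] by simp
  have "(D t \<noteq> 0 \<and> D (nx s t) \<noteq> 0 \<or> fl K < fl (nk s t)) \<and> fl K \<noteq> fl (nk s t)"
  proof (cases "D t = 0")
    case True
    then have "mu s h = 32 * (ln h * N h)" "nk s t = 4 * mu s h" using n(1) t(2) by (auto simp: node_ok_def)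
    then show ?thesis using core_key(1,3)[OF h x] unfolding K_def by simp
  next
    case D: False
    then have l: "link_ok rs D s h (nx s t) (nl s t) (nr s t)" "nk s t = mu s h XOR mu s (nw s (nx s t))"
      and y: "nx s t < reg s 21"
      using n(1) t by (auto simp: node_ok_def)
    have mu_h: "mu s h < 2 ^ (class_exp h + 4)" using l(1) by (simp add: link_ok_def)
    note m = nodes_okD[OF ok y]
    show ?thesis
    proof (cases "D (nx s t) = 0")
      case True
      let ?v = "nw s (nx s t)"
      have c: "class_exp h = class_exp ?v" using l(1) class_cong(1) by (simp add: link_ok_def)
      have core: "mu s ?v = 32 * (ln ?v * N ?v)" using m(1) True by (simp add: node_ok_def)
      have "class_exp h + 5 \<le> fl (nk s t)"
        using core_key(1,2)[OF m(3,4) mu_h[unfolded c] core] c l(2) by simp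
      moreover have "K < 2 ^ (class_exp h + 4)" unfolding K_def by (rule xor_less_power[OF x mu_h])
      then have "fl K < class_exp h + 4" by (cases "K = 0") (auto intro: floor_log_less)
      ultimately show ?thesis by simp
    next
      case False
      then have "mu s (nw s (nx s t)) < mu s h" using l(1) by (simp add: link_ok_def)
      then have "fl (mu s (nw s (nx s t)) XOR mu s h) \<noteq> fl (mu s h XOR x)"
        using floor_log_xor_distinct u(3)[OF D] by blast
      then show ?thesis using D False l(2) by (simp add: K_def xor.commute)
    qed
  qed
  then show "D t \<noteq> 0 \<and> D (nx s t) \<noteq> 0 \<or> fl K < fl (nk s t)" "fl K \<noteq> fl (nk s t)" by auto
qed

text \<open>The states of the loop that merges the topmost nodes of the stack of \<open>h\<close> before its
  parent \<open>u\<close> is pushed; \<open>B\<close> and \<open>B'\<close> bound the numbers of rules and of nodes.\<close>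

definition merging :: "nat \<Rightarrow> nat \<Rightarrow> nat set \<Rightarrow> state \<Rightarrow> nat rhs list \<Rightarrow> (nat \<Rightarrow> nat) \<Rightarrow> nat \<Rightarrow> nat \<Rightarrow>
    state \<Rightarrow> nat rhs list \<Rightarrow> (nat \<Rightarrow> nat) \<Rightarrow> bool" where
  "merging u h S s0 rs0 D0 B B' s rs D \<longleftrightarrow>
     nodes_ok rs D S s \<and> reg s 12 < reg s 21 \<and> nw s (reg s 12) = h \<and> reg s 13 = mu s u XOR mu s h \<and>
     low rs h (fl (reg s 13)) (nl s (reg s 12)) \<and> low rs h (fl (reg s 13)) (nr s (reg s 12)) \<and>
     (D (reg s 12) \<noteq> 0 \<longrightarrow> mu s h < mu s u) \<and>
     arr s 14 = arr s0 14 \<and> reg s0 21 \<le> reg s 21 \<and> same_nodes (reg s0 21) s0 s \<and>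
     (\<exists>us. rs = rs0 @ us) \<and> (\<forall>t < reg s0 21. D t = D0 t) \<and>
     length rs + 4 * D (reg s 12) \<le> B \<and> reg s 21 + D (reg s 12) \<le> B'"

text \<open>The two sides cost at most one rule each and the new node at most two: this is the
  factor 4 of \<open>D\<close> in \<open>merging\<close>.\<close>

lemma merge_step:
  assumes wl: "256 * (n + V) < 2 ^ wl" and B: "3 * B + 20 < 2 ^ wl" "B' + 2 < 2 ^ wl"
    and u: "same_class u h" "mu s0 u < 2 ^ (class_exp u + 4)"
    and m: "merging u h S s0 rs0 D0 B B' s rs D" and less: "nk s (reg s 12) < reg s 13"
  defines "s' \<equiv> run wl merge_step s"
  shows "\<exists>rs' D'. merging u h S s0 rs0 D0 B B' s' rs' D' \<and> Suc (D' (reg s' 12)) = D (reg s 12)"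
proof -
  define t where "t = reg s 12"
  define y where "y = nx s t"
  define z where "z = nx s y"
  define K where "K = reg s 13"
  have ok: "nodes_ok rs D S s" and t: "t < reg s 21" "nw s t = h" and K: "K = mu s u XOR mu s h"
    and mu_hu: "D t \<noteq> 0 \<Longrightarrow> mu s h < mu s u"
    and rest: "arr s 14 = arr s0 14" "reg s0 21 \<le> reg s 21" "same_nodes (reg s0 21) s0 s"
      "\<exists>us. rs = rs0 @ us" "\<forall>t < reg s0 21. D t = D0 t"
    and size: "length rs + 4 * D t \<le> B" "reg s 21 + D t \<le> B'"
    using m by (auto simp: merging_def t_def K_def)
  have "mu s u < 2 ^ (class_exp u + 4)" using u(2) rest(1) by simp
  note keys = key_levels[OF ok t u(1) this mu_hu, folded K]
  have "fl (nk s t) \<le> fl K" using less by (intro floor_log_le_iff) (simp add: t_def K_def)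
  with keys have Dt: "D t \<noteq> 0" "D y \<noteq> 0" and lt: "fl (nk s t) < fl K" by (auto simp: y_def)
  note nt = nodes_okD[OF ok t(1)]
  have yt: "y < t" and Dy: "D t = Suc (D y)" and kt: "nk s t = mu s h XOR mu s (nw s y)"
    and link_t: "link_ok rs D s h y (nl s t) (nr s t)"
    using nt(1) Dt(1) t(2) by (auto simp: node_ok_def y_def)
  have y: "y < reg s 21" using yt t by simp
  note ny = nodes_okD[OF ok y]
  have zy: "z < y" and Dz: "D y = Suc (D z)" and ky: "nk s y = mu s (nw s y) XOR mu s (nw s z)"
    and link_y: "link_ok rs D s (nw s y) z (nl s y) (nr s y)"
    using ny(1) Dt(2) by (auto simp: node_ok_def z_def)
  have z: "z < reg s 21" using zy y by simp
  note nz = nodes_okD[OF ok z]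
  note lt' = link_t[unfolded link_ok_def, folded kt] and ly' = link_y[unfolded link_ok_def, folded ky]
  have cls: "same_class h (nw s y)" "same_class h (nw s z)" using lt' ly' same_class_trans by blast+
  have lows: "low rs h (fl (nk s t)) (nl s t)" "low rs h (fl (nk s t)) (nr s t)" "low rs h (fl (nk s t)) (nl s y)"
    "low rs h (fl (nk s t)) (nr s y)" using lt' by auto
  have lows_z: "low rs h (fl (nk s y)) (nl s z)" "low rs h (fl (nk s y)) (nr s z)"
    using ly' class_cong(5)[OF cls(1)] by auto
  \<comment> \<open>Removing the middle point combines both keys by XOR; \<open>nk s y\<close> has
    the higher bit, so the merged node inherits its level.\<close>
  have key': "fl (mu s h XOR mu s (nw s z)) = fl (nk s y)"
  proof -
    have "mu s h XOR mu s (nw s z) = nk s t XOR nk s y"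
      unfolding kt ky by (rule xor_telescope)
    then show ?thesis using floor_log_xor(1) lt' by auto
  qed
  have h: "h < V" "0 < N h" using nt(3,4) t(2) by auto
  define s1 where "s1 = set_reg 23 (nl s y) (set_reg 22 (nl s t) (set_reg 25 y s))"
  define s2 where "s2 = run wl join s1"
  have ok1: "nodes_ok rs D S s1"
    using nodes_ok_frame[OF ok, of s1 "[]"] ok by (auto simp: s1_def set_reg_def nodes_ok_def annotated_def holds_input_def outputs_def)
  have r1: "reg s1 22 = nl s t" "reg s1 23 = nl s y" by (simp_all add: s1_def set_reg_def)
  have b1: "3 * length rs + 2 < 2 ^ wl" using size B by simp
  have le1: "reg s1 22 \<le> length rs" "reg s1 23 \<le> length rs" using r1 nt(7) ny(7) by auto
  obtain us where us: "nodes_ok (rs @ us) D S s2" "length us \<le> 1" "reg s2 24 \<le> length (rs @ us)"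
    "opt_exp (rs @ us) (reg s2 24) = opt_exp rs (nl s t) @ opt_exp rs (nl s y)"
    "opt_height (rs @ us) (reg s2 24) \<le> Suc (max (opt_height rs (nl s t)) (opt_height rs (nl s y)))"
    "reg s2 24 \<noteq> 0 \<longrightarrow> nl s t \<noteq> 0 \<or> nl s y \<noteq> 0"
    using run_join_nodes[OF ok1 le1 b1] unfolding r1 s2_def[symmetric] by blast
  have f2: "\<And>r. r \<notin> {0, 20, 22, 23, 24, 25} \<Longrightarrow> reg s2 r = reg s r" "reg s2 25 = y"
    "\<And>a. a \<notin> {0, 1, 2} \<Longrightarrow> arr s2 a = arr s a"
    by (simp_all add: s2_def run_frame s1_def set_reg_def)
  define l where "l = reg s2 24"
  define s3 where "s3 = set_reg 23 (nr s t) (set_reg 22 (nr s y) (set_reg 14 l s2))"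
  define s4 where "s4 = run wl join s3"
  have ok3: "nodes_ok (rs @ us) D S s3"
    using nodes_ok_frame[OF us(1), of s3 "[]"] us(1)
    by (auto simp: s3_def set_reg_def nodes_ok_def annotated_def holds_input_def outputs_def)
  have r3: "reg s3 22 = nr s y" "reg s3 23 = nr s t" by (simp_all add: s3_def set_reg_def)
  have b3: "3 * length (rs @ us) + 2 < 2 ^ wl" using size B us(2) by simp
  have le3: "reg s3 22 \<le> length (rs @ us)" "reg s3 23 \<le> length (rs @ us)" using r3 nt(8) ny(8) by auto
  obtain vs where vs: "nodes_ok ((rs @ us) @ vs) D S s4" "length vs \<le> 1" "reg s4 24 \<le> length ((rs @ us) @ vs)"
    "opt_exp ((rs @ us) @ vs) (reg s4 24) = opt_exp (rs @ us) (nr s y) @ opt_exp (rs @ us) (nr s t)"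
    "opt_height ((rs @ us) @ vs) (reg s4 24) \<le> Suc (max (opt_height (rs @ us) (nr s y)) (opt_height (rs @ us) (nr s t)))"
    "reg s4 24 \<noteq> 0 \<longrightarrow> nr s y \<noteq> 0 \<or> nr s t \<noteq> 0"
    using run_join_nodes[OF ok3 le3 b3] unfolding r3 s4_def[symmetric] by blast
  have f4: "\<And>r. r \<notin> {0, 14, 20, 22, 23, 24, 25} \<Longrightarrow> reg s4 r = reg s r" "reg s4 25 = y" "reg s4 14 = l"
    "\<And>a. a \<notin> {0, 1, 2} \<Longrightarrow> arr s4 a = arr s a"
    by (simp_all add: s4_def run_frame s3_def set_reg_def f2)
  define r where "r = reg s4 24"
  define s5 where "s5 = set_reg 17 z (set_reg 16 h (set_reg 15 r s4))"
  let ?rs = "(rs @ us) @ vs"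
  have ok5: "nodes_ok ?rs D S s5"
    using nodes_ok_frame[OF vs(1), of s5 "[]"] vs(1)
    by (auto simp: s5_def set_reg_def nodes_ok_def annotated_def holds_input_def outputs_def)
  have f5: "\<And>r. r \<notin> {0, 14, 15, 16, 17, 20, 22, 23, 24, 25} \<Longrightarrow> reg s5 r = reg s r"
    "reg s5 14 = l" "reg s5 15 = r" "reg s5 16 = h" "reg s5 17 = z"
    "\<And>a. a \<notin> {0, 1, 2} \<Longrightarrow> arr s5 a = arr s a"
    by (simp_all add: s5_def set_reg_def f4)
  have s': "s' = run wl new_node s5"
  proof -
    have "run wl (Set 23 (Get 15 (Reg 25))) (run wl (Set 22 (Get 15 (Reg 12))) (run wl (Set 25 (Get 20 (Reg 12))) s)) = s1"
      by (simp add: s1_def set_reg_def t_def y_def)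
    moreover have "run wl (Set 23 (Get 16 (Reg 12))) (run wl (Set 22 (Get 16 (Reg 25))) (run wl (Set 14 (Reg 24)) s2)) = s3"
      by (simp add: s3_def set_reg_def t_def l_def f2)
    moreover have "run wl (Set 17 (Get 20 (Reg 25))) (run wl (Set 16 (Get 18 (Reg 12))) (run wl (Set 15 (Reg 24)) s4)) = s5"
      using t(2) by (simp add: s5_def set_reg_def t_def r_def z_def f4)
    ultimately show ?thesis
      unfolding s'_def merge_step_def block.simps run.simps(1,4) by (simp only: s2_def s4_def)
  qed
  have low_l: "low ?rs h (Suc (fl (nk s t))) l"
  proof -
    have "low (rs @ us) h (Suc (fl (nk s t))) l"
      using low_join[OF lows(1,3)] us(5,6) by (simp add: l_def)
    then show ?thesis using us(3) by (simp add: low_append l_def del: append_assoc)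
  qed
  have low_r: "low ?rs h (Suc (fl (nk s t))) r"
    using low_join[OF _ _ vs(5,6)] lows(2,4) nt(8) ny(8) by (simp add: low_append r_def)
  \<comment> \<open>The joined sides rise by one level, and the strict order of the key levels
    leaves room for it.\<close>
  have rise: "Suc (fl (nk s t)) \<le> fl (nk s y)" using lt' by simp
  have ex_l: "opt_exp ?rs l = opt_exp rs (nl s t) @ opt_exp rs (nl s y)"
    using us(3,4) by (simp add: l_def opt_append del: append_assoc)
  have ex_r: "opt_exp ?rs r = opt_exp rs (nr s y) @ opt_exp rs (nr s t)"
    using vs(4) nt(8) ny(8) by (simp add: r_def opt_append del: append_assoc)
  have "link_ok ?rs D s5 h z l r"
  proof -
    have "ex h = opt_exp ?rs l @ ex (nw s z) @ opt_exp ?rs r" using lt' ly' ex_l ex_r by simp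
    moreover have "D z \<noteq> 0 \<longrightarrow> mu s (nw s z) < mu s h" using lt' ly' Dt by auto
    moreover have "low ?rs h (fl (nk s y)) l" "low ?rs h (fl (nk s y)) r"
      using low_mono[OF low_l rise] low_mono[OF low_r rise] .
    moreover have "low ?rs h (fl (nk s y)) (nl s z)" "low ?rs h (fl (nk s y)) (nr s z)"
      using lows_z nz(7,8) by (simp_all add: low_append)
    ultimately show ?thesis
      unfolding link_ok_def using f5(6) cls(2) lt' ly' key' by simp
  qed
  moreover have "l \<le> length ?rs" "r \<le> length ?rs" using us(3) vs(3) by (simp_all add: l_def r_def)
  moreover have "3 * length ?rs + 8 < 2 ^ wl" "reg s 21 + 1 < 2 ^ wl"
    using size B us(2) vs(2) Dt by auto
  ultimately obtain rs' where rs': "nodes_ok (?rs @ rs') (D(reg s 21 := Suc (D z))) (insert h S) s'" "length rs' \<le> 2"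
    "reg s' 12 = reg s 21" "reg s' 21 = Suc (reg s 21)" "same_nodes (reg s 21) s5 s'"
    "nl s' (reg s 21) = l" "nr s' (reg s 21) = r" "nw s' (reg s 21) = h"
    using new_node[OF wl ok5] f5 h z unfolding s' by (auto simp del: append_assoc)
  have hS: "h \<in> S" using nt(2) t(2) by simp
  have mu': "arr s' 14 = arr s 14" "reg s' 13 = reg s 13"
    using f5 by (simp_all add: s' run_frame)
  have same: "same_nodes (reg s0 21) s0 s'"
    using rest(2,3) rs'(5) f5(6) unfolding same_nodes_def by (simp add: Ball_def)
  have "low (?rs @ rs') h (fl K) l" "low (?rs @ rs') h (fl K) r"
    using low_mono[OF low_l, of "fl K"] low_mono[OF low_r, of "fl K"] lt us(3) vs(3)
    by (simp_all add: low_append l_def r_def del: append_assoc)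
  moreover have "\<exists>ws. ?rs @ rs' = rs0 @ ws" using rest(4) by auto
  ultimately have "merging u h S s0 rs0 D0 B B' s' (?rs @ rs') (D(reg s 21 := Suc (D z)))"
    unfolding merging_def
    using rs' mu' same rest size K hS us(2) vs(2) rs'(2) Dy Dz mu_hu[OF Dt(1)]
    by (simp add: insert_absorb K_def[symmetric])
  then show ?thesis using rs'(3) Dy Dz
    by (intro exI[of _ "?rs @ rs'"] exI[of _ "D(reg s 21 := Suc (D z))"] conjI) (simp_all add: t_def[symmetric])
qed

text \<open>Each unit of stack height is worth 222 units of time: 217 for a merge and 5 for the loop
  test.\<close>

lemma merge_loop:
  assumes wl: "256 * (n + V) < 2 ^ wl" and B: "3 * B + 20 < 2 ^ wl" "B' + 2 < 2 ^ wl"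
    and u: "same_class u h" "mu s0 u < 2 ^ (class_exp u + 4)"
    and m: "merging u h S s0 rs0 D0 B B' s0 rs0 D0"
  shows "\<exists>T s rs D. exec wl (While (Bin Less (Get 19 (Reg 12)) (Reg 13)) merge_step) s0 T s \<and>
    merging u h S s0 rs0 D0 B B' s rs D \<and> fl (reg s 13) < fl (nk s (reg s 12)) \<and>
    T + 222 * D (reg s 12) \<le> 222 * D0 (reg s0 12) + 5"
proof -
  let ?e = "Bin Less (Get 19 (Reg 12)) (Reg 13)"
  let ?I = "\<lambda>s k. \<exists>rs D. merging u h S s0 rs0 D0 B B' s rs D \<and> k = 222 * D (reg s 12)"
  have w: "0 < wl" using wl_pos[OF wl] by simp
  have "\<exists>T s' k'. exec wl (While ?e merge_step) s0 T s' \<and> ?I s' k' \<and> val wl s' ?e = 0 \<and>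
      T + k' \<le> 222 * D0 (reg s0 12) + cost ?e + 1"
  proof (rule exec_While[where I = ?I])
    fix s k assume "?I s k" and less: "val wl s ?e \<noteq> 0"
    then obtain rs D where m: "merging u h S s0 rs0 D0 B B' s rs D" "k = 222 * D (reg s 12)" by blast
    have "nk s (reg s 12) < reg s 13" using less unfolding val_Less_eq_0[OF w] by simp
    from merge_step[OF wl B u m(1) this] obtain rs' D' where
      m': "merging u h S s0 rs0 D0 B B' (run wl merge_step s) rs' D'"
      "Suc (D' (reg (run wl merge_step s) 12)) = D (reg s 12)" by blast
    obtain T where T: "T \<le> 217" "exec wl merge_step s T (run wl merge_step s)"
      using exec_loopfree[of merge_step wl s] by (auto simp: maxtime_merge_step)
    have "222 * D' (reg (run wl merge_step s) 12) + T + cost ?e + 1 \<le> k"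
      unfolding m(2) m'(2)[symmetric] using T(1) by simp
    then show "\<exists>T s' k'. exec wl merge_step s T s' \<and> ?I s' k' \<and> k' + T + cost ?e + 1 \<le> k"
      using T(2) m'(1) by blast
  qed (use m in blast)
  then obtain T s rs D where s: "exec wl (While ?e merge_step) s0 T s" "merging u h S s0 rs0 D0 B B' s rs D"
    "val wl s ?e = 0" "T + 222 * D (reg s 12) \<le> 222 * D0 (reg s0 12) + 5" by auto
  let ?t = "reg s 12"
  have ok: "nodes_ok rs D S s" "?t < reg s 21" "nw s ?t = h" "D ?t \<noteq> 0 \<Longrightarrow> mu s h < mu s u"
    "mu s u < 2 ^ (class_exp u + 4)" "reg s 13 = mu s u XOR mu s h"
    using s(2) u(2) by (auto simp: merging_def)
  have "reg s 13 \<le> nk s ?t" using s(3) unfolding val_Less_eq_0[OF w] by simp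
  then have "fl (reg s 13) \<le> fl (nk s ?t)" by (rule floor_log_le_iff)
  moreover have "fl (reg s 13) \<noteq> fl (nk s ?t)"
    using key_levels(2)[OF ok(1-3) u(1) ok(5,4)] ok(6) by simp
  ultimately show ?thesis using s by (intro exI[of _ T] exI[of _ s]) auto
qed

text \<open>Let \<open>a\<close> and \<open>c\<close> be the powers of two of the class. Going up a
  path, \<open>ln\<close> grows within \<open>a\<close> to \<open>2 * a\<close>, while
  \<open>M\<close> falls from at most \<open>2 * c\<close>. The two parts of the weights are bounded
  by \<open>2 * c\<close> times the growth of \<open>ln\<close> and \<open>2 * a\<close> times the
  fall of \<open>M\<close>, so their sum telescopes. The outer factor 2 reflects that a step fills
  twice its weight.\<close>

definition pos_bound :: "nat \<Rightarrow> nat" where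
  "pos_bound v = 2 * (2 ^ Suc (fl (ln v)) * (2 ^ Suc (fl (N v)) - M v) + 2 ^ Suc (fl (N v)) * (ln v - 2 ^ fl (ln v)))"

lemma pos_bound_less:
  assumes "v < V" "0 < N v"
  shows "pos_bound v < 2 ^ (class_exp v + 4)"
proof -
  define a where "a = (2::nat) ^ fl (ln v)"
  define c where "c = (2::nat) ^ fl (N v)"
  have pos: "0 < a" "0 < c" by (simp_all add: a_def c_def)
  have "ln v < 2 * a" using floor_log_bounds(2)[OF ln_pos[OF assms(1)]] by (simp add: a_def)
  define X where "X = 2 * a * (2 * c - M v)"
  define Y where "Y = 2 * c * (ln v - a)"
  define Z where "Z = a * c"
  have "Y \<le> 2 * c * a" unfolding Y_def using \<open>ln v < 2 * a\<close> by (intro mult_le_mono2) simp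
  then have "Y \<le> 2 * Z" by (simp add: Z_def ac_simps)
  moreover have "X \<le> 2 * a * (2 * c)" unfolding X_def by (intro mult_le_mono2) simp
  then have "X \<le> 4 * Z" by (simp add: Z_def ac_simps)
  moreover have "0 < Z" using pos by (simp add: Z_def)
  moreover have "pos_bound v = 2 * (X + Y)"
    by (simp add: pos_bound_def X_def Y_def a_def c_def)
  moreover have "2 ^ (class_exp v + 4) = 16 * Z" by (simp add: class_exp_def power_add a_def c_def Z_def)
  ultimately show ?thesis by simp
qed

text \<open>Because \<open>N u \<le> M (heavy_child u)\<close>, the entries at \<open>u\<close> are
  covered by the fall of \<open>M\<close>; the light child is covered by the growth of
  \<open>ln\<close>.\<close>

lemma pos_bound_step:
  assumes "heavy u \<noteq> 0"
  shows "pos_bound (heavy_child u) + 2 * (entries u * ln u + ln (light_child u) * N u) \<le> pos_bound u"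
proof -
  note h = heavyD[OF assms]
  let ?h = "heavy_child u" and ?x = "light_child u"
  define a where "a = (2::nat) ^ fl (ln u)"
  define c where "c = (2::nat) ^ fl (N u)"
  have eq: "2 ^ fl (ln ?h) = a" "2 ^ fl (N ?h) = c" using h(7) by (simp_all add: same_class_def a_def c_def)
  have u: "ln u < 2 * a" "a \<le> ln u" "N u < 2 * c"
    using floor_log_bounds[OF ln_pos[OF h(1)]] floor_log_bounds[OF h(3)] by (simp_all add: a_def c_def)
  have hh: "a \<le> ln ?h" using floor_log_bounds(1)[OF ln_pos[OF h(4)]] eq by simp
  have Nh: "0 < N ?h" using edge_N_le[OF h(9)] h(3,10) by simp
  have "N ?h < 2 * c" using floor_log_bounds(2)[OF Nh] eq by simp
  then have Mh: "M ?h \<le> 2 * c" using M_le[OF h(4)] by simp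
  have M: "N u \<le> M ?h" "M u \<le> N u" using N_le_M[OF assms] M_le[OF h(1)] by auto
  define X where "X = 2 * a * (2 * c - M u)"
  define X' where "X' = 2 * a * (2 * c - M ?h)"
  define Y where "Y = 2 * c * (ln u - a)"
  define Y' where "Y' = 2 * c * (ln ?h - a)"
  have "entries u * ln u \<le> (M ?h - M u) * (2 * a)" using M u by (intro mult_le_mono) (auto simp: entries_def)
  moreover have "ln ?x * N u \<le> 2 * c * ln ?x" using u by simp
  moreover have "X = X' + (M ?h - M u) * (2 * a)"
  proof -
    have "2 * c - M u = (2 * c - M ?h) + (M ?h - M u)" using Mh M by simp
    then show ?thesis by (simp add: X_def X'_def algebra_simps)
  qed
  moreover have "Y = Y' + 2 * c * ln ?x"
  proof -
    have "ln u - a = (ln ?h - a) + ln ?x" using h(6) hh by simp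
    then show ?thesis by (simp add: Y_def Y'_def algebra_simps)
  qed
  moreover have "pos_bound u = 2 * (X + Y)" "pos_bound ?h = 2 * (X' + Y')"
    by (simp_all add: pos_bound_def eq a_def c_def X_def X'_def Y_def Y'_def)
  moreover have "E1 \<le> P \<Longrightarrow> E2 \<le> Q \<Longrightarrow> X = X' + P \<Longrightarrow> Y = Y' + Q \<Longrightarrow> b = 2 * (X + Y) \<Longrightarrow>
      b' = 2 * (X' + Y') \<Longrightarrow> b' + 2 * (E1 + E2) \<le> b" for E1 E2 P Q b b' :: nat by simp
  ultimately show ?thesis by blast
qed

text \<open>For a step, \<open>pos s v - mu s v\<close> is its weight: the point is the midpoint of
  an interval that ends at \<open>pos s v\<close>. The next point lies beyond that end, so the sides
  are low at the level of any key that the parent can produce. The condition on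
  \<open>entries\<close> records that the node of \<open>v\<close> is high enough in the trie for
  the light edges that enter at \<open>v\<close>.\<close>

definition vert_ok :: "nat rhs list \<Rightarrow> (nat \<Rightarrow> nat) \<Rightarrow> state \<Rightarrow> nat \<Rightarrow> bool" where
  "vert_ok rs D s v \<longleftrightarrow> tp s v < reg s 21 \<and> nw s (tp s v) = v \<and> (D (tp s v) = 0 \<longleftrightarrow> heavy v = 0) \<and>
     (0 < entries v \<longrightarrow> fl (entries v) + fl (ln v) \<le> fl (nk s (tp s v))) \<and> pos s v \<le> pos_bound v \<and>
     (heavy v \<noteq> 0 \<longrightarrow> mu s v < pos s v \<and>
        low rs v (fl (pos s v - mu s v)) (nl s (tp s v)) \<and> low rs v (fl (pos s v - mu s v)) (nr s (tp s v)))"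

lemma vertex_height:
  assumes ok: "nodes_ok rs D S s" and v: "vert_ok rs D s v" "0 < entries v"
  shows "int (opt_height rs (ne s (tp s v))) \<le> vertex_bound v"
proof -
  have t: "tp s v < reg s 21" "nw s (tp s v) = v" "fl (entries v) + fl (ln v) \<le> fl (nk s (tp s v))"
    using v by (auto simp: vert_ok_def)
  have "int (opt_height rs (ne s (tp s v))) \<le> node_bound v + 2 * (int (level_bound v) - int (fl (nk s (tp s v))))"
    using nodes_okD(1)[OF ok t(1)] t(2) by (simp add: node_ok_def)
  then show ?thesis using t(3)
    by (simp add: node_bound_def vertex_bound_def level_bound_def class_exp_def)
qed

lemma vert_ok_mono:
  assumes ok: "nodes_ok rs D S s" and v: "vert_ok rs D s v"
    and same: "same_nodes (reg s 21) s s'" "reg s 21 \<le> reg s' 21" "\<And>t. t < reg s 21 \<Longrightarrow> D' t = D t"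
    and eq: "tp s' v = tp s v" "mu s' v = mu s v" "pos s' v = pos s v"
  shows "vert_ok (rs @ rs') D' s' v"
proof -
  have t: "tp s v < reg s 21" using v by (simp add: vert_ok_def)
  note n = nodes_okD(7,8)[OF ok t]
  show ?thesis
    using v t same(2,3) unfolding vert_ok_def eq same_nodesD[OF same(1) t] low_append[OF n(1)] low_append[OF n(2)]
    by auto
qed

end

section \<open>Bottom vertices and pushes\<close>

definition emit_core :: com where
  "emit_core =
     If (Bin Eq (Get 3 (Reg 8)) (Const 0)) (block [Set 22 (Get 4 (Reg 8)), emit_term])
       (If (Bin Eq (Get 3 (Reg 8)) (Const 2))
          (block [Set 22 (Bin Sub (Get 17 (Get 12 (Get 4 (Reg 8)))) (Const 1)), Set 23 (Get 5 (Reg 8)), emit 2])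
          (block [Set 22 (Bin Sub (Get 17 (Get 12 (Get 4 (Reg 8)))) (Const 1)),
             Set 23 (Bin Sub (Get 17 (Get 12 (Get 5 (Reg 8)))) (Const 1)), emit 1]))"

definition core_node :: com where
  "core_node = block [
     Put 13 (Reg 8) (Const 0), Put 14 (Reg 8) (Bin Mul (Const 32) (Bin Mul (Get 9 (Reg 8)) (Get 8 (Reg 8)))),
     Put 15 (Reg 21) (Const 0), Put 16 (Reg 21) (Const 0), Put 17 (Reg 21) (Reg 0), Put 18 (Reg 21) (Reg 8),
     Put 19 (Reg 21) (Bin Mul (Const 4) (Get 14 (Reg 8))), Put 12 (Reg 8) (Reg 21),
     Set 21 (Bin Add (Reg 21) (Const 1))]"

lemma written_core [simp]:
  "loopfree emit_core" "written_regs emit_core = {0, 20, 22, 23}" "written_arrs emit_core = {0, 1, 2}"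
  "loopfree core_node" "written_regs core_node = {21}" "written_arrs core_node = {12, 13, 14, 15, 16, 17, 18, 19}"
  by (auto simp: emit_core_def core_node_def)

definition link_start :: com where
  "link_start = block [
     If (Bin Eq (Get 10 (Reg 8)) (Const 1))
       (block [Set 9 (Get 4 (Reg 8)), Set 10 (Get 5 (Reg 8))])
       (block [Set 9 (Get 5 (Reg 8)), Set 10 (Get 4 (Reg 8))]),
     Set 11 (Bin Add (Bin Mul (Bin Sub (Get 8 (Reg 8)) (Get 11 (Reg 8))) (Get 9 (Reg 8)))
       (Bin Mul (Get 9 (Reg 10)) (Get 8 (Reg 8)))),
     Put 14 (Reg 8) (Bin Add (Get 13 (Reg 9)) (Reg 11)), Put 13 (Reg 8) (Bin Add (Get 14 (Reg 8)) (Reg 11)),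
     Set 12 (Get 12 (Reg 9)), Set 13 (Bin Xor (Get 14 (Reg 8)) (Get 14 (Reg 9)))]"

definition link_finish :: com where
  "link_finish = block [
     If (Bin Eq (Get 10 (Reg 8)) (Const 1))
       (block [Set 14 (Const 0), Set 15 (Get 17 (Get 12 (Reg 10)))])
       (block [Set 14 (Get 17 (Get 12 (Reg 10))), Set 15 (Const 0)]),
     Set 16 (Reg 8), Set 17 (Reg 12), new_node, Put 12 (Reg 8) (Reg 12)]"

definition link_vertex :: com where
  "link_vertex = Seq link_start
     (Seq (While (Bin Less (Get 19 (Reg 12)) (Reg 13)) merge_step) link_finish)"

lemma written_link [simp]:
  "loopfree link_start" "written_regs link_start = {9, 10, 11, 12, 13}" "written_arrs link_start = {13, 14}"
  "loopfree link_finish" "written_regs link_finish = {0, 12, 14, 15, 16, 17, 20, 21, 22, 23, 24}"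
  "written_arrs link_finish = {0, 1, 2, 12, 15, 16, 17, 18, 19, 20}"
  by (auto simp: link_start_def link_finish_def)

lemma maxtime_link: "maxtime link_start + maxtime link_finish + 5 \<le> 300"
  by (simp add: link_start_def link_finish_def maxtime_new_node)

context traversed
begin

definition processed :: "nat \<Rightarrow> nat set" where
  "processed i = {v \<in> q ` {i..<V}. 0 < N v}"

definition tips :: "nat \<Rightarrow> nat set" where
  "tips i = {v \<in> processed i. \<forall>u \<in> processed i. heavy u \<noteq> 0 \<longrightarrow> heavy_child u \<noteq> v}"

text \<open>By \<open>heavy_unique\<close> a stack is extended by one parent only. Stacks of
  vertices inside a path survive as shared nodes but are never merged again, so only those at the
  current upper ends of paths have to pay.\<close>

definition potential :: "(nat \<Rightarrow> nat) \<Rightarrow> state \<Rightarrow> nat \<Rightarrow> nat" where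
  "potential D s i = (\<Sum>v\<in>tips i. D (tp s v))"

text \<open>A push emits at most one rule and deposits four more for the later merge of its node;
  the node count is amortized in the same way. The last clause makes the most recent vertex own the
  last rule, so that in the end the start variable does.\<close>

definition built :: "nat rhs list \<Rightarrow> (nat \<Rightarrow> nat) \<Rightarrow> nat \<Rightarrow> state \<Rightarrow> bool" where
  "built rs D i s \<longleftrightarrow> nodes_ok rs D (processed i) s \<and> (\<forall>v \<in> processed i. vert_ok rs D s v) \<and>
     length rs + 4 * potential D s i \<le> 6 * (V - i) \<and> reg s 21 + potential D s i \<le> 3 * (V - i) \<and>
     (i < V \<longrightarrow> 0 < N (q i) \<longrightarrow> ne s (tp s (q i)) = length rs)"

lemma processed_Suc:
  assumes "i < V"
  shows "processed i = (if 0 < N (q i) then insert (q i) (processed (Suc i)) else processed (Suc i))"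
proof -
  have "{i..<V} = insert i {Suc i..<V}" using assms by auto
  then show ?thesis by (auto simp: processed_def)
qed

lemma not_processed: "i < V \<Longrightarrow> q i \<notin> processed (Suc i)"
  using inj_q by (auto simp: processed_def dest: inj_onD)

lemma processed_less: "v \<in> processed i \<Longrightarrow> v < V"
  using q_less by (auto simp: processed_def)

lemma finite_processed: "finite (processed i)"
  by (rule finite_subset[of _ "{..<V}"]) (auto dest: processed_less)

lemma child_processed:
  "i < V \<Longrightarrow> e \<in> edges \<Longrightarrow> fst e = q i \<Longrightarrow> 0 < N (q i) \<Longrightarrow> target e \<in> processed (Suc i)"
  using child_later[of i e] edge_N_le[of e] by (simp add: processed_def)

lemma heavy_child_not_first:
  assumes "i < V" "u \<in> processed i" "heavy u \<noteq> 0"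
  shows "heavy_child u \<noteq> q i"
proof
  assume eq: "heavy_child u = q i"
  obtain j where j: "i \<le> j" "j < V" "u = q j" using assms(2) by (auto simp: processed_def)
  have "heavy_child u \<in> q ` {Suc j..<V}"
    using child_later[OF j(2) heavyD(9)[OF assms(3)]] heavyD(10)[OF assms(3)] j(3) by simp
  then obtain k where "Suc j \<le> k" "k < V" "q i = q k" using eq by auto
  then show False using inj_q assms(1) j by (auto dest: inj_onD)
qed

lemma tips_core:
  assumes "i < V" "0 < N (q i)" "heavy (q i) = 0"
  shows "tips i = insert (q i) (tips (Suc i))" "q i \<notin> tips (Suc i)"
  using assms heavy_child_not_first[OF assms(1)] not_processed[OF assms(1)]
  by (auto simp: tips_def processed_Suc)

lemma tips_heavy:
  assumes i: "i < V" and h: "heavy (q i) \<noteq> 0"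
  shows "tips i = insert (q i) (tips (Suc i) - {heavy_child (q i)})" "q i \<notin> tips (Suc i)"
    "heavy_child (q i) \<in> tips (Suc i)"
proof -
  note d = heavyD[OF h]
  have p: "processed i = insert (q i) (processed (Suc i))" using processed_Suc[OF i] d(3) by simp
  show "q i \<notin> tips (Suc i)" using not_processed[OF i] by (simp add: tips_def)
  have c: "heavy_child (q i) \<in> processed (Suc i)" using child_processed[OF i d(9)] d(3,10) by simp
  have "heavy_child u \<noteq> heavy_child (q i)" if "u \<in> processed (Suc i)" "heavy u \<noteq> 0" for u
    using heavy_unique[OF that(2) h] that(1) not_processed[OF i] by auto
  then show "heavy_child (q i) \<in> tips (Suc i)" using c by (auto simp: tips_def)
  show "tips i = insert (q i) (tips (Suc i) - {heavy_child (q i)})"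
    using heavy_child_not_first[OF i] h not_processed[OF i] unfolding tips_def p by auto
qed

lemma entries_light:
  assumes "e \<in> edges" "heavy (fst e) = 0 \<or> snd e \<noteq> heavy (fst e) - 1"
  shows "N (fst e) \<le> entries (target e)" "fl (N (fst e)) \<le> fl (entries (target e))"
    "fl (entries (target e)) \<le> fl (N (target e))"
proof -
  show 1: "N (fst e) \<le> entries (target e)" using light_edge_N[OF assms] by (simp add: entries_def)
  then show "fl (N (fst e)) \<le> fl (entries (target e))" by (rule floor_log_le_iff)
  show "fl (entries (target e)) \<le> fl (N (target e))" by (rule floor_log_le_iff) (simp add: entries_def)
qed

lemma light_bound:
  assumes h: "heavy u \<noteq> 0" and "int k \<le> vertex_bound (light_child u)"
  shows "int k \<le> side_bound u + int (fl (ln (light_child u)) + fl (N u)) - 1" "N u \<le> entries (light_child u)"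
proof -
  note d = heavyD[OF h]
  have e: "heavy (fst (u, 2 - heavy u)) = 0 \<or> snd (u, 2 - heavy u) \<noteq> heavy (fst (u, 2 - heavy u)) - 1"
    using d(13) by simp
  note l = entries_light[OF d(11) e]
  show "N u \<le> entries (light_child u)" using l(1) d(12) by simp
  show "int k \<le> side_bound u + int (fl (ln (light_child u)) + fl (N u)) - 1"
    using l(2,3) d(12) light_class[OF h] assms(2) unfolding vertex_bound_def side_bound_def by simp
qed

lemma core_bound:
  assumes h: "heavy u = 0" "0 < N u" and e: "e \<in> edges" "fst e = u" and k: "int k \<le> vertex_bound (target e)"
  shows "int k + 1 \<le> node_bound u" "0 < entries (target e)"
proof -
  note l = entries_light[OF e(1)] and c = core_class[OF h e]
  show "0 < entries (target e)" using l(1) h e(2) by simp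
  show "int k + 1 \<le> node_bound u"
    using l(2,3) h(1) e(2) c k unfolding vertex_bound_def node_bound_def by auto
qed

lemma emit_core:
  assumes wl: "256 * (n + V) < 2 ^ wl" and b: "built rs D (Suc i) s" and i: "i < V"
    and u: "u = q i" "reg s 8 = u" "0 < N u" "heavy u = 0"
  shows "\<exists>R. outputs (rs @ [R]) (run wl emit_core s) \<and> topological (rs @ [R]) \<and> expand (exps rs) R = ex u \<and>
    int (rhs_height (heights rs) R) \<le> node_bound u"
proof -
  have ok: "nodes_ok rs D (processed (Suc i)) s" and vert: "\<And>v. v \<in> processed (Suc i) \<Longrightarrow> vert_ok rs D s v"
    and len: "length rs \<le> 6 * V" using b by (auto simp: built_def)
  have out: "outputs rs s" "topological rs" "annotated s" using ok by (auto simp: nodes_ok_def)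
  have uV: "u < V" using q_less[OF i] u by simp
  have arrs: "arr s 3 = kd" "arr s 4 = lc" "arr s 5 = rc" using out(3) by (auto simp: annotated_def holds_input_def)
  have w: "0 < wl" "1 < wl" "2 mod 2 ^ wl = (2::nat)"
    using wl_pos[OF wl] small_mod[OF wl, of 2] n_pos by auto
  have bound: "length rs + grammar_size \<lparr>rules = rs, start = 0\<rparr> + 2 < 2 ^ wl"
    using grammar_size_le[OF out(2), of 0] len wl n_pos by simp
  define E where "E v = ne s (tp s v)" for v
  have child: "E (target e) \<noteq> 0" "E (target e) \<le> length rs" "opt_exp rs (E (target e)) = ex (target e)"
    "int (opt_height rs (E (target e))) + 1 \<le> node_bound u"
    if e: "e \<in> edges" "fst e = u" for e
  proof -
    have v: "vert_ok rs D s (target e)" using vert child_processed[OF i e(1)] e(2) u by simp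
    then have t: "tp s (target e) < reg s 21" "nw s (tp s (target e)) = target e" by (auto simp: vert_ok_def)
    note nd = nodes_okD[OF ok t(1)]
    show "E (target e) \<noteq> 0" "E (target e) \<le> length rs" using nd by (auto simp: E_def)
    show "opt_exp rs (E (target e)) = ex (target e)" using nd(1) t(2) by (simp add: E_def node_ok_def)
    \<comment> \<open>All edges of a bottom vertex are light, so each occurrence of \<open>u\<close>
      is an entry at the child and \<open>vertex_height\<close> applies.\<close>
    have "0 < entries (target e)" using entries_light(1)[OF e(1)] u e(2) by simp
    then show "int (opt_height rs (E (target e))) + 1 \<le> node_bound u"
      using core_bound(1)[OF u(4,3) e] vertex_height[OF ok v] by (simp add: E_def)
  qed
  consider "kd u = 0" | "kd u = 1" | "kd u = 2" using kd_cases[OF uV] by metis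
  then show ?thesis
  proof cases
    case 1
    define s1 where "s1 = set_reg 22 (lc u) s"
    have "run wl emit_core s = run wl emit_term s1"
      using 1 arrs u(2) w by (simp add: emit_core_def s1_def)
    moreover have "outputs rs s1" using out(1) by (simp add: s1_def set_reg_def outputs_def)
    then have "outputs (rs @ [Term (lc u)]) (run wl emit_term s1)"
      by (rule outputs_emit_term) (use bound in \<open>auto simp: s1_def set_reg_def\<close>)
    moreover have "ex u = [lc u]" using rule[OF uV] 1 by simp
    moreover have "1 \<le> node_bound u" using fl_N_le[OF uV] by (simp add: node_bound_def)
    ultimately show ?thesis using out(2) by (intro exI[of _ "Term (lc u)"]) simp
  next
    case 2
    have e: "(u, 0) \<in> edges" "(u, 1) \<in> edges" using 2 uV by (auto simp: edges_def)
    note c1 = child[OF e(1), simplified target_def, simplified] and c2 = child[OF e(2), simplified target_def, simplified]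
    define s1 where "s1 = set_reg 23 (E (rc u) - 1) (set_reg 22 (E (lc u) - 1) s)"
    let ?R = "Vars [E (lc u) - 1, E (rc u) - 1]"
    have small: "(E v - 1) mod 2 ^ wl = E v - 1" if "E v \<le> length rs" for v
      using small_mod[OF wl, of "E v - 1"] that len by simp
    have "run wl emit_core s = run wl (emit 1) s1"
      using 2 arrs u(2) w small[OF c1(2)] small[OF c2(2)] by (simp add: emit_core_def s1_def set_reg_def E_def)
    moreover have "outputs rs s1" using out(1) by (simp add: s1_def set_reg_def outputs_def)
    then have "outputs (rs @ [?R]) (run wl (emit 1) s1)"
      by (rule outputs_emit) (use bound in \<open>auto simp: s1_def set_reg_def\<close>)
    moreover have "expand (exps rs) ?R = ex u" using c1 c2 rule[OF uV] 2 by (simp add: opt_exp_def)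
    moreover have "int (rhs_height (heights rs) ?R) \<le> node_bound u" using c1 c2 by (simp add: opt_height_def)
    moreover have "E (lc u) - 1 < length rs" "E (rc u) - 1 < length rs" using c1(1,2) c2(1,2) by auto
    ultimately show ?thesis using out(2) by (intro exI[of _ ?R]) simp
  next
    case 3
    have e: "(u, 0) \<in> edges" using 3 uV by (auto simp: edges_def)
    note c1 = child[OF e(1), simplified target_def, simplified]
    define s1 where "s1 = set_reg 23 (rc u) (set_reg 22 (E (lc u) - 1) s)"
    let ?R = "Power (E (lc u) - 1) (rc u)"
    have small: "(E (lc u) - 1) mod 2 ^ wl = E (lc u) - 1"
      using small_mod[OF wl, of "E (lc u) - 1"] c1(2) len by simp
    have "run wl emit_core s = run wl (emit 2) s1"
      using 3 arrs u(2) w small by (simp add: emit_core_def s1_def set_reg_def E_def)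
    moreover have "outputs rs s1" using out(1) by (simp add: s1_def set_reg_def outputs_def)
    then have "outputs (rs @ [?R]) (run wl (emit 2) s1)"
      by (rule outputs_emit) (use bound in \<open>auto simp: s1_def set_reg_def\<close>)
    moreover have "expand (exps rs) ?R = ex u" "2 < rc u" using c1 rule[OF uV] 3 by (simp_all add: opt_exp_def)
    moreover have "int (rhs_height (heights rs) ?R) \<le> node_bound u" using c1 by (simp add: opt_height_def)
    moreover have "E (lc u) - 1 < length rs" using c1(1,2) by auto
    ultimately show ?thesis using out(2) by (intro exI[of _ ?R]) simp
  qed
qed

lemma core_step:
  assumes wl: "256 * (n + V) < 2 ^ wl" and b: "built rs D (Suc i) s" and i: "i < V"
    and u: "u = q i" "reg s 8 = u" "0 < N u" "heavy u = 0"
  defines "s' \<equiv> run wl (Seq emit_core core_node) s"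
  shows "\<exists>rs' D'. built rs' D' i s' \<and> potential D' s' i = potential D s (Suc i)"
proof -
  let ?S = "processed (Suc i)"
  define s1 where "s1 = run wl emit_core s"
  obtain R where R: "outputs (rs @ [R]) s1" "topological (rs @ [R])" "expand (exps rs) R = ex u"
    "int (rhs_height (heights rs) R) \<le> node_bound u"
    using emit_core[OF wl b i u] unfolding s1_def by blast
  have ok: "nodes_ok rs D ?S s" and vert: "\<And>v. v \<in> ?S \<Longrightarrow> vert_ok rs D s v"
    and size: "length rs + 4 * potential D s (Suc i) \<le> 6 * (V - Suc i)" "reg s 21 + potential D s (Suc i) \<le> 3 * (V - Suc i)"
    using b by (auto simp: built_def)
  have ann: "annotated s" using ok by (simp add: nodes_ok_def)
  have uV: "u < V" and u_new: "u \<notin> ?S" using q_less[OF i] not_processed[OF i] u by auto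
  have Vi: "V - i = Suc (V - Suc i)" using i by simp
  define t where "t = reg s 21"
  define m where "m = 32 * (ln u * N u)"
  have f1: "\<And>r. r \<notin> {0, 20, 22, 23} \<Longrightarrow> reg s1 r = reg s r" "\<And>a. a \<notin> {0, 1, 2} \<Longrightarrow> arr s1 a = arr s a"
    by (simp_all add: s1_def run_frame)
  have r0: "reg s1 0 = Suc (length rs)" using R(1) by (simp add: outputs_def)
  have w: "0 < wl" "1 < wl" "4 mod 2 ^ wl = (4::nat)" "32 mod 2 ^ wl = (32::nat)"
    using wl_pos[OF wl] small_mod[OF wl, of 4] small_mod[OF wl, of 32] n_pos by auto
  have lnN: "ln u * N u \<le> n" using N_ln[OF uV] by (simp add: mult.commute)
  have small: "(ln u * N u) mod 2 ^ wl = ln u * N u" "m mod 2 ^ wl = m" "(4 * m) mod 2 ^ wl = 4 * m"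
    "Suc t mod 2 ^ wl = Suc t"
    using small_mod[OF wl] lnN size(2) i by (simp_all add: m_def t_def)
  have in_s: "arr s 9 u = ln u" "arr s 8 u = N u" using ann u uV by (auto simp: annotated_def)
  have s': "s' = run wl core_node s1" by (simp add: s'_def s1_def)
  have fields: "arr s' 13 = (arr s 13)(u := 0)" "arr s' 14 = (arr s 14)(u := m)" "arr s' 15 = (arr s 15)(t := 0)"
    "arr s' 16 = (arr s 16)(t := 0)" "arr s' 17 = (arr s 17)(t := Suc (length rs))" "arr s' 18 = (arr s 18)(t := u)"
    "arr s' 19 = (arr s 19)(t := 4 * m)" "arr s' 12 = (arr s 12)(u := t)" "arr s' 20 = arr s 20"
    "reg s' 21 = Suc t"
    using f1 r0 w small u(2) in_s
    unfolding s' core_node_def by (simp_all add: set_arr_def set_reg_def m_def[symmetric] t_def[symmetric])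
  have keep: "\<And>r. r \<noteq> 21 \<Longrightarrow> reg s' r = reg s1 r" "\<And>a. a < 12 \<Longrightarrow> arr s' a = arr s1 a"
    unfolding s' by (simp_all add: run_frame)
  have ann': "annotated s'" by (rule annotated_frame[OF ann]) (auto simp: keep f1)
  have out': "outputs (rs @ [R]) s'" using R(1) keep by (simp add: outputs_def)
  have "\<forall>a \<in> {15..20}. \<exists>v. arr s' a = (arr s a)(t := v)"
  proof
    fix a :: nat assume "a \<in> {15..20}"
    then consider "a = 15" | "a = 16" | "a = 17" | "a = 18" | "a = 19" | "a = 20" by fastforce
    then show "\<exists>v. arr s' a = (arr s a)(t := v)" using fields fun_upd_triv[of "arr s 20" t] by cases metis+
  qed
  then have same: "same_nodes t s s'" unfolding same_nodes_def by (metis fun_upd_other less_irrefl)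
  let ?D = "D(t := 0)"
  have key: "fl (4 * m) = fl m + 2" "class_exp u + 5 \<le> fl m" "fl (4 * m) \<le> level_bound u"
    using core_key[OF uV u(3), of 0 m] by (simp_all add: m_def)
  have new: "node_ok (rs @ [R]) ?D s' t"
    using fields uV u R(3,4) key by (simp add: node_ok_def m_def)
  have "node_ok (rs @ [R]) ?D s' t' \<and> nw s' t' \<in> insert u ?S" if "t' < Suc t" for t'
  proof (cases "t' = t")
    case False
    then have t': "t' < reg s 21" using that by (simp add: t_def)
    have "node_ok (rs @ [R]) ?D s' t'"
      by (rule node_ok_mono[OF ok t' same[unfolded t_def]]) (use fields u_new in \<open>auto simp: t_def\<close>)
    then show ?thesis using nodes_okD(2)[OF ok t'] same_nodesD[OF same[unfolded t_def] t'] by simp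
  qed (use new fields in simp)
  moreover have P: "processed i = insert u ?S" using processed_Suc[OF i] u by simp
  ultimately have ok': "nodes_ok (rs @ [R]) ?D (processed i) s'"
    using ann' out' R(2) fields by (simp add: nodes_ok_def)
  have "vert_ok (rs @ [R]) ?D s' v" if "v \<in> processed i" for v
  proof (cases "v = u")
    case True
    have "fl (entries u) \<le> fl (N u)" by (rule floor_log_le_iff) (simp add: entries_def)
    then show ?thesis using True fields key u by (simp add: vert_ok_def class_exp_def)
  next
    case False
    then have v: "v \<in> ?S" using that P by simp
    then show ?thesis
      by (rule vert_ok_mono[OF ok vert same[unfolded t_def]]) (use False fields in \<open>auto simp: t_def\<close>)
  qed
  moreover have pot: "potential ?D s' i = potential D s (Suc i)"
  proof -
    have "(\<Sum>v\<in>tips (Suc i). ?D (tp s' v)) = (\<Sum>v\<in>tips (Suc i). D (tp s v))"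
    proof (rule sum.cong)
      fix v assume "v \<in> tips (Suc i)"
      then have "v \<in> ?S" by (simp add: tips_def)
      then have "tp s v < t" "v \<noteq> u" using vert[of v] u_new by (auto simp: vert_ok_def t_def)
      then show "?D (tp s' v) = D (tp s v)" using fields by simp
    qed simp
    moreover have "finite (tips (Suc i))" using finite_processed by (simp add: tips_def)
    ultimately show ?thesis
      using tips_core[OF i] u fields by (simp add: potential_def)
  qed
  ultimately have "built (rs @ [R]) ?D i s'"
    using ok' size i u fields Vi unfolding built_def pot by (simp add: t_def)
  then show ?thesis using pot by blast
qed

text \<open>The constant 522 consists of 222 for the height of the pushed node and 300 for the code
  around the merge loop.\<close>

lemma link_vertex:
  assumes wl: "256 * (n + V) < 2 ^ wl" and b: "built rs D (Suc i) s" and i: "i < V"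
    and u: "u = q i" "reg s 8 = u" "heavy u \<noteq> 0"
  shows "\<exists>T s' rs' D'. exec wl link_vertex s T s' \<and> built rs' D' i s' \<and>
    T + 222 * potential D' s' i \<le> 222 * potential D s (Suc i) + 522"
proof -
  let ?S = "processed (Suc i)"
  define h where "h = heavy_child u"
  define x where "x = light_child u"
  note d = heavyD[OF u(3), folded h_def x_def]
  have ok: "nodes_ok rs D ?S s" and vert: "\<And>v. v \<in> ?S \<Longrightarrow> vert_ok rs D s v"
    and size: "length rs + 4 * potential D s (Suc i) \<le> 6 * (V - Suc i)" "reg s 21 + potential D s (Suc i) \<le> 3 * (V - Suc i)"
    using b by (auto simp: built_def)
  have Vi: "V - i = Suc (V - Suc i)" using i by simp
  have ann: "annotated s" using ok by (simp add: nodes_ok_def)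
  have u_new: "u \<notin> ?S" using not_processed[OF i] u by auto
  have Nq: "0 < N (q i)" using d(3) u(1) by simp
  have hS: "h \<in> ?S" using child_processed[OF i d(9) _ Nq] d(10) u(1) by simp
  have xS: "x \<in> ?S" using child_processed[OF i d(11) _ Nq] d(12) u(1) by simp
  have neq: "h \<noteq> u" "x \<noteq> u" using hS xS u_new by auto
  have Nh: "0 < N h" using edge_N_le[OF d(9)] d(3,10) by simp
  have Nx: "0 < N x" using edge_N_le[OF d(11)] d(3,12) by simp
  have arrs: "arr s 3 = kd" "arr s 4 = lc" "arr s 5 = rc" "arr s 8 = N" using ann by (auto simp: annotated_def holds_input_def)
  have ann_v: "arr s 9 v = ln v" "arr s 10 v = heavy v" "arr s 11 v = M v" if "v < V" "0 < N v" for v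
    using ann that by (auto simp: annotated_def)
  define om where "om = entries u * ln u + ln x * N u"
  define m where "m = pos s h + om"
  define p where "p = m + om"
  define t0 where "t0 = tp s h"
  define K where "K = m XOR mu s h"
  have vh: "t0 < reg s 21" "nw s t0 = h" "D t0 = 0 \<longleftrightarrow> heavy h = 0" "pos s h \<le> pos_bound h"
    "heavy h \<noteq> 0 \<Longrightarrow> mu s h < pos s h \<and> low rs h (fl (pos s h - mu s h)) (nl s t0) \<and>
      low rs h (fl (pos s h - mu s h)) (nr s t0)"
    using vert[OF hS] by (auto simp: vert_ok_def t0_def)
  note nh = nodes_okD[OF ok vh(1)]
  have p_le: "p \<le> pos_bound u" using pos_bound_step[OF u(3)] vh(4) by (simp add: p_def m_def om_def h_def x_def)
  have om_pos: "0 < om" using ln_pos[OF d(5)] d(3) by (simp add: om_def)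
  have p_less: "p < 2 ^ (class_exp u + 4)" using p_le pos_bound_less[OF d(1,3)] by simp
  then have m_less: "m < 2 ^ (class_exp u + 4)" by (simp add: p_def)
  have cu: "2 ^ class_exp u \<le> n" using class_exp_le(3)[OF d(1,3)] .
  have p_small: "p \<le> 16 * n" using p_less cu by (simp add: power_add)
  have mu_h: "mu s h \<le> 32 * n" using mu_le[OF ok vh(1)] vh(2) by simp
  have K_small: "K \<le> 48 * n" using xor_le_add[of m "mu s h"] p_small mu_h by (simp add: K_def p_def)
  have w: "0 < wl" "1 < wl" using wl_pos[OF wl] by auto
  define s1 where "s1 = run wl link_start s"
  have f1: "\<And>r. r \<notin> {9, 10, 11, 12, 13} \<Longrightarrow> reg s1 r = reg s r" "\<And>a. a \<notin> {13, 14} \<Longrightarrow> arr s1 a = arr s a"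
    by (simp_all add: s1_def run_frame)
  have lnN: "ln u * N u \<le> n" using N_ln[OF d(1)] by (simp add: mult.commute)
  have e_le: "entries u * ln u \<le> n" "ln x * N u \<le> n"
  proof -
    have "entries u * ln u \<le> N u * ln u" by (intro mult_le_mono1) (simp add: entries_def)
    then show "entries u * ln u \<le> n" using N_ln[OF d(1)] by (rule le_trans)
    have "ln x * N u \<le> ln u * N u" using d(6) by (intro mult_le_mono1) simp
    then show "ln x * N u \<le> n" using lnN by (rule le_trans)
  qed
  have small: "entries u mod 2 ^ wl = entries u" "(entries u * ln u) mod 2 ^ wl = entries u * ln u"
    "(ln x * N u) mod 2 ^ wl = ln x * N u" "om mod 2 ^ wl = om" "m mod 2 ^ wl = m" "p mod 2 ^ wl = p" "K mod 2 ^ wl = K"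
    using small_mod[OF wl] e_le p_small K_small N_le[OF d(1)] by (simp_all add: entries_def p_def om_def)
  have s1: "reg s1 10 = x" "reg s1 12 = t0" "reg s1 13 = K" "arr s1 14 = (arr s 14)(u := m)" "arr s1 13 = (arr s 13)(u := p)"
  proof -
    let ?s = "set_reg 10 x (set_reg 9 h s)"
    have "run wl (If (Bin Eq (Get 10 (Reg 8)) (Const 1))
        (block [Set 9 (Get 4 (Reg 8)), Set 10 (Get 5 (Reg 8))])
        (block [Set 9 (Get 5 (Reg 8)), Set 10 (Get 4 (Reg 8))])) s = ?s"
      using ann_v[OF d(1,3)] u(2) arrs w by (simp add: set_reg_def h_def x_def heavy_child_def light_child_def)
    moreover have "run wl (Set 11 (Bin Add (Bin Mul (Bin Sub (Get 8 (Reg 8)) (Get 11 (Reg 8))) (Get 9 (Reg 8)))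
       (Bin Mul (Get 9 (Reg 10)) (Get 8 (Reg 8))))) ?s = set_reg 11 om ?s"
      using ann_v[OF d(1,3)] ann_v[OF d(5) Nx] u(2) arrs small(1-4)
      by (simp add: set_reg_def om_def[symmetric] entries_def[symmetric])
    ultimately have "s1 = run wl (block [
       Put 14 (Reg 8) (Bin Add (Get 13 (Reg 9)) (Reg 11)), Put 13 (Reg 8) (Bin Add (Get 14 (Reg 8)) (Reg 11)),
       Set 12 (Get 12 (Reg 9)), Set 13 (Bin Xor (Get 14 (Reg 8)) (Get 14 (Reg 9)))]) (set_reg 11 om ?s)"
      unfolding s1_def link_start_def block.simps(2) run.simps(4) by (simp only:)
    also have "\<dots> = set_reg 13 K (set_reg 12 t0 (set_arr 13 u p (set_arr 14 u m (set_reg 11 om ?s))))"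
      using u(2) neq small(5-7)
      by (simp add: set_reg_def set_arr_def m_def[symmetric] p_def[symmetric] t0_def[symmetric] K_def[symmetric])
    finally show "reg s1 10 = x" "reg s1 12 = t0" "reg s1 13 = K" "arr s1 14 = (arr s 14)(u := m)" "arr s1 13 = (arr s 13)(u := p)"
      by (simp_all add: set_reg_def set_arr_def)
  qed
  have mu1: "mu s1 v = mu s v" if "v \<in> ?S" for v using that s1 u_new by (cases "v = u") simp_all
  have ok1: "nodes_ok rs D ?S s1"
  proof -
    have "annotated s1" by (rule annotated_frame[OF ann]) (auto simp: f1)
    moreover have "outputs (rs @ []) s1" "topological (rs @ [])" using ok f1 by (auto simp: nodes_ok_def outputs_def)
    ultimately have "nodes_ok (rs @ []) D ?S s1"
      using u_new mu1 f1 by (intro nodes_ok_frame[OF ok]) auto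
    then show ?thesis by simp
  qed
  have cls: "same_class u h" "same_class h u" using d(7) same_class_sym by auto
  \<comment> \<open>If \<open>h\<close> is a step, the two points are apart by the sum of both
    weights, and \<open>diff_le_xor\<close> passes this on to the key. If \<open>h\<close> is a
    bottom vertex, its point alone determines the level of the key and exceeds both weights.\<close>
  have K_ge: "fl (pos s h - mu s h) \<le> fl K" "fl om \<le> fl K" "heavy h \<noteq> 0 \<Longrightarrow> mu s h < m"
  proof -
    have "fl (pos s h - mu s h) \<le> fl K \<and> fl om \<le> fl K \<and> (heavy h \<noteq> 0 \<longrightarrow> mu s h < m)"
    proof (cases "heavy h = 0")
      case True
      then have "mu s h = 32 * (ln h * N h)" using nh(1) vh by (simp add: node_ok_def)
      then have c: "fl K = fl (mu s h)" "class_exp h + 5 \<le> fl (mu s h)"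
        using core_key(1,2)[OF d(4) Nh _, of m] m_less class_cong(1)[OF cls(1)] by (auto simp: K_def)
      have "om < 2 ^ (class_exp h + 4)" using m_less class_cong(1)[OF cls(1)] by (simp add: m_def)
      then have "fl om < class_exp h + 4" using om_pos by (intro floor_log_less)
      moreover have "pos s h - mu s h < 2 ^ (class_exp h + 4)"
        using m_less class_cong(1)[OF cls(1)] by (simp add: m_def)
      then have "fl (pos s h - mu s h) < class_exp h + 4" by (cases "pos s h - mu s h = 0") (auto intro: floor_log_less)
      ultimately show ?thesis using True c by simp
    next
      case False
      then have "mu s h < pos s h" using vh(5) by simp
      then have le: "pos s h - mu s h \<le> K" "om \<le> K" "mu s h < m"
        using diff_le_xor[of m "mu s h"] by (simp_all add: K_def m_def xor.commute)
      show ?thesis using floor_log_le_iff[OF le(1)] floor_log_le_iff[OF le(2)] le(3) by simp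
    qed
    then show "fl (pos s h - mu s h) \<le> fl K" "fl om \<le> fl K" "heavy h \<noteq> 0 \<Longrightarrow> mu s h < m" by auto
  qed
  have low0: "low rs h (fl K) (nl s t0)" "low rs h (fl K) (nr s t0)"
  proof -
    have "low rs h (fl K) (nl s t0) \<and> low rs h (fl K) (nr s t0)"
    proof (cases "heavy h = 0")
      case True
      then have "nl s t0 = 0" "nr s t0 = 0" using nh(1) vh(3) by (auto simp: node_ok_def)
      then show ?thesis by (simp add: low_def)
    qed (use vh(5) low_mono K_ge(1) in blast)
    then show "low rs h (fl K) (nl s t0)" "low rs h (fl K) (nr s t0)" by auto
  qed
  define B where "B = length rs + 4 * D t0"
  define B' where "B' = reg s 21 + D t0"
  have m1: "merging u h ?S s1 rs D B B' s1 rs D"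
    unfolding merging_def using ok1 s1 f1 vh(1-3) low0 K_ge(3) neq
    by (auto simp: same_nodes_def B_def B'_def K_def)
  have fin: "finite (tips (Suc i))" using finite_processed by (simp add: tips_def)
  note tips = tips_heavy[OF i, folded u(1), folded h_def, OF u(3)]
  have D0_le: "D t0 \<le> potential D s (Suc i)"
    unfolding potential_def t0_def using tips(3) fin by (intro member_le_sum) auto
  have B_small: "B \<le> 6 * (V - Suc i)" "B' \<le> 3 * (V - Suc i)" using size D0_le by (auto simp: B_def B'_def)
  have "3 * B + 20 < 2 ^ wl" "B' + 2 < 2 ^ wl" using B_small wl n_pos i by auto
  moreover have "mu s1 u < 2 ^ (class_exp u + 4)" using s1 m_less by simp
  ultimately obtain T2 s2 rs2 D2 where loop: "exec wl (While (Bin Less (Get 19 (Reg 12)) (Reg 13)) merge_step) s1 T2 s2"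
    "merging u h ?S s1 rs D B B' s2 rs2 D2" "fl (reg s2 13) < fl (nk s2 (reg s2 12))"
    "T2 + 222 * D2 (reg s2 12) \<le> 222 * D t0 + 5"
    using merge_loop[OF wl _ _ cls(1) _ m1] s1(2) by auto
  define t2 where "t2 = reg s2 12"
  obtain us where rs2: "rs2 = rs @ us" using loop(2) by (auto simp: merging_def)
  have f1_21: "reg s1 21 = reg s 21" by (simp add: f1)
  have l2: "nodes_ok rs2 D2 ?S s2" "t2 < reg s2 21" "nw s2 t2 = h" "reg s2 13 = mu s2 u XOR mu s2 h"
    "low rs2 h (fl (reg s2 13)) (nl s2 t2)" "low rs2 h (fl (reg s2 13)) (nr s2 t2)"
    "D2 t2 \<noteq> 0 \<longrightarrow> mu s2 h < mu s2 u" "arr s2 14 = arr s1 14" "reg s 21 \<le> reg s2 21"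
    "same_nodes (reg s 21) s1 s2" "\<And>t. t < reg s 21 \<Longrightarrow> D2 t = D t"
    "length rs2 + 4 * D2 t2 \<le> B" "reg s2 21 + D2 t2 \<le> B'"
    using loop(2) f1_21 by (auto simp: merging_def t2_def)
  have frame: "\<And>r. r \<notin> {0, 12, 14, 15, 16, 17, 20, 21, 22, 23, 24, 25} \<Longrightarrow> reg s2 r = reg s1 r"
    "\<And>a. a \<notin> {0, 1, 2, 15, 16, 17, 18, 19, 20} \<Longrightarrow> arr s2 a = arr s1 a"
    using exec_frame[OF loop(1)] by simp_all
  have same2: "same_nodes (reg s 21) s s2" using l2(10) f1 by (simp add: same_nodes_def)
  have mu2: "mu s2 u = m" "mu s2 h = mu s h" "reg s2 13 = K" using l2(4,8) s1(4) neq by (simp_all add: K_def)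
  define y where "y = ne s2 (tp s2 x)"
  define l where "l = (if heavy u = 1 then 0 else y)"
  define r where "r = (if heavy u = 1 then y else 0)"
  have vx: "vert_ok rs D s x" using vert[OF xS] .
  then have tx: "tp s x < reg s 21" "nw s (tp s x) = x" by (auto simp: vert_ok_def)
  have tp2: "arr s2 12 = arr s 12" using frame f1 by simp
  have y: "y = ne s (tp s x)" using same_nodesD(3)[OF same2 tx(1)] tp2 by (simp add: y_def)
  note nx = nodes_okD[OF ok tx(1)]
  have y': "y \<noteq> 0" "y \<le> length rs" "opt_exp rs y = ex x" using nx tx by (auto simp: y node_ok_def)
  \<comment> \<open>The summand \<open>ln x * N u\<close> of the weight provides exactly the level
    that \<open>light_bound\<close> asks for.\<close>
  have "int (opt_height rs y) \<le> side_bound u + int (fl om) - 1"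
  proof -
    have lb: "int k \<le> vertex_bound x \<Longrightarrow> int k \<le> side_bound u + int (fl (ln x) + fl (N u)) - 1" "N u \<le> entries x"
      if "int k \<le> vertex_bound x" for k
      using light_bound[OF u(3), of k] that by (simp_all add: x_def)
    have "0 < entries x"
      using entries_light(1)[OF d(11)] d(3,12,13) by simp
    then have hx: "int (opt_height rs y) \<le> vertex_bound x" using vertex_height[OF ok vx] y by simp
    have "2 ^ (fl (ln x) + fl (N u)) \<le> ln x * N u"
      unfolding power_add using floor_log_bounds(1)[OF ln_pos[OF d(5)]] floor_log_bounds(1)[OF d(3)] by (rule mult_le_mono)
    also have "\<dots> \<le> om" by (simp add: om_def)
    finally have "fl (ln x) + fl (N u) \<le> fl om" by (rule floor_log_ge)
    then show ?thesis using lb(1)[OF hx hx] by simp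
  qed
  then have low_y: "low rs u (fl om) y" by (simp add: low_def)
  have y2: "y \<le> length rs2" "opt_exp rs2 y = ex x" "low rs2 u (fl om) y"
    using y' low_y rs2 by (simp_all add: opt_append low_append)
  define s3 where "s3 = set_reg 17 t2 (set_reg 16 u (set_reg 15 r (set_reg 14 l s2)))"
  have in2: "reg s2 8 = u" "reg s2 10 = x" "arr s2 10 u = heavy u"
    using frame f1 s1 u(2) ann_v[OF d(1,3)] by simp_all
  have step: "run wl link_finish s2 = set_arr 12 u (reg (run wl new_node s3) 12) (run wl new_node s3)"
  proof -
    have "run wl (Set 17 (Reg 12)) (run wl (Set 16 (Reg 8)) (run wl (If (Bin Eq (Get 10 (Reg 8)) (Const 1))
       (block [Set 14 (Const 0), Set 15 (Get 17 (Get 12 (Reg 10)))])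
       (block [Set 14 (Get 17 (Get 12 (Reg 10))), Set 15 (Const 0)])) s2)) = s3"
      using in2 w by (simp add: s3_def set_reg_def l_def r_def y_def t2_def)
    moreover have "reg (run wl new_node s3) 8 = u" using in2 by (simp add: run_frame s3_def set_reg_def)
    ultimately show ?thesis unfolding link_finish_def block.simps run.simps(1,4) by simp
  qed
  have f3: "reg s3 14 = l" "reg s3 15 = r" "reg s3 16 = u" "reg s3 17 = t2" "reg s3 21 = reg s2 21" "arr s3 = arr s2"
    by (simp_all add: s3_def set_reg_def)
  have ok3: "nodes_ok rs2 D2 ?S s3"
    using nodes_ok_frame[OF l2(1), of s3 "[]"] l2(1)
    by (auto simp: s3_def set_reg_def nodes_ok_def annotated_def holds_input_def outputs_def)
  have link: "link_ok rs2 D2 s3 u t2 l r"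
  proof -
    have "ex u = opt_exp rs2 l @ ex h @ opt_exp rs2 r"
      using d(8) y2 by (auto simp: l_def r_def opt_exp_def)
    moreover have "low rs2 u (fl K) y" using low_mono[OF y2(3) K_ge(2)] .
    then have "low rs2 u (fl K) l" "low rs2 u (fl K) r" by (auto simp: l_def r_def low_def)
    moreover have "low rs2 u (fl K) (nl s2 t2)" "low rs2 u (fl K) (nr s2 t2)"
      using l2(5,6) class_cong(5)[OF cls(1)] mu2 by simp_all
    ultimately show ?thesis
      unfolding link_ok_def f3(6) l2(3) using cls(1) l2(7) mu2 m_less loop(3)
      by (simp add: K_def[symmetric] t2_def)
  qed
  have len2: "3 * length rs2 + 8 < 2 ^ wl" "reg s3 21 + 1 < 2 ^ wl"
    using l2(12,13) B_small wl n_pos i f3(5) by auto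
  have lr: "l \<le> length rs2" "r \<le> length rs2" "l \<noteq> 0 \<or> r \<noteq> 0" "l = 0 \<or> r = 0" using y2(1) y'(1) by (auto simp: l_def r_def)
  define s4 where "s4 = run wl new_node s3"
  define t where "t = reg s2 21"
  let ?D = "D2(t := Suc (D2 t2))"
  obtain rs' where n4: "nodes_ok (rs2 @ rs') ?D (insert u ?S) s4" "length rs' \<le> 1" "ne s4 t = length (rs2 @ rs')"
    "reg s4 12 = t" "reg s4 21 = Suc t" "same_nodes t s3 s4" "nl s4 t = l" "nr s4 t = r" "nw s4 t = u" "nk s4 t = K"
    using new_node[OF wl ok3 len2, unfolded f3, OF d(1,3) l2(2) lr(1,2) link] lr(3,4) mu2 l2(3)
    unfolding s4_def[symmetric] t_def[symmetric] K_def[symmetric] by (auto simp: K_def)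
  define s' where "s' = set_arr 12 u t s4"
  have f': "reg s' = reg s4" "\<And>a. a \<noteq> 12 \<Longrightarrow> arr s' a = arr s4 a" "arr s' 12 = (arr s 12)(u := t)"
    "arr s' 13 = (arr s 13)(u := p)" "arr s' 14 = (arr s 14)(u := m)"
    using tp2 frame(2)[of 13] l2(8) s1(4,5)
    by (auto simp: s'_def set_arr_def s4_def run_frame f3(6))
  have P: "processed i = insert u ?S" using processed_Suc[OF i] u(1) d(3) by simp
  have ok': "nodes_ok (rs2 @ rs') ?D (processed i) s'"
  proof -
    have "annotated s'" using n4(1) f'(1,2) by (auto simp: nodes_ok_def annotated_def holds_input_def)
    moreover have "outputs ((rs2 @ rs') @ []) s'" "topological ((rs2 @ rs') @ [])"
      using n4(1) f'(1,2) by (auto simp: nodes_ok_def outputs_def)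
    ultimately have "nodes_ok ((rs2 @ rs') @ []) ?D (insert u ?S) s'"
      using f' by (intro nodes_ok_frame[OF n4(1)]) auto
    then show ?thesis by (simp add: P)
  qed
  have le_t: "reg s 21 \<le> t" using l2(9) by (simp add: t_def)
  have same': "same_nodes (reg s 21) s s'"
    using same2 n4(6) f'(2) f3(6) le_t by (simp add: same_nodes_def)
  have D': "?D t' = D t'" if "t' < reg s 21" for t' using that l2(11) le_t by simp
  have vert': "vert_ok (rs2 @ rs') ?D s' v" if "v \<in> processed i" for v
  proof (cases "v = u")
    case True
    \<comment> \<open>The summand \<open>entries u * ln u\<close> of the weight provides the level
      for the light edges that enter at \<open>u\<close>.\<close>
    have "fl (entries u) + fl (ln u) \<le> fl K" if e: "0 < entries u"
    proof -
      have "2 ^ (fl (entries u) + fl (ln u)) \<le> entries u * ln u"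
        unfolding power_add using floor_log_bounds(1)[OF e] floor_log_bounds(1)[OF ln_pos[OF d(1)]] by (rule mult_le_mono)
      also have "\<dots> \<le> om" by (simp add: om_def)
      finally have "fl (entries u) + fl (ln u) \<le> fl om" by (rule floor_log_ge)
      then show ?thesis using K_ge(2) by simp
    qed
    moreover have "low (rs2 @ rs') u (fl om) y" using y2(1,3) by (simp add: low_append)
    then have "low (rs2 @ rs') u (fl om) l" "low (rs2 @ rs') u (fl om) r"
      by (auto simp: l_def r_def low_def)
    ultimately show ?thesis
      using True f' n4 u(3) p_le om_pos by (simp add: vert_ok_def p_def)
  next
    case False
    then have v: "v \<in> ?S" using that P by simp
    have "vert_ok (rs @ (us @ rs')) ?D s' v"
      by (rule vert_ok_mono[OF ok vert[OF v] same' _ D']) (use False f' n4(5) le_t in auto)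
    then show ?thesis by (simp add: rs2)
  qed
  \<comment> \<open>The vertex \<open>u\<close> takes the place of \<open>h\<close> among the upper
    ends of paths, and one node was pushed after the merges.\<close>
  have pot: "potential ?D s' i + D t0 = potential D s (Suc i) + Suc (D2 t2)"
  proof -
    have fin': "finite (tips (Suc i) - {h})" using fin by simp
    have "(\<Sum>v\<in>tips (Suc i) - {h}. ?D (tp s' v)) = (\<Sum>v\<in>tips (Suc i) - {h}. D (tp s v))"
    proof (rule sum.cong)
      fix v assume "v \<in> tips (Suc i) - {h}"
      then have v: "v \<in> ?S" by (simp add: tips_def)
      then have "tp s v < reg s 21" "v \<noteq> u" using vert[OF v] u_new by (auto simp: vert_ok_def)
      then show "?D (tp s' v) = D (tp s v)" using f'(3) D' by simp
    qed simp
    moreover have "potential D s (Suc i) = D t0 + (\<Sum>v\<in>tips (Suc i) - {h}. D (tp s v))"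
      unfolding potential_def t0_def using fin tips(3) by (rule sum.remove)
    moreover have "potential ?D s' i = ?D (tp s' u) + (\<Sum>v\<in>tips (Suc i) - {h}. ?D (tp s' v))"
      unfolding potential_def tips(1) using fin' tips(2) by (subst sum.insert) auto
    ultimately show ?thesis using f'(3) by simp
  qed
  have "length (rs2 @ rs') + 4 * potential ?D s' i \<le> 6 * (V - i)"
    using pot l2(12) n4(2) size(1) Vi unfolding B_def by simp
  moreover have "reg s' 21 + potential ?D s' i \<le> 3 * (V - i)"
    using pot l2(13) n4(5) size(2) Vi f'(1) unfolding B'_def t_def by simp
  moreover have "ne s' (tp s' (q i)) = length (rs2 @ rs')" using f' n4(3) u(1) by simp
  ultimately have built: "built (rs2 @ rs') ?D i s'"
    using ok' vert' unfolding built_def by blast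
  obtain T1 where T1: "T1 \<le> maxtime link_start" "exec wl link_start s T1 s1"
    using exec_loopfree[of link_start wl s] by (auto simp: s1_def)
  obtain T3 where T3: "T3 \<le> maxtime link_finish" "exec wl link_finish s2 T3 s'"
    using exec_loopfree[of link_finish wl s2] n4(4) by (auto simp: step s'_def s4_def)
  have "exec wl link_vertex s (T1 + (T2 + T3)) s'"
    unfolding link_vertex_def using T1(2) loop(1) T3(2) by (intro exec.intros(4))
  moreover have "T1 + (T2 + T3) + 222 * potential ?D s' i \<le> 222 * potential D s (Suc i) + 522"
    using T1(1) T3(1) maxtime_link loop(4) pot unfolding t2_def by linarith
  ultimately show ?thesis using built by blast
qed

end

section \<open>The complete sweep\<close>

definition build_step :: com where
  "build_step = Seq (block [Set 2 (Bin Sub (Reg 2) (Const 1)), Set 8 (Get 7 (Reg 2))])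
     (If (Get 8 (Reg 8)) (If (Get 10 (Reg 8)) link_vertex (Seq emit_core core_node)) Skip)"

definition build :: com where
  "build = Seq (block [Put 1 (Const 0) (Const 0), Set 0 (Const 0), Set 20 (Const 0), Set 21 (Const 0), Set 2 (Reg 4)])
     (Seq (While (Reg 2) build_step) (Set 1 (Bin Sub (Get 17 (Get 12 (Reg 5))) (Const 1))))"

lemma maxtime_core: "maxtime (Seq emit_core core_node) \<le> 200"
  by (simp add: emit_core_def core_node_def maxtime_emit)

context traversed
begin

lemma built_set_reg:
  assumes "built rs D i s" "r \<notin> {0, 4, 5, 20, 21}"
  shows "built rs D i (set_reg r v s)" "potential D (set_reg r v s) i = potential D s i"
proof -
  have eq: "arr (set_reg r v s) = arr s" "\<And>k. k \<in> {0, 4, 5, 20, 21} \<Longrightarrow> reg (set_reg r v s) k = reg s k"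
    using assms(2) by (auto simp: set_reg_def)
  show "potential D (set_reg r v s) i = potential D s i" by (simp add: potential_def eq)
  then show "built rs D i (set_reg r v s)"
    using assms(1) unfolding built_def nodes_ok_def annotated_def holds_input_def outputs_def node_ok_def
      link_ok_def vert_ok_def eq(1) by (simp add: eq(2))
qed

lemma built_skip:
  assumes b: "built rs D (Suc i) s" and i: "i < V" "N (q i) = 0"
  shows "built rs D i s" "potential D s i = potential D s (Suc i)"
proof -
  have P: "processed i = processed (Suc i)" using processed_Suc[OF i(1)] i(2) by simp
  then show pot: "potential D s i = potential D s (Suc i)" by (simp add: potential_def tips_def)
  have "V - i = Suc (V - Suc i)" using i by simp
  then show "built rs D i s" using b i(2) unfolding built_def pot P by simp
qed

lemma build_step:
  assumes wl: "256 * (n + V) < 2 ^ wl" and b: "built rs D (reg s 2) s" and i: "0 < reg s 2" "reg s 2 \<le> V"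
  shows "\<exists>T s' rs' D'. exec wl build_step s T s' \<and> built rs' D' (reg s' 2) s' \<and> reg s' 2 = reg s 2 - 1 \<and>
    T + 222 * potential D' s' (reg s' 2) \<le> 222 * potential D s (reg s 2) + 540"
proof -
  let ?A = "block [Set 2 (Bin Sub (Reg 2) (Const 1)), Set 8 (Get 7 (Reg 2))]"
  define i' where "i' = reg s 2 - 1"
  have r2: "reg s 2 = Suc i'" "i' < V" using i by (auto simp: i'_def)
  define u where "u = q i'"
  have uV: "u < V" using q_less[OF r2(2)] by (simp add: u_def)
  have w: "0 < wl" "1 < wl" using wl_pos[OF wl] by auto
  have ann: "annotated s" using b by (simp add: built_def nodes_ok_def)
  then have arrs: "arr s 7 = q" "arr s 8 = N" "0 < N u \<Longrightarrow> arr s 10 u = heavy u"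
    using uV by (auto simp: annotated_def)
  define s1 where "s1 = set_reg 8 u (set_reg 2 i' s)"
  have A: "run wl ?A s = s1"
    using arrs r2 w small_mod[OF wl, of i'] by (simp add: s1_def set_reg_def u_def)
  have "loopfree ?A" "maxtime ?A \<le> 9" by simp_all
  then obtain T1 where T1: "T1 \<le> 9" "exec wl ?A s T1 s1" using exec_loopfree[of ?A wl s] A le_trans by metis
  have "potential D s1 (Suc i') = potential D s (Suc i')" by (simp add: s1_def potential_def set_reg_def)
  moreover have "built rs D (Suc i') s1"
    unfolding s1_def by (intro built_set_reg) (use b r2(1) in auto)
  ultimately have b1: "built rs D (Suc i') s1" "potential D s1 (Suc i') = potential D s (Suc i')" by auto
  have s1: "reg s1 8 = u" "reg s1 2 = i'" "arr s1 = arr s" by (simp_all add: s1_def set_reg_def)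
  let ?C = "If (Get 10 (Reg 8)) link_vertex (Seq emit_core core_node)"
  have "\<exists>T s' rs' D'. exec wl (If (Get 8 (Reg 8)) ?C Skip) s1 T s' \<and> built rs' D' i' s' \<and> reg s' 2 = i' \<and>
    T + 222 * potential D' s' i' \<le> 222 * potential D s1 (Suc i') + 530"
  proof (cases "N u = 0")
    case True
    have "exec wl (If (Get 8 (Reg 8)) ?C Skip) s1 (cost (Get 8 (Reg 8)) + 1 + 1) s1"
      by (rule exec.intros(6)) (use True s1 arrs in \<open>auto intro: exec.intros(1)[simplified]\<close>)
    then show ?thesis using built_skip[OF b1(1) r2(2)] True s1(2) unfolding u_def by fastforce
  next
    case False
    have "\<exists>T s' rs' D'. exec wl ?C s1 T s' \<and> built rs' D' i' s' \<and>
      T + 222 * potential D' s' i' \<le> 222 * potential D s1 (Suc i') + 525"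
    proof (cases "heavy u = 0")
      case True
      let ?P = "Seq emit_core core_node"
      obtain rs' D' where c: "built rs' D' i' (run wl ?P s1)"
        "potential D' (run wl ?P s1) i' = potential D s1 (Suc i')"
        using core_step[OF wl b1(1) r2(2) u_def s1(1)] False True by blast
      have "loopfree ?P" by simp
      then obtain T where T: "T \<le> 200" "exec wl ?P s1 T (run wl ?P s1)"
        using exec_loopfree maxtime_core le_trans by blast
      have "exec wl ?C s1 (cost (Get 10 (Reg 8)) + 1 + T) (run wl ?P s1)"
        by (rule exec.intros(6)) (use True False s1 arrs T(2) in auto)
      then show ?thesis using c T(1) by fastforce
    next
      case heavy: False
      obtain T s' rs' D' where c: "exec wl link_vertex s1 T s'" "built rs' D' i' s'"
        "T + 222 * potential D' s' i' \<le> 222 * potential D s1 (Suc i') + 522"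
        using link_vertex[OF wl b1(1) r2(2) u_def s1(1) heavy] by blast
      have "exec wl ?C s1 (cost (Get 10 (Reg 8)) + 1 + T) s'"
        by (rule exec.intros(5)) (use heavy False s1 arrs c(1) in auto)
      then show ?thesis using c by fastforce
    qed
    then obtain T s' rs' D' where c: "exec wl ?C s1 T s'" "built rs' D' i' s'"
      "T + 222 * potential D' s' i' \<le> 222 * potential D s1 (Suc i') + 525" by blast
    have "exec wl (If (Get 8 (Reg 8)) ?C Skip) s1 (cost (Get 8 (Reg 8)) + 1 + T) s'"
      by (rule exec.intros(5)) (use False s1 arrs c(1) in auto)
    moreover have "reg s' 2 = reg s1 2" using exec_frame[OF c(1)] by (simp add: link_vertex_def)
    ultimately show ?thesis using c s1(2) by fastforce
  qed
  then obtain T s' rs' D' where c: "exec wl (If (Get 8 (Reg 8)) ?C Skip) s1 T s'" "built rs' D' i' s'" "reg s' 2 = i'"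
    "T + 222 * potential D' s' i' \<le> 222 * potential D s1 (Suc i') + 530" by blast
  have "exec wl build_step s (T1 + T) s'"
    unfolding build_step_def using T1(2) c(1) by (rule exec.intros(4))
  moreover have "T1 + T + 222 * potential D' s' (reg s' 2) \<le> 222 * potential D s (reg s 2) + 540"
    using c(3,4) T1(1) b1(2) r2(1) by simp
  ultimately show ?thesis using c(2,3) i'_def by blast
qed

lemma build:
  assumes wl: "256 * (n + V) < 2 ^ wl" and ann: "annotated s"
  shows "\<exists>T s' G'. exec wl build s T s' \<and> T \<le> 600 * V + 50 \<and> holds_grammar s' G' \<and> is_rlslp G' \<and>
    generates G' (ex st) \<and> grammar_size G' \<le> 12 * V \<and> depth G' \<le> 58 * fl n + 29 \<and>
    (\<forall>R \<in> set (rules G'). normal_rhs R)"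
proof -
  let ?A = "block [Put 1 (Const 0) (Const 0), Set 0 (Const 0), Set 20 (Const 0), Set 21 (Const 0), Set 2 (Reg 4)]"
  define s1 where "s1 = run wl ?A s"
  have "loopfree ?A" "maxtime ?A \<le> 16" by simp_all
  then obtain T1 where T1: "T1 \<le> 16" "exec wl ?A s T1 s1" using exec_loopfree le_trans unfolding s1_def by blast
  have r1: "reg s1 2 = V" "reg s1 0 = 0" "reg s1 20 = 0" "reg s1 21 = 0" "arr s1 1 0 = 0"
    using ann by (simp_all add: s1_def set_reg_def set_arr_def annotated_def holds_input_def)
  have ann1: "annotated s1" by (rule annotated_frame[OF ann]) (auto simp: s1_def set_reg_def set_arr_def)
  have "processed V = {}" by (simp add: processed_def)
  then have b1: "built [] (\<lambda>_. 0) V s1" "potential (\<lambda>_. 0) s1 V = 0"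
    using ann1 r1 by (auto simp: built_def nodes_ok_def outputs_def potential_def tips_def topological_def
      array_holds_def kinds_def offsets_def cells_def grammar_size_def)
  let ?I = "\<lambda>s k. \<exists>rs D. built rs D (reg s 2) s \<and> reg s 2 \<le> V \<and> k = 222 * potential D s (reg s 2) + 550 * reg s 2"
  have I1: "?I s1 (550 * V)" using b1 r1(1) by (intro exI[of _ "[]"] exI[of _ "\<lambda>_. 0"]) simp
  have "\<exists>T s' k'. exec wl (While (Reg 2) build_step) s1 T s' \<and> ?I s' k' \<and> val wl s' (Reg 2) = 0 \<and>
      T + k' \<le> 550 * V + cost (Reg 2) + 1"
  proof (rule exec_While[where I = ?I, OF I1])
    fix s k assume "?I s k" and pos: "val wl s (Reg 2) \<noteq> 0"
    then obtain rs D where s: "built rs D (reg s 2) s" "reg s 2 \<le> V" "k = 222 * potential D s (reg s 2) + 550 * reg s 2"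
      by blast
    from pos have "0 < reg s 2" by simp
    from build_step[OF wl s(1) this s(2)] obtain T s' rs' D' where
      s': "exec wl build_step s T s'" "built rs' D' (reg s' 2) s'" "reg s' 2 = reg s 2 - 1"
      "T + 222 * potential D' s' (reg s' 2) \<le> 222 * potential D s (reg s 2) + 540" by blast
    have "222 * potential D' s' (reg s' 2) + 550 * reg s' 2 + T + cost (Reg 2) + 1 \<le> k"
      using s'(3,4) s(3) \<open>0 < reg s 2\<close> by simp
    moreover have "reg s' 2 \<le> V" using s'(3) s(2) by simp
    ultimately show "\<exists>T s' k'. exec wl build_step s T s' \<and> ?I s' k' \<and> k' + T + cost (Reg 2) + 1 \<le> k"
      using s'(1,2) by blast
  qed
  then obtain T2 s2 rs D where s2: "exec wl (While (Reg 2) build_step) s1 T2 s2" "built rs D 0 s2"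
    "T2 \<le> 550 * V + 2"
    by auto
  define s3 where "s3 = run wl (Set 1 (Bin Sub (Get 17 (Get 12 (Reg 5))) (Const 1))) s2"
  have "loopfree (Set 1 (Bin Sub (Get 17 (Get 12 (Reg 5))) (Const 1)))"
    "maxtime (Set 1 (Bin Sub (Get 17 (Get 12 (Reg 5))) (Const 1))) \<le> 7" by simp_all
  then obtain T3 where T3: "T3 \<le> 7" "exec wl (Set 1 (Bin Sub (Get 17 (Get 12 (Reg 5))) (Const 1))) s2 T3 s3"
    using exec_loopfree le_trans unfolding s3_def by blast
  have run: "exec wl build s (T1 + (T2 + T3)) s3"
    unfolding build_def using T1(2) s2(1) T3(2) by (intro exec.intros(4))
  have V: "0 < V" using start(1) by simp
  have ok: "nodes_ok rs D (processed 0) s2" and last: "ne s2 (tp s2 st) = length rs"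
    and len: "length rs \<le> 6 * V" and st: "st \<in> processed 0"
    using s2(2) V N_st q_0 by (auto simp: built_def processed_def)
  then have v: "vert_ok rs D s2 st" using s2(2) by (simp add: built_def)
  then have t: "tp s2 st < reg s2 21" "nw s2 (tp s2 st) = st" by (auto simp: vert_ok_def)
  note nd = nodes_okD[OF ok t(1)]
  have top: "topological rs" "outputs rs s2" "annotated s2" using ok by (auto simp: nodes_ok_def)
  have ne: "rs \<noteq> []" using nd(5) last by auto
  have ex_st: "List.last (exps rs) = ex st" and ht_st: "List.last (heights rs) = opt_height rs (length rs)"
  proof -
    have "exps rs \<noteq> []" "heights rs \<noteq> []" using ne by (metis length_0_conv length_fold_rules)+
    then have "List.last (exps rs) = opt_exp rs (length rs)" "List.last (heights rs) = opt_height rs (length rs)"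
      using ne by (simp_all add: opt_exp_def opt_height_def last_conv_nth)
    moreover have "opt_exp rs (length rs) = ex st" using nd(1) t(2) last by (simp add: node_ok_def)
    ultimately show "List.last (exps rs) = ex st" "List.last (heights rs) = opt_height rs (length rs)" by simp_all
  qed
  define G' where "G' = \<lparr>rules = rs, start = length rs - 1\<rparr>"
  note G' = topological_grammar[OF top(1) ne, folded G'_def]
  have e: "entries st = 1" by (simp add: entries_def N_st M_st)
  \<comment> \<open>At the start both \<open>N\<close> and \<open>entries\<close> are 1 and the
    length is \<open>n\<close>, so the bound evaluates to \<open>58 * fl n + 29\<close>.\<close>
  have "int (opt_height rs (length rs)) \<le> vertex_bound st"
    using vertex_height[OF ok v] last e by simp
  then have "depth G' \<le> 58 * fl n + 29"
    using G'(3) ht_st e N_st start(2) by (simp add: vertex_bound_def ln_def)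
  moreover have "holds_grammar s3 G'"
  proof -
    have "reg s2 5 = st" using top(3) by (simp add: annotated_def holds_input_def)
    moreover have "0 < wl" "(length rs - 1) mod 2 ^ wl = length rs - 1"
      using wl_pos[OF wl] small_mod[OF wl, of "length rs - 1"] len by auto
    ultimately have "s3 = set_reg 1 (length rs - 1) s2" using last wl_pos[OF wl] by (simp add: s3_def)
    then show ?thesis
      using top(2) by (simp add: holds_grammar_def outputs_def G'_def set_reg_def kinds_def offsets_def cells_def)
  qed
  moreover have "grammar_size G' \<le> 12 * V"
    using grammar_size_le[OF top(1), of "length rs - 1"] len by (simp add: G'_def)
  moreover have "T1 + (T2 + T3) \<le> 600 * V + 50" using T1(1) s2(3) T3(1) by simp
  ultimately show ?thesis using run G'(1,2,4) ex_st by (intro exI[of _ "T1 + (T2 + T3)"] exI[of _ s3] exI[of _ G']) simp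
qed

end

text \<open>Since \<open>floor_log n\<close> is at least 1 here, the additive 29 is absorbed:
  \<open>87 = 58 + 29\<close>.\<close>

lemma depth_log:
  assumes "2 \<le> n" "d \<le> 58 * floor_log n + 29"
  shows "real d \<le> 87 * log 2 (real n)"
proof -
  have "2 ^ floor_log n \<le> n" using assms(1) by (intro floor_log_bounds) simp
  then have "real (floor_log n) \<le> log 2 (real n)" by (intro le_log2_of_power) auto
  moreover have "1 \<le> floor_log n" using floor_log_ge[of 1 n] assms(1) by simp
  then have "d \<le> 87 * floor_log n" using assms(2) by simp
  then have "real d \<le> 87 * real (floor_log n)" by (metis of_nat_le_iff of_nat_mult of_nat_numeral)
  ultimately show ?thesis by linarith
qed

text \<open>The factor 256 leaves room for the key \<open>128 * (ln v * N v)\<close> of a bottom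
  node. A sum of two numbers of \<open>b\<close> bits times \<open>2 ^ 8\<close> needs
  \<open>b + 9\<close> bits, which is at most \<open>10 * b\<close> as \<open>b\<close> is
  positive.\<close>

lemma word_length:
  assumes "fits b n G" "10 * b \<le> wl" "0 < grammar_size G"
  shows "256 * (n + grammar_size G) < 2 ^ wl"
proof -
  have *: "n < 2 ^ b" "grammar_size G < 2 ^ b" using assms(1) by (auto simp: fits_def)
  have "0 < b" using assms(3) *(2) by (cases b) auto
  then have "b + 9 \<le> wl" using assms(2) by linarith
  then have "(2::nat) ^ (b + 9) \<le> 2 ^ wl" by (intro power_increasing) auto
  then show ?thesis using * by (simp add: power_add)
qed

definition balance :: com where
  "balance = Seq binarize (Seq toposort (Seq measure_all build))"

theorem theorem1:
  "\<exists>(P :: com) (k :: nat) (c_time :: nat) (c_size :: nat) (c_depth :: real).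
     \<forall>(G :: nat rlslp) (w :: nat list) (n :: nat) (b :: nat) (wl :: nat).
       is_rlslp G \<and> generates G w \<and> length w = n \<and> fits b n G \<and> k * b \<le> wl \<longrightarrow>
       (\<exists>(G' :: nat rlslp) (T :: nat) (s :: state).
          exec wl P (initial G) T s \<and> T \<le> c_time * grammar_size G \<and>
          holds_grammar s G' \<and>
          is_rlslp G' \<and> generates G' w \<and>
          grammar_size G' \<le> c_size * grammar_size G \<and>
          (n \<ge> 2 \<longrightarrow> real (depth G') \<le> c_depth * log 2 (real n)) \<and>
          (\<forall>R \<in> set (rules G'). normal_rhs R))"
proof (rule exI[of _ balance], rule exI[of _ 10], rule exI[of _ 2000], rule exI[of _ 12], rule exI[of _ 87],
    intro allI impI)
  fix G :: "nat rlslp" and w :: "nat list" and n b wl :: nat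
  assume asm: "is_rlslp G \<and> generates G w \<and> length w = n \<and> fits b n G \<and> 10 * b \<le> wl"
  let ?V = "grammar_size G"
  interpret G: rlslp_input G w using asm by unfold_locales auto
  have n: "length w = n" using asm by blast
  have pos: "0 < ?V" using G.off_less[OF G.start_less] G.size_pos[OF G.start_less] by fastforce
  have wl: "256 * (n + ?V) < 2 ^ wl" using word_length asm pos by blast
  have "?V + 2 < 2 ^ wl" using wl pos by simp
  then obtain T1 s1 where s1: "exec wl binarize (initial G) T1 s1" "T1 \<le> 100 * (?V + 1)"
    "binary_grammar ?V (reg s1 5) n (arr s1 3) (arr s1 4) (arr s1 5) G.suffixes"
    "G.suffixes (reg s1 5) = w" "reg s1 4 = ?V"
    using G.terminates_binarize n unfolding terminates_def by blast
  interpret B: binary_grammar ?V "reg s1 5" n "arr s1 3" "arr s1 4" "arr s1 5" G.suffixes by (rule s1(3))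
  have "arr s1 a = arr (initial G) a" if "a \<notin> {3, 4, 5}" for a
    using exec_frame[OF s1(1)] that by (simp add: binarize_def binarize_step_def binarize_vertex_def)
  then have zero: "arr s1 a v = 0" if "a \<in> {6, 8, 10, 11}" for a v
    using that by (auto simp: initial_def)
  have "B.holds_input s1" by (simp add: B.holds_input_def s1(5))
  then obtain T2 s2 where s2: "exec wl toposort s1 T2 s2" "T2 \<le> 200 * (?V + 1)" "B.holds_input s2"
    "B.traversal (arr s2 7) (arr s2 8)"
    using B.terminates_toposort[OF wl] zero unfolding terminates_def by blast
  interpret R: traversed ?V "reg s1 5" n "arr s1 3" "arr s1 4" "arr s1 5" G.suffixes "arr s2 7" "arr s2 8"
    by unfold_locales (rule s2(4))
  have "arr s2 a = arr s1 a" if "a \<in> {10, 11}" for a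
    using exec_frame[OF s2(1)] that
    by (auto simp: toposort_def indegree_step_def seed_step_def kahn_step_def visit_def)
  then have "arr s2 10 v = 0" "arr s2 11 v = 0" for v using zero by auto
  then obtain T3 s3 where s3: "exec wl measure_all s2 T3 s3" "T3 \<le> 200 * (?V + 1)" "R.annotated s3"
    using R.terminates_measure_all[OF wl s2(3) refl refl] unfolding terminates_def by blast
  obtain T4 s4 G' where s4: "exec wl build s3 T4 s4" "T4 \<le> 600 * ?V + 50" "holds_grammar s4 G'" "is_rlslp G'"
    "generates G' w" "grammar_size G' \<le> 12 * ?V" "depth G' \<le> 58 * floor_log n + 29"
    "\<forall>R \<in> set (rules G'). normal_rhs R"
    using R.build[OF wl s3(3)] unfolding s1(4) by blast
  have "exec wl balance (initial G) (T1 + (T2 + (T3 + T4))) s4"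
    unfolding balance_def using s1(1) s2(1) s3(1) s4(1) by (intro exec.intros(4))
  \<comment> \<open>The four phases together take at most \<open>1100 * ?V + 550\<close> units, and
    \<open>?V\<close> is positive.\<close>
  moreover have "T1 + (T2 + (T3 + T4)) \<le> 2000 * ?V" using s1(2) s2(2) s3(2) s4(2) pos by simp
  ultimately show "\<exists>(G' :: nat rlslp) (T :: nat) (s :: state).
      exec wl balance (initial G) T s \<and> T \<le> 2000 * ?V \<and> holds_grammar s G' \<and> is_rlslp G' \<and> generates G' w \<and>
      grammar_size G' \<le> 12 * ?V \<and> (n \<ge> 2 \<longrightarrow> real (depth G') \<le> 87 * log 2 (real n)) \<and>
      (\<forall>R \<in> set (rules G'). normal_rhs R)"
    using s4(3-8) depth_log by blast
qed

end
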